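(* For every $\beta > 0$ there exist $N=N(\beta)$ and $\delta=\delta(\beta)>0$ such that every graph $G$ with $n > N$ vertices and $m \ge \beta n^2$ edges satisfying $\tau_t(G) \ge (1-\delta)\frac{m}{2}$ also satisfies $$\nu_t(G) \ge \left(1+\frac{\beta^2}{800}\right)\frac{m}{4}.$$
   Context: All graphs are finite, simple and undirected. A triangle cover of a graph $G$ is a set of edges meeting every triangle of $G$; $\tau_t(G)$ is the minimum size of a triangle cover. A triangle packing is a set of pairwise edge-disjoint triangles of $G$; $\nu_t(G)$ is the maximum size of a triangle packing. A graph with $m$ edges satisfying $\tau_t(G)\ge(1-\delta)m/2$ is called $(1-\delta)$-hard to make triangle-free. *)

theory Defs
  imports Complex_Main "HOL-Library.Ramsey"
begin

(* nsets A k is the set of k-element subsets of A: an edge of a simple undirected graph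
   is a 2-element set of vertices, and a triangle is identified with its vertex set T,
   so that its edges are the elements of nsets T 2. *)

locale simple_graph =
  fixes V :: "'a set" and E :: "'a set set"
  assumes finite_V: "finite V"
    and edges: "E \<subseteq> nsets V 2"

definition triangles :: "'a set \<Rightarrow> 'a set set \<Rightarrow> 'a set set" where
  "triangles V E = {T \<in> nsets V 3. nsets T 2 \<subseteq> E}"

definition triangle_cover :: "'a set \<Rightarrow> 'a set set \<Rightarrow> 'a set set \<Rightarrow> bool" where
  "triangle_cover V E C \<longleftrightarrow> C \<subseteq> E \<and> (\<forall>T\<in>triangles V E. C \<inter> nsets T 2 \<noteq> {})"

definition triangle_packing :: "'a set \<Rightarrow> 'a set set \<Rightarrow> 'a set set \<Rightarrow> bool" where
  "triangle_packing V E P \<longleftrightarrow>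
     P \<subseteq> triangles V E \<and> pairwise (\<lambda>S T. disjnt (nsets S 2) (nsets T 2)) P"

definition tau_t :: "'a set \<Rightarrow> 'a set set \<Rightarrow> nat" where
  "tau_t V E = Min (card ` {C. triangle_cover V E C})"

definition nu_t :: "'a set \<Rightarrow> 'a set set \<Rightarrow> nat" where
  "nu_t V E = Max (card ` {P. triangle_packing V E P})"

(* The sets under Min and Max are finite and nonempty, so both extrema are attained. *)

context simple_graph
begin

lemma finite_E: "finite E"
  using finite_subset[OF edges] finite_V by (simp add: finite_imp_finite_nsets)

lemma finite_triangles: "finite (triangles V E)"
  unfolding triangles_def using finite_V by (simp add: finite_imp_finite_nsets)

lemma triangle_cover_all: "triangle_cover V E E"
  unfolding triangle_cover_def
proof (intro conjI ballI)
  fix T assume T: "T \<in> triangles V E"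
  then have "finite T" "card T = 3" "nsets T 2 \<subseteq> E"
    by (auto simp: triangles_def nsets_def)
  moreover from this have "card (nsets T 2) = 3"
    by (simp add: card_nsets choose_two)
  ultimately show "E \<inter> nsets T 2 \<noteq> {}"
    by (metis Int_absorb1 card.empty zero_neq_numeral)
qed simp

lemma finite_triangle_covers: "finite {C. triangle_cover V E C}"
  by (rule finite_subset[of _ "Pow E"]) (auto simp: triangle_cover_def finite_E)

lemma finite_triangle_packings: "finite {P. triangle_packing V E P}"
  by (rule finite_subset[of _ "Pow (triangles V E)"])
    (auto simp: triangle_packing_def finite_triangles)

lemma triangle_packing_empty: "triangle_packing V E {}"
  by (simp add: triangle_packing_def)

lemma tau_t_attained: "\<exists>C. triangle_cover V E C \<and> card C = tau_t V E"
proof -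
  have "tau_t V E \<in> card ` {C. triangle_cover V E C}"
    unfolding tau_t_def
    by (rule Min_in) (use finite_triangle_covers triangle_cover_all in auto)
  then show ?thesis by force
qed

lemma tau_t_le: "triangle_cover V E C \<Longrightarrow> tau_t V E \<le> card C"
  unfolding tau_t_def using finite_triangle_covers by auto

lemma nu_t_attained: "\<exists>P. triangle_packing V E P \<and> card P = nu_t V E"
proof -
  have "nu_t V E \<in> card ` {P. triangle_packing V E P}"
    unfolding nu_t_def
    by (rule Max_in) (use finite_triangle_packings triangle_packing_empty in auto)
  then show ?thesis by force
qed

lemma nu_t_ge: "triangle_packing V E P \<Longrightarrow> card P \<le> nu_t V E"
  unfolding nu_t_def using finite_triangle_packings by auto

end

end

theory Submission
  imports Defs "HOL-Analysis.Convex"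
begin

text \<open>Consider fractional triangle packings in which every triangle has weight \<open>O(1 / n)\<close>. Such a
  packing is turned into an integral one with loss \<open>o(n\<^sup>2)\<close> by a derandomized nibble. If no such
  packing has weight \<open>(1 + \<beta>\<^sup>2 / 800 + o(1)) m / 4\<close>, a penalty version of LP duality gives edge
  weights \<open>f\<close> of total at most about \<open>(1 + \<beta>\<^sup>2 / 800) m / 4\<close> which cover all but \<open>o(n\<^sup>3)\<close>
  triangles, and a coloured triangle removal lemma makes \<open>f\<close> a fractional cover after the deletion
  of \<open>o(n\<^sup>2)\<close> edges. Rounding \<open>f\<close> gives a triangle cover of size at most \<open>2 * (\<Sum>e. f e)\<close>, with a saving
  unless almost all values of \<open>f\<close> are near \<open>0\<close> or \<open>1 / 2\<close>; as \<open>\<tau>\<close> is close to \<open>m / 2\<close>, this is the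
  case. The neighbourhood of a suitable vertex in the graph of edges with \<open>f \<approx> 0\<close> then spans
  few edges but has total degree at least \<open>\<beta> m / 4\<close>, which produces a cut with noticeably more
  than \<open>m / 2\<close> edges. The edges outside a cut form a triangle cover, a contradiction.\<close>

subsection \<open>Near-optimal matchings in linear triple systems\<close>

text \<open>The graph enters as a linear triple system: the points are its edges, the triples are
  the edge sets of triangles, and distinct triangles share at most one edge. Linearity is why a cap
  on the weights suffices for the nibble: the weight through two given points is that of at most one
  triple. The cap \<open>\<eta>\<close> that is used is a constant depending on
  \<open>\<beta>\<close> only. A triangle that the dual weights fail to cover carries the full
  capped weight, and the total weight is at most \<open>m\<close>, so at most
  \<open>m / \<eta> = O(n\<^sup>2)\<close> triangles are uncovered; for large \<open>n\<close> this
  is below the cubic threshold of the removal lemma. Removal handles finitely many colours, so the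
  dual weights are rounded up to multiples of \<open>1 / (3 * J)\<close>, with \<open>J\<close>
  depending on \<open>\<beta>\<close> only. The gain of order \<open>\<beta>\<^sup>2\<close> has its
  origin in the final cut. A neighbourhood with degree sum at least \<open>\<beta> * m / 4\<close>,
  given sign 1 against mean sign \<open>- p\<close> elsewhere, gains
  \<open>p * \<beta> * m / 4\<close> and costs \<open>p\<^sup>2 * m\<close>; the best choice
  \<open>p = \<beta> / 8\<close> leaves \<open>\<beta>\<^sup>2 * m / 64\<close>, and all other
  errors are kept below that.\<close>

locale weighted_triples =
  fixes X :: "'b set" and H :: "'b set set" and w :: "'b set \<Rightarrow> real" and \<eta> :: real
  assumes finite_X: "finite X"
    and H_subset: "T \<in> H \<Longrightarrow> T \<subseteq> X"
    and H_card: "T \<in> H \<Longrightarrow> card T = 3"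
    and H_linear: "S \<in> H \<Longrightarrow> T \<in> H \<Longrightarrow> S \<noteq> T \<Longrightarrow> card (S \<inter> T) \<le> 1"
    and w_nonneg: "T \<in> H \<Longrightarrow> 0 \<le> w T"
    and w_le: "T \<in> H \<Longrightarrow> w T \<le> \<eta>"
    and eta_nonneg: "0 \<le> \<eta>"
    and degree_le_1: "e \<in> X \<Longrightarrow> (\<Sum>T\<in>H. w T * of_bool (e \<in> T)) \<le> 1"
begin

definition alive :: "'b set \<Rightarrow> 'b set set" where
  "alive Y = {T \<in> H. T \<subseteq> Y}"

definition deg :: "'b set \<Rightarrow> 'b \<Rightarrow> real" where
  "deg Y e = (\<Sum>T\<in>alive Y. w T * of_bool (e \<in> T))"

definition link :: "'b set \<Rightarrow> 'b \<Rightarrow> 'b \<Rightarrow> real" where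
  "link Y e f = (\<Sum>T\<in>alive Y. w T * of_bool (e \<in> T \<and> f \<in> T \<and> e \<noteq> f))"

text \<open>If every point survived independently with probability \<open>p\<close>, a triple at
  \<open>e\<close> would keep its other two points with probability \<open>p\<^sup>2\<close>. This
  is the departure from the degree so predicted.\<close>

definition dev :: "'b set \<Rightarrow> real \<Rightarrow> 'b \<Rightarrow> real" where
  "dev Y p e = deg Y e - deg X e * p\<^sup>2"

definition dev2 :: "'b set \<Rightarrow> real \<Rightarrow> real" where
  "dev2 Y p = (\<Sum>e\<in>Y. (dev Y p e)\<^sup>2)"

section \<open>Weighted degrees and links of the surviving triples\<close>

lemma finite_H: "finite H"
  by (rule finite_subset[of _ "Pow X"]) (use H_subset finite_X in auto)

lemma finite_alive: "finite (alive Y)"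
  using finite_H by (simp add: alive_def)

lemma alive_X: "alive X = H"
  using H_subset by (auto simp: alive_def)

lemma finite_T: "T \<in> H \<Longrightarrow> finite T"
  using H_subset finite_X finite_subset by blast

lemma deg_nonneg: "0 \<le> deg Y e"
  unfolding deg_def by (intro sum_nonneg) (auto simp: alive_def w_nonneg)

lemma link_nonneg: "0 \<le> link Y e f"
  unfolding link_def by (intro sum_nonneg) (auto simp: alive_def w_nonneg)

lemma link_sym: "link Y e f = link Y f e"
  unfolding link_def by (intro sum.cong) auto

lemma deg_mono: "deg Y e \<le> deg X e"
  unfolding deg_def alive_X
  by (rule sum_mono2) (auto simp: alive_def w_nonneg finite_H)

lemma deg_X_le_1: "e \<in> X \<Longrightarrow> deg X e \<le> 1"
  unfolding deg_def alive_X using degree_le_1 .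

lemma deg_le_1: "e \<in> X \<Longrightarrow> deg Y e \<le> 1"
  using deg_mono deg_X_le_1 order_trans by blast

lemma sum_mult_deg:
  assumes "Y \<subseteq> X"
  shows "(\<Sum>e\<in>Y. c e * deg Y e) = (\<Sum>T\<in>alive Y. w T * (\<Sum>e\<in>T. c e))"
proof -
  have "(\<Sum>e\<in>Y. c e * deg Y e) = (\<Sum>e\<in>Y. \<Sum>T\<in>alive Y. w T * (c e * of_bool (e \<in> T)))"
    unfolding deg_def by (simp add: sum_distrib_left mult_ac)
  also have "\<dots> = (\<Sum>T\<in>alive Y. \<Sum>e\<in>Y. w T * (c e * of_bool (e \<in> T)))"
    by (rule sum.swap)
  also have "\<dots> = (\<Sum>T\<in>alive Y. w T * (\<Sum>e\<in>T. c e))"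
  proof (rule sum.cong[OF refl])
    fix T assume T: "T \<in> alive Y"
    then have "T \<subseteq> Y" by (auto simp: alive_def)
    moreover have "finite Y" using assms finite_X finite_subset by blast
    ultimately have "(\<Sum>e\<in>Y. c e * of_bool (e \<in> T)) = (\<Sum>e\<in>T. c e)"
      by (intro sum.mono_neutral_cong_right) auto
    then show "(\<Sum>e\<in>Y. w T * (c e * of_bool (e \<in> T))) = w T * (\<Sum>e\<in>T. c e)"
      by (simp flip: sum_distrib_left)
  qed
  finally show ?thesis .
qed

lemma sum_deg:
  assumes "Y \<subseteq> X"
  shows "(\<Sum>e\<in>Y. deg Y e) = 3 * (\<Sum>T\<in>alive Y. w T)"
proof -
  have "(\<Sum>e\<in>Y. deg Y e) = (\<Sum>T\<in>alive Y. w T * (\<Sum>e\<in>T. 1))"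
    using sum_mult_deg[OF assms, of "\<lambda>_. 1"] by simp
  also have "\<dots> = (\<Sum>T\<in>alive Y. w T * 3)"
    by (intro sum.cong) (auto simp: alive_def H_card)
  finally show ?thesis by (simp flip: sum_distrib_right)
qed

lemma sum_link_subset:
  assumes "S \<subseteq> Y" "Y \<subseteq> X"
  shows "(\<Sum>f\<in>S. link Y e f) = (\<Sum>T\<in>alive Y. w T * of_bool (e \<in> T) * card (T \<inter> S - {e}))"
proof -
  have fin: "finite S" using assms finite_X by (meson finite_subset)
  have "(\<Sum>f\<in>S. link Y e f)
      = (\<Sum>T\<in>alive Y. \<Sum>f\<in>S. w T * of_bool (e \<in> T \<and> f \<in> T \<and> e \<noteq> f))"
    unfolding link_def by (rule sum.swap)
  also have "\<dots> = (\<Sum>T\<in>alive Y. w T * of_bool (e \<in> T) * card (T \<inter> S - {e}))"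
  proof (rule sum.cong[OF refl])
    fix T
    have "(\<Sum>f\<in>S. of_bool (f \<in> T \<and> e \<noteq> f)) = real (card (T \<inter> S - {e}))"
    proof -
      have "S \<inter> {f. f \<in> T \<and> e \<noteq> f} = T \<inter> S - {e}" by auto
      then show ?thesis using fin by (simp add: sum_of_bool_eq)
    qed
    moreover have "(\<Sum>f\<in>S. w T * of_bool (e \<in> T \<and> f \<in> T \<and> e \<noteq> f))
        = w T * of_bool (e \<in> T) * (\<Sum>f\<in>S. of_bool (f \<in> T \<and> e \<noteq> f))"
      by (simp add: sum_distrib_left of_bool_conj mult_ac)
    ultimately show "(\<Sum>f\<in>S. w T * of_bool (e \<in> T \<and> f \<in> T \<and> e \<noteq> f))
        = w T * of_bool (e \<in> T) * real (card (T \<inter> S - {e}))"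
      by simp
  qed
  finally show ?thesis .
qed

lemma sum_link:
  assumes "Y \<subseteq> X"
  shows "(\<Sum>f\<in>Y. link Y e f) = 2 * deg Y e"
proof -
  have "(\<Sum>f\<in>Y. link Y e f) = (\<Sum>T\<in>alive Y. w T * of_bool (e \<in> T) * 2)"
    unfolding sum_link_subset[OF subset_refl assms]
  proof (rule sum.cong[OF refl])
    fix T assume T: "T \<in> alive Y"
    then have "T \<inter> Y = T" "finite T" "card T = 3"
      using finite_T H_card by (auto simp: alive_def)
    then show "w T * of_bool (e \<in> T) * real (card (T \<inter> Y - {e})) = w T * of_bool (e \<in> T) * 2"
      by (cases "e \<in> T") auto
  qed
  then show ?thesis unfolding deg_def by (simp add: sum_distrib_left mult_ac)
qed

text \<open>Linearity allows only one triple through two distinct points, so a nonzero link is a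
  single weight.\<close>

lemma link_le: "link Y e f \<le> \<eta>"
proof (cases "\<exists>T\<in>alive Y. e \<in> T \<and> f \<in> T \<and> e \<noteq> f")
  case True
  then obtain T where T: "T \<in> alive Y" "e \<in> T" "f \<in> T" "e \<noteq> f" by auto
  have uniq: "S = T" if "S \<in> alive Y" "e \<in> S" "f \<in> S" for S
  proof (rule ccontr)
    assume "S \<noteq> T"
    then have "card (S \<inter> T) \<le> 1"
      using that T H_linear by (auto simp: alive_def)
    moreover have "card {e, f} \<le> card (S \<inter> T)"
      using that T finite_T by (intro card_mono) (auto simp: alive_def)
    ultimately show False using T by simp
  qed
  have "of_bool (e \<in> S \<and> f \<in> S \<and> e \<noteq> f) = (of_bool (S = T) :: real)" if "S \<in> alive Y" for S
    using uniq[OF that] T by (cases "S = T") auto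
  then have "link Y e f = (\<Sum>S\<in>alive Y. w S * of_bool (S = T))"
    unfolding link_def by (intro sum.cong) auto
  also have "\<dots> = w T"
    using T finite_alive by (simp add: of_bool_def if_distrib cong: if_cong)
  finally have "link Y e f = w T" .
  then show ?thesis using T w_le by (auto simp: alive_def)
next
  case False
  then have "link Y e f = 0" unfolding link_def by (intro sum.neutral) auto
  then show ?thesis using eta_nonneg by simp
qed

text \<open>The last assumption ensures that no triple at \<open>e\<close> loses two points at once,
  so summing links over \<open>S\<close> counts every destroyed triple exactly once.\<close>

lemma deg_remove:
  assumes "Y \<subseteq> X" "S \<subseteq> Y" "e \<in> Y - S"
    and S: "\<And>T. T \<in> alive Y \<Longrightarrow> e \<in> T \<Longrightarrow> card (T \<inter> S) \<le> 1"
  shows "deg (Y - S) e = deg Y e - (\<Sum>f\<in>S. link Y e f)"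
proof -
  have "deg (Y - S) e = (\<Sum>T\<in>alive Y. w T * of_bool (e \<in> T) * of_bool (T \<inter> S = {}))"
    unfolding deg_def
    by (rule sum.mono_neutral_cong_left) (auto simp: alive_def finite_H)
  also have "\<dots> = (\<Sum>T\<in>alive Y. w T * of_bool (e \<in> T) - w T * of_bool (e \<in> T) * card (T \<inter> S - {e}))"
  proof (rule sum.cong[OF refl])
    fix T assume T: "T \<in> alive Y"
    show "w T * of_bool (e \<in> T) * of_bool (T \<inter> S = {})
        = w T * of_bool (e \<in> T) - w T * of_bool (e \<in> T) * real (card (T \<inter> S - {e}))"
    proof (cases "e \<in> T")
      case True
      have "finite (T \<inter> S)" using T finite_T by (auto simp: alive_def)
      moreover have "T \<inter> S - {e} = T \<inter> S" using assms(3) by auto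
      ultimately have "of_bool (T \<inter> S = {}) = 1 - real (card (T \<inter> S - {e}))"
        using S[OF T True] by (cases "T \<inter> S = {}") (auto simp: le_Suc_eq)
      then show ?thesis by (simp only: right_diff_distrib mult_1_right)
    qed simp
  qed
  also have "\<dots> = deg Y e - (\<Sum>f\<in>S. link Y e f)"
    unfolding sum_link_subset[OF assms(2,1)] deg_def by (simp add: sum_subtractf)
  finally show ?thesis .
qed

text \<open>One step of a lazy random process on the set \<open>Y\<close> of uncovered points: a triple \<open>T\<close> is
  selected with probability \<open>w T * h / p ^ 3\<close>, a single point \<open>e\<close> is discarded with probability
  \<open>(1 - deg X e) * h / p\<close>, and otherwise nothing happens. Discarding at this rate makes every
  point disappear at rate about \<open>h / p\<close> whatever its degree, so that \<open>deg Y e\<close> stays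
  near \<open>deg X e * p\<^sup>2\<close>. The functional \<open>avg\<close> is the expectation over the non-idle moves.\<close>

definition avg :: "'b set \<Rightarrow> real \<Rightarrow> real \<Rightarrow> ('b set \<Rightarrow> real) \<Rightarrow> real" where
  "avg Y p h F = (\<Sum>T\<in>alive Y. w T * (h / p ^ 3) * F T) + (\<Sum>e\<in>Y. (1 - deg X e) * (h / p) * F {e})"

definition moves :: "'b set \<Rightarrow> 'b set set" where
  "moves Y = alive Y \<union> (\<lambda>e. {e}) ` Y"

section \<open>Expected change of the potential in one step\<close>

lemma avg_add: "avg Y p h (\<lambda>S. F S + G S) = avg Y p h F + avg Y p h G"
  unfolding avg_def by (simp add: distrib_left sum.distrib)

lemma avg_cmult: "avg Y p h (\<lambda>S. c * F S) = c * avg Y p h F"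
  unfolding avg_def by (simp add: sum_distrib_left distrib_left mult_ac)

lemma avg_sum: "avg Y p h (\<lambda>S. \<Sum>e\<in>A. F e S) = (\<Sum>e\<in>A. avg Y p h (F e))"
proof -
  have "(\<Sum>T\<in>alive Y. w T * (h / p ^ 3) * (\<Sum>e\<in>A. F e T))
      = (\<Sum>e\<in>A. \<Sum>T\<in>alive Y. w T * (h / p ^ 3) * F e T)"
    unfolding sum_distrib_left by (rule sum.swap)
  moreover have "(\<Sum>f\<in>Y. (1 - deg X f) * (h / p) * (\<Sum>e\<in>A. F e {f}))
      = (\<Sum>e\<in>A. \<Sum>f\<in>Y. (1 - deg X f) * (h / p) * F e {f})"
    unfolding sum_distrib_left by (rule sum.swap)
  ultimately show ?thesis unfolding avg_def sum.distrib by simp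
qed

lemma avg_mono:
  assumes "Y \<subseteq> X" "0 < p" "0 \<le> h" "\<And>S. S \<in> moves Y \<Longrightarrow> F S \<le> G S"
  shows "avg Y p h F \<le> avg Y p h G"
  unfolding avg_def
proof (intro add_mono sum_mono mult_left_mono)
  fix T assume "T \<in> alive Y"
  then show "F T \<le> G T" "0 \<le> w T * (h / p ^ 3)"
    using assms w_nonneg by (auto simp: moves_def alive_def)
next
  fix e assume "e \<in> Y"
  then show "F {e} \<le> G {e}" "0 \<le> (1 - deg X e) * (h / p)"
    using assms deg_X_le_1[of e] by (auto simp: moves_def)
qed

text \<open>Split \<open>deg Y f\<close> into \<open>dev Y p f\<close> and
  \<open>deg X f * p\<^sup>2\<close>. The second part removes \<open>f\<close> at rate
  \<open>deg X f * h / p\<close>, and discarding supplies exactly the missing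
  \<open>(1 - deg X f) * h / p\<close>.\<close>

lemma avg_additive:
  assumes "Y \<subseteq> X" "0 < p"
  shows "avg Y p h (\<lambda>S. \<Sum>f\<in>S. c f) = (\<Sum>f\<in>Y. c f * (h / p + h / p ^ 3 * dev Y p f))"
proof -
  have "(\<Sum>T\<in>alive Y. w T * (h / p ^ 3) * (\<Sum>f\<in>T. c f))
      = h / p ^ 3 * (\<Sum>T\<in>alive Y. w T * (\<Sum>f\<in>T. c f))"
    unfolding sum_distrib_left by (intro sum.cong) (simp_all add: sum_distrib_left mult_ac)
  also have "\<dots> = h / p ^ 3 * (\<Sum>f\<in>Y. c f * deg Y f)"
    by (simp only: sum_mult_deg[OF assms(1)])
  also have "\<dots> = (\<Sum>f\<in>Y. c f * (h / p ^ 3 * deg Y f))"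
    by (simp add: sum_distrib_left mult_ac)
  finally have "avg Y p h (\<lambda>S. \<Sum>f\<in>S. c f)
      = (\<Sum>f\<in>Y. c f * (h / p ^ 3 * deg Y f) + (1 - deg X f) * (h / p) * c f)"
    unfolding avg_def by (simp add: sum.distrib)
  also have "\<dots> = (\<Sum>f\<in>Y. c f * (h / p + h / p ^ 3 * dev Y p f))"
    by (intro sum.cong refl) (use assms(2) in \<open>simp add: dev_def field_simps power2_eq_square power3_eq_cube\<close>)
  finally show ?thesis .
qed

lemma avg_in_H:
  assumes "Y \<subseteq> X"
  shows "avg Y p h (\<lambda>S. of_bool (S \<in> H)) = h / p ^ 3 * (\<Sum>e\<in>Y. deg Y e) / 3"
proof -
  have "{e} \<notin> H" for e using H_card[of "{e}"] by auto
  then have "avg Y p h (\<lambda>S. of_bool (S \<in> H)) = (\<Sum>T\<in>alive Y. w T * (h / p ^ 3))"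
    unfolding avg_def by (simp add: alive_def)
  then show ?thesis unfolding sum_deg[OF assms] by (simp add: sum_distrib_left sum_distrib_right mult_ac)
qed

lemma abs_dev_le_1:
  assumes "e \<in> X" "0 \<le> p" "p \<le> 1"
  shows "\<bar>dev Y p e\<bar> \<le> 1"
proof -
  have "0 \<le> p\<^sup>2" "p\<^sup>2 \<le> 1" using assms by (auto simp: power_le_one)
  then have "0 \<le> deg X e * p\<^sup>2" "deg X e * p\<^sup>2 \<le> 1"
    using deg_nonneg[of X e] deg_X_le_1[OF assms(1)] by (auto simp: mult_le_one)
  then show ?thesis
    unfolding dev_def using deg_nonneg[of Y e] deg_le_1[OF assms(1), of Y] by auto
qed

text \<open>This is the probability of moving at all. It has to stay below 1 to leave room for the
  idle move, and it multiplies every error that is uniform over the moves.\<close>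

lemma avg_one_le:
  assumes "Y \<subseteq> X" "0 < p" "p \<le> 1" "0 \<le> h"
  shows "avg Y p h (\<lambda>_. 1) \<le> 2 * h * card X / p ^ 3"
proof -
  have fY: "finite Y" "card Y \<le> card X" using assms finite_X by (auto intro: finite_subset card_mono)
  have "3 * (\<Sum>T\<in>alive Y. w T) \<le> (\<Sum>e\<in>Y. 1)"
    unfolding sum_deg[OF assms(1), symmetric] using assms deg_le_1 by (intro sum_mono) auto
  then have W: "3 * (\<Sum>T\<in>alive Y. w T) \<le> card X" using fY by simp
  have W0: "0 \<le> (\<Sum>T\<in>alive Y. w T)" by (intro sum_nonneg) (auto simp: alive_def w_nonneg)
  have "(\<Sum>T\<in>alive Y. w T * (h / p ^ 3) * 1) = h / p ^ 3 * (\<Sum>T\<in>alive Y. w T)"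
    by (simp add: sum_distrib_left sum_divide_distrib mult_ac)
  also have "\<dots> \<le> h / p ^ 3 * card X" using assms W W0 by (intro mult_left_mono) auto
  finally have 1: "(\<Sum>T\<in>alive Y. w T * (h / p ^ 3) * 1) \<le> h / p ^ 3 * card X" .
  have "p ^ 3 \<le> p ^ 1" using assms by (intro power_decreasing) auto
  then have hp: "h / p \<le> h / p ^ 3" using assms by (intro divide_left_mono) auto
  have "(\<Sum>e\<in>Y. (1 - deg X e) * (h / p) * 1) \<le> (\<Sum>e\<in>Y. h / p ^ 3)"
  proof (rule sum_mono)
    fix e assume "e \<in> Y"
    have "(1 - deg X e) * (h / p) \<le> 1 * (h / p)"
      using deg_nonneg[of X e] assms by (intro mult_right_mono) auto
    then show "(1 - deg X e) * (h / p) * 1 \<le> h / p ^ 3" using hp by simp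
  qed
  also have "\<dots> \<le> h / p ^ 3 * card X" using fY assms by (simp add: mult.commute mult_left_mono divide_right_mono)
  finally have "(\<Sum>e\<in>Y. (1 - deg X e) * (h / p) * 1) \<le> h / p ^ 3 * card X" .
  moreover have "2 * h * card X / p ^ 3 = h / p ^ 3 * card X + h / p ^ 3 * card X" by simp
  ultimately show ?thesis unfolding avg_def using 1 by linarith
qed

text \<open>The coefficient \<open>(1 - p0 / p) / 3\<close> is chosen so that, with
  \<open>h = p - p'\<close>, all terms free of deviations cancel. What remains has coefficients
  \<open>c * deg X f - 1 / 3\<close> on the deviations, of modulus at most
  \<open>1 / 3\<close>.\<close>

lemma linear_drift:
  assumes "Y \<subseteq> X" "0 < p0" "p0 \<le> p'" "p' = p - h" "0 \<le> h"
  shows "avg Y p h (\<lambda>S. (1 - p0 / p') / 3 * (\<Sum>f\<in>S. deg X f) - of_bool (S \<in> H))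
      + ((1 - p0 / p) / 3 - (1 - p0 / p') / 3) * (\<Sum>f\<in>Y. deg X f)
    \<le> h / (3 * p ^ 3) * (\<Sum>e\<in>Y. \<bar>dev Y p e\<bar>)"
proof -
  define c where "c = (1 - p0 / p') / 3"
  define A where "A = (\<Sum>f\<in>Y. deg X f)"
  have p: "0 < p" "0 < p'" using assms by auto
  have c: "0 \<le> c" "c \<le> 1/3" using assms p unfolding c_def by auto
  have "avg Y p h (\<lambda>S. c * (\<Sum>f\<in>S. deg X f) - of_bool (S \<in> H))
      = avg Y p h (\<lambda>S. c * (\<Sum>f\<in>S. deg X f) + (-1) * of_bool (S \<in> H))" by simp
  also have "\<dots> = c * avg Y p h (\<lambda>S. \<Sum>f\<in>S. deg X f) + (-1) * avg Y p h (\<lambda>S. of_bool (S \<in> H))"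
    by (simp only: avg_add avg_cmult)
  also have "\<dots> = c * (\<Sum>f\<in>Y. deg X f * (h / p + h / p ^ 3 * dev Y p f)) - h / p ^ 3 * (\<Sum>e\<in>Y. deg Y e) / 3"
    by (simp add: avg_additive[OF assms(1) p(1)] avg_in_H[OF assms(1)])
  also have "(\<Sum>e\<in>Y. deg Y e) = (\<Sum>e\<in>Y. dev Y p e) + p\<^sup>2 * A"
    unfolding dev_def A_def by (simp add: sum_subtractf sum_distrib_left mult_ac)
  also have "(\<Sum>f\<in>Y. deg X f * (h / p + h / p ^ 3 * dev Y p f))
      = h / p * A + h / p ^ 3 * (\<Sum>f\<in>Y. deg X f * dev Y p f)"
    unfolding A_def by (simp add: distrib_left sum.distrib sum_distrib_left mult_ac)
  finally have eq: "avg Y p h (\<lambda>S. c * (\<Sum>f\<in>S. deg X f) - of_bool (S \<in> H))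
     + ((1 - p0 / p) / 3 - c) * A
     = h / p ^ 3 * (\<Sum>f\<in>Y. c * (deg X f * dev Y p f))  - h / p ^ 3 * (\<Sum>e\<in>Y. dev Y p e / 3)
       + (c * h / p - h / p ^ 3 * p\<^sup>2 / 3 + (1 - p0 / p) / 3 - c) * A"
    by (simp add: algebra_simps sum_distrib_left[symmetric] sum_divide_distrib[symmetric] add_divide_distrib)
  have "c * h / p - h / p ^ 3 * p\<^sup>2 / 3 + (1 - p0 / p) / 3 - c = 0"
  proof -
    have h: "h = p - p'" using assms(4) by simp
    show ?thesis
      using p unfolding c_def h by (simp add: field_simps power2_eq_square power3_eq_cube)
  qed
  moreover have "(\<Sum>f\<in>Y. (c * deg X f - 1 / 3) * dev Y p f)
      = (\<Sum>f\<in>Y. c * (deg X f * dev Y p f)) - (\<Sum>e\<in>Y. dev Y p e / 3)"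
    by (simp add: sum_subtractf[symmetric] algebra_simps)
  ultimately have "avg Y p h (\<lambda>S. c * (\<Sum>f\<in>S. deg X f) - of_bool (S \<in> H))
     + ((1 - p0 / p) / 3 - c) * A
     = h / p ^ 3 * (\<Sum>f\<in>Y. (c * deg X f - 1 / 3) * dev Y p f)"
    unfolding eq by (simp only: right_diff_distrib)
  also have "\<dots> \<le> h / p ^ 3 * (\<Sum>f\<in>Y. \<bar>dev Y p f\<bar> / 3)"
  proof (intro mult_left_mono sum_mono)
    fix f assume "f \<in> Y"
    then have "0 \<le> c * deg X f" "c * deg X f \<le> (1/3) * 1"
      using c deg_nonneg[of X f] deg_X_le_1[of f] assms(1) mult_mono[of c "1/3" "deg X f" 1] by auto
    then have "\<bar>c * deg X f - 1/3\<bar> \<le> 1/3" by auto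
    then have "\<bar>(c * deg X f - 1/3) * dev Y p f\<bar> \<le> 1/3 * \<bar>dev Y p f\<bar>"
      unfolding abs_mult by (intro mult_right_mono) auto
    then show "(c * deg X f - 1 / 3) * dev Y p f \<le> \<bar>dev Y p f\<bar> / 3" by auto
  qed (use p assms in auto)
  finally show ?thesis unfolding c_def A_def by (simp add: sum_divide_distrib[symmetric])
qed

text \<open>A triple at a surviving point differs from the selected triple, hence meets it at most
  once, and \<open>deg_remove\<close> is exact. Keeping the removed points on the right only adds
  squares.\<close>

lemma dev2_remove:
  assumes "Y \<subseteq> X" "S \<in> moves Y"
  shows "dev2 (Y - S) p \<le> (\<Sum>e\<in>Y. (dev Y p e - (\<Sum>f\<in>S. link Y e f))\<^sup>2)"
proof -
  have "S \<subseteq> Y" using assms by (auto simp: moves_def alive_def)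
  have fin: "finite Y" using assms finite_X finite_subset by blast
  have "dev2 (Y - S) p = (\<Sum>e\<in>Y - S. (dev Y p e - (\<Sum>f\<in>S. link Y e f))\<^sup>2)"
    unfolding dev2_def
  proof (rule sum.cong[OF refl])
    fix e assume e: "e \<in> Y - S"
    have "card (T \<inter> S) \<le> 1" if "T \<in> alive Y" "e \<in> T" for T
      using assms(2) unfolding moves_def
    proof
      assume "S \<in> alive Y"
      then show ?thesis using that e H_linear[of T S] by (auto simp: alive_def)
    next
      assume "S \<in> (\<lambda>e. {e}) ` Y"
      then show ?thesis by (auto simp: Int_insert_right)
    qed
    then have "dev (Y - S) p e = dev Y p e - (\<Sum>f\<in>S. link Y e f)"
      unfolding dev_def using deg_remove[OF assms(1) \<open>S \<subseteq> Y\<close> e] by simp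
    then show "(dev (Y - S) p e)\<^sup>2 = (dev Y p e - (\<Sum>f\<in>S. link Y e f))\<^sup>2" by simp
  qed
  also have "\<dots> \<le> (\<Sum>e\<in>Y. (dev Y p e - (\<Sum>f\<in>S. link Y e f))\<^sup>2)"
    by (rule sum_mono2) (use fin in auto)
  finally show ?thesis .
qed

text \<open>Each inner sum is at most \<open>3 * \<eta>\<close>, since a move has at most three
  points. Over all \<open>e\<close> the inner sums total at most 6, because every point of
  \<open>S\<close> has links of total \<open>2 * deg Y f \<le> 2\<close>.\<close>

lemma sum_link_power2_le:
  assumes "Y \<subseteq> X" "S \<in> moves Y"
  shows "(\<Sum>e\<in>Y. (\<Sum>f\<in>S. link Y e f)\<^sup>2) \<le> 18 * \<eta>"
proof -
  have SY: "S \<subseteq> Y" using assms by (auto simp: moves_def alive_def)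
  have c3: "card S \<le> 3" using assms H_card by (auto simp: moves_def alive_def)
  have r0: "0 \<le> (\<Sum>f\<in>S. link Y e f)" for e by (intro sum_nonneg link_nonneg)
  have r3: "(\<Sum>f\<in>S. link Y e f) \<le> 3 * \<eta>" for e
  proof -
    have "(\<Sum>f\<in>S. link Y e f) \<le> (\<Sum>f\<in>S. \<eta>)" by (intro sum_mono link_le)
    also have "\<dots> \<le> 3 * \<eta>" using c3 eta_nonneg by (simp add: mult_right_mono)
    finally show ?thesis .
  qed
  have "(\<Sum>e\<in>Y. (\<Sum>f\<in>S. link Y e f)\<^sup>2) \<le> (\<Sum>e\<in>Y. 3 * \<eta> * (\<Sum>f\<in>S. link Y e f))"
    unfolding power2_eq_square using r0 r3 by (intro sum_mono mult_right_mono) auto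
  also have "\<dots> = 3 * \<eta> * (\<Sum>e\<in>Y. \<Sum>f\<in>S. link Y e f)" by (simp add: sum_distrib_left)
  also have "(\<Sum>e\<in>Y. \<Sum>f\<in>S. link Y e f) = (\<Sum>f\<in>S. \<Sum>e\<in>Y. link Y f e)"
    by (subst sum.swap) (simp add: link_sym)
  also have "\<dots> = (\<Sum>f\<in>S. 2 * deg Y f)" by (simp add: sum_link[OF assms(1)])
  also have "3 * \<eta> * \<dots> \<le> 3 * \<eta> * 6"
  proof (intro mult_left_mono)
    have "(\<Sum>f\<in>S. 2 * deg Y f) \<le> (\<Sum>f\<in>S. 2)"
      using SY assms(1) deg_le_1 by (intro sum_mono) auto
    also have "\<dots> \<le> 6" using c3 by simp
    finally show "(\<Sum>f\<in>S. 2 * deg Y f) \<le> 6" .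
  qed (use eta_nonneg in simp)
  finally show ?thesis by simp
qed

text \<open>Schur test: the link matrix is symmetric and nonnegative with row sums
  \<open>2 * deg Y e \<le> 2\<close>, so its quadratic form is bounded by twice the squared
  norm.\<close>

lemma link_form_le:
  assumes "Y \<subseteq> X"
  shows "\<bar>\<Sum>e\<in>Y. c e * (\<Sum>f\<in>Y. link Y e f * c f)\<bar> \<le> 2 * (\<Sum>e\<in>Y. (c e)\<^sup>2)"
proof -
  have "\<bar>\<Sum>e\<in>Y. c e * (\<Sum>f\<in>Y. link Y e f * c f)\<bar> \<le> (\<Sum>e\<in>Y. \<Sum>f\<in>Y. \<bar>c e * (link Y e f * c f)\<bar>)"
    unfolding sum_distrib_left by (intro order_trans[OF sum_abs] sum_mono sum_abs)
  also have "\<dots> \<le> (\<Sum>e\<in>Y. \<Sum>f\<in>Y. link Y e f * (c e)\<^sup>2 / 2 + link Y f e * (c f)\<^sup>2 / 2)"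
  proof (intro sum_mono)
    fix e f
    have "2 * (\<bar>c e\<bar> * \<bar>c f\<bar>) \<le> (c e)\<^sup>2 + (c f)\<^sup>2"
      using sum_squares_bound[of "\<bar>c e\<bar>" "\<bar>c f\<bar>"] by simp
    then have "link Y e f * (2 * (\<bar>c e\<bar> * \<bar>c f\<bar>)) \<le> link Y e f * ((c e)\<^sup>2 + (c f)\<^sup>2)"
      by (intro mult_left_mono link_nonneg)
    then show "\<bar>c e * (link Y e f * c f)\<bar> \<le> link Y e f * (c e)\<^sup>2 / 2 + link Y f e * (c f)\<^sup>2 / 2"
      using link_nonneg[of Y e f] link_sym[of Y e f] by (simp add: abs_mult algebra_simps)
  qed
  also have "\<dots> = (\<Sum>e\<in>Y. \<Sum>f\<in>Y. link Y e f * (c e)\<^sup>2 / 2) + (\<Sum>e\<in>Y. \<Sum>f\<in>Y. link Y f e * (c f)\<^sup>2 / 2)"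
    by (simp add: sum.distrib)
  also have "(\<Sum>e\<in>Y. \<Sum>f\<in>Y. link Y f e * (c f)\<^sup>2 / 2) = (\<Sum>e\<in>Y. \<Sum>f\<in>Y. link Y e f * (c e)\<^sup>2 / 2)"
    by (rule sum.swap)
  also have "(\<Sum>e\<in>Y. \<Sum>f\<in>Y. link Y e f * (c e)\<^sup>2 / 2) = (\<Sum>e\<in>Y. (2 * deg Y e) * (c e)\<^sup>2 / 2)"
    by (simp only: sum_link[OF assms, symmetric] sum_distrib_right sum_divide_distrib)
  also have "\<dots> + \<dots> = 2 * (\<Sum>e\<in>Y. deg Y e * (c e)\<^sup>2)"
    by (simp add: sum_distrib_left)
  also have "\<dots> \<le> 2 * (\<Sum>e\<in>Y. 1 * (c e)\<^sup>2)"
    using assms deg_le_1 by (intro mult_left_mono sum_mono mult_right_mono) auto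
  finally show ?thesis by simp
qed

text \<open>From \<open>p\<close> to \<open>p'\<close> the predicted degree falls by
  \<open>deg X e * (2 * p * h - h\<^sup>2)\<close>, while the mean loss of degree is
  \<open>2 * p * h * deg X e\<close> plus deviation terms. The term in \<open>dev Y p e\<close>
  itself pulls the deviation towards 0 and is dropped; the link term costs the factor
  \<open>4 * h / p ^ 3\<close>. The mismatch and the square of the shift are second order, at most
  \<open>2 * h\<^sup>2\<close> and \<open>4 * h\<^sup>2\<close> per point.\<close>

lemma quadratic_drift:
  assumes YX: "Y \<subseteq> X" and p: "0 < p'" "p' = p - h" "p \<le> 1" "0 \<le> h"
  shows "avg Y p h (\<lambda>S. dev2 (Y - S) p' - dev2 Y p') + dev2 Y p'
    \<le> dev2 Y p * (1 + 4 * h / p ^ 3) + 6 * h\<^sup>2 * card X + 36 * \<eta> * h * card X / p ^ 3"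
proof -
  have p0: "0 < p" using p by auto
  have fY: "finite Y" "card Y \<le> card X" using YX finite_X by (auto intro: finite_subset card_mono)
  define r where "r = (\<lambda>S e. \<Sum>f\<in>S. link Y e f)"
  define \<Lambda> where "\<Lambda> = (\<lambda>e. \<Sum>f\<in>Y. link Y e f * dev Y p f)"
  define m where "m = (\<lambda>e. avg Y p h (\<lambda>S. r S e))"
  have m: "m e = 2 * p * h * deg X e + 2 * (h / p) * dev Y p e + h / p ^ 3 * \<Lambda> e" for e
  proof -
    have "m e = (\<Sum>f\<in>Y. link Y e f * (h / p + h / p ^ 3 * dev Y p f))"
      unfolding m_def r_def by (rule avg_additive[OF YX p0])
    also have "\<dots> = h / p * (\<Sum>f\<in>Y. link Y e f) + h / p ^ 3 * \<Lambda> e"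
      unfolding \<Lambda>_def by (simp add: distrib_left sum.distrib sum_distrib_left mult_ac)
    also have "\<dots> = h / p * (2 * deg Y e) + h / p ^ 3 * \<Lambda> e" by (simp add: sum_link[OF YX])
    also have "deg Y e = dev Y p e + deg X e * p\<^sup>2" by (simp add: dev_def)
    finally show ?thesis using p0 by (simp add: field_simps power2_eq_square)
  qed
  have m0: "0 \<le> m e" for e
  proof -
    have "avg Y p h (\<lambda>S. 0) \<le> m e"
      unfolding m_def r_def by (intro avg_mono[OF YX p0 p(4)] sum_nonneg link_nonneg)
    then show ?thesis by (simp add: avg_def)
  qed
  have "avg Y p h (\<lambda>S. dev2 (Y - S) p' - dev2 Y p')
      \<le> avg Y p h (\<lambda>S. (\<Sum>e\<in>Y. (- 2 * dev Y p' e) * r S e) + 18 * \<eta> * 1)"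
  proof (rule avg_mono[OF YX p0 p(4)])
    fix S assume S: "S \<in> moves Y"
    have "dev2 (Y - S) p' - dev2 Y p' \<le> (\<Sum>e\<in>Y. (dev Y p' e - r S e)\<^sup>2) - (\<Sum>e\<in>Y. (dev Y p' e)\<^sup>2)"
      using dev2_remove[OF YX S, of p'] unfolding r_def dev2_def[of Y] by simp
    also have "\<dots> = (\<Sum>e\<in>Y. (- 2 * dev Y p' e) * r S e) + (\<Sum>e\<in>Y. (r S e)\<^sup>2)"
      by (simp add: power2_diff sum_subtractf sum.distrib sum_negf algebra_simps)
    finally show "dev2 (Y - S) p' - dev2 Y p' \<le> (\<Sum>e\<in>Y. (- 2 * dev Y p' e) * r S e) + 18 * \<eta> * 1"
      using sum_link_power2_le[OF YX S] unfolding r_def by simp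
  qed
  also have "\<dots> = (\<Sum>e\<in>Y. (- 2 * dev Y p' e) * m e) + 18 * \<eta> * avg Y p h (\<lambda>_. 1)"
    unfolding m_def by (simp only: avg_add avg_sum avg_cmult)
  also have "\<dots> \<le> (\<Sum>e\<in>Y. (- 2 * dev Y p' e) * m e) + 18 * \<eta> * (2 * h * card X / p ^ 3)"
    using avg_one_le[OF YX p0 p(3,4)] eta_nonneg by (intro add_left_mono mult_left_mono) auto
  finally have 1: "avg Y p h (\<lambda>S. dev2 (Y - S) p' - dev2 Y p') + dev2 Y p'
      \<le> (\<Sum>e\<in>Y. (dev Y p' e)\<^sup>2 - 2 * dev Y p' e * m e) + 36 * \<eta> * h * card X / p ^ 3"
    unfolding dev2_def[of Y] by (simp add: sum_subtractf sum_negf)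
  have "(\<Sum>e\<in>Y. (dev Y p' e)\<^sup>2 - 2 * dev Y p' e * m e)
      \<le> (\<Sum>e\<in>Y. (dev Y p e)\<^sup>2 - 2 * (h / p ^ 3) * (dev Y p e * \<Lambda> e) + 6 * h\<^sup>2)"
  proof (rule sum_mono)
    fix e assume e: "e \<in> Y"
    define \<delta> where "\<delta> = dev Y p e"
    define D where "D = deg X e"
    define b where "b = D * (2 * p * h - h\<^sup>2)"
    have D: "0 \<le> D" "D \<le> 1" using deg_nonneg deg_X_le_1 e YX by (auto simp: D_def)
    have ph: "0 \<le> 2 * p * h - h\<^sup>2" "2 * p * h - h\<^sup>2 \<le> 2 * h"
    proof -
      have "2 * p * h - h\<^sup>2 = h * (p + p')" unfolding p(2) by (simp add: algebra_simps power2_eq_square)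
      moreover have "h * 0 \<le> h * (p + p')" "h * (p + p') \<le> h * 2" using p p0 by (auto intro!: mult_left_mono)
      ultimately show "0 \<le> 2 * p * h - h\<^sup>2" "2 * p * h - h\<^sup>2 \<le> 2 * h" by auto
    qed
    have b: "0 \<le> b" "b \<le> 1 * (2 * h)" unfolding b_def using D ph mult_mono[of D 1 "2 * p * h - h\<^sup>2" "2 * h"] by auto
    have dev': "dev Y p' e = \<delta> + b"
      unfolding \<delta>_def b_def D_def dev_def p(2) by (simp add: algebra_simps power2_eq_square)
    have "(dev Y p' e)\<^sup>2 - 2 * dev Y p' e * m e = \<delta>\<^sup>2 + 2 * \<delta> * (b - m e) + b\<^sup>2 - 2 * b * m e"
      unfolding dev' by (simp add: algebra_simps power2_eq_square)
    also have "2 * \<delta> * (b - m e) = 2 * (- \<delta> * D) * h\<^sup>2 - 4 * (h / p) * \<delta>\<^sup>2 - 2 * (h / p ^ 3) * (\<delta> * \<Lambda> e)"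
      unfolding m b_def D_def \<delta>_def by (simp add: algebra_simps power2_eq_square)
    finally have eq: "(dev Y p' e)\<^sup>2 - 2 * dev Y p' e * m e
      = \<delta>\<^sup>2 + (2 * (- \<delta> * D) * h\<^sup>2 - 4 * (h / p) * \<delta>\<^sup>2 - 2 * (h / p ^ 3) * (\<delta> * \<Lambda> e)) + b\<^sup>2 - 2 * b * m e" .
    have "\<bar>\<delta>\<bar> \<le> 1" unfolding \<delta>_def using abs_dev_le_1[of e p Y] e YX p p0 by auto
    then have "\<bar>\<delta> * D\<bar> \<le> 1" unfolding abs_mult using D by (intro mult_le_one) auto
    then have "- \<delta> * D \<le> 1" by auto
    then have i1: "2 * (- \<delta> * D) * h\<^sup>2 \<le> 2 * 1 * h\<^sup>2" by (intro mult_right_mono mult_left_mono) auto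
    have i2: "0 \<le> 4 * (h / p) * \<delta>\<^sup>2" using p p0 by auto
    have "b\<^sup>2 \<le> (2 * h)\<^sup>2" using b by (intro power_mono) auto
    then have i3: "b\<^sup>2 \<le> 4 * h\<^sup>2" by (simp add: power_mult_distrib)
    have i4: "0 \<le> 2 * b * m e" using b m0[of e] by auto
    show "(dev Y p' e)\<^sup>2 - 2 * dev Y p' e * m e
        \<le> (dev Y p e)\<^sup>2 - 2 * (h / p ^ 3) * (dev Y p e * \<Lambda> e) + 6 * h\<^sup>2"
      unfolding eq \<delta>_def[symmetric] using i1 i2 i3 i4 by linarith
  qed
  also have "\<dots> = dev2 Y p - 2 * (h / p ^ 3) * (\<Sum>e\<in>Y. dev Y p e * \<Lambda> e) + 6 * h\<^sup>2 * card Y"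
    unfolding dev2_def by (simp add: sum.distrib sum_subtractf sum_distrib_left)
  also have "\<dots> \<le> dev2 Y p + 2 * (h / p ^ 3) * (2 * dev2 Y p) + 6 * h\<^sup>2 * card X"
  proof -
    have "\<bar>\<Sum>e\<in>Y. dev Y p e * \<Lambda> e\<bar> \<le> 2 * dev2 Y p"
      unfolding \<Lambda>_def dev2_def by (rule link_form_le[OF YX])
    then have "- (\<Sum>e\<in>Y. dev Y p e * \<Lambda> e) \<le> 2 * dev2 Y p" by linarith
    then have "2 * (h / p ^ 3) * - (\<Sum>e\<in>Y. dev Y p e * \<Lambda> e) \<le> 2 * (h / p ^ 3) * (2 * dev2 Y p)"
      using p p0 by (intro mult_left_mono) auto
    moreover have "6 * h\<^sup>2 * card Y \<le> 6 * h\<^sup>2 * card X" using fY by (intro mult_left_mono) auto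
    ultimately show ?thesis by simp
  qed
  finally show ?thesis using 1 by (simp add: algebra_simps)
qed

text \<open>The potential combines the squared deviations with \<open>- |M| - (1 - p0 / p) / 3 * (\<Sum>e\<in>Y. deg X e)\<close>.
  Up to deviations the latter is a martingale, because both \<open>3 * |M| + (\<Sum>e\<in>Y. deg X e)\<close> and
  \<open>(\<Sum>e\<in>Y. deg X e) / p\<close> are; at \<open>p = p0\<close> only \<open>- |M|\<close> is left.\<close>

lemma nibble_step:
  fixes p p' h a a' \<mu> :: real
  assumes YX: "Y \<subseteq> X" and p: "0 < p0" "p0 \<le> p'" "p' = p - h" "p \<le> 1" "0 \<le> h"
    and mass: "2 * h * card X / p ^ 3 < 1"
    and a': "0 \<le> a'" and \<mu>: "0 < \<mu>"
    and a: "a' * (1 + 4 * h / p ^ 3) + h / (12 * \<mu> * p ^ 3) \<le> a"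
  shows "\<exists>S. (S = {} \<or> S \<in> moves Y) \<and>
    a' * dev2 (Y - S) p' - of_bool (S \<in> H) - (1 - p0 / p') / 3 * (\<Sum>e\<in>Y - S. deg X e)
    \<le> a * dev2 Y p - (1 - p0 / p) / 3 * (\<Sum>e\<in>Y. deg X e)
      + (a' * (6 * h\<^sup>2 + 36 * \<eta> * h / p ^ 3) + h * \<mu> / (3 * p ^ 3)) * card X"
proof (rule ccontr)
  have p0: "0 < p" "0 < p'" using p by auto
  have fY: "finite Y" "card Y \<le> card X" using YX finite_X by (auto intro: finite_subset card_mono)
  have neH: "{} \<notin> H" using H_card by force
  define c where "c = (1 - p0 / p) / 3"
  define c' where "c' = (1 - p0 / p') / 3"
  define F where "F = (\<lambda>S. a' * dev2 (Y - S) p' - of_bool (S \<in> H) - c' * (\<Sum>e\<in>Y - S. deg X e))"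
  define t where "t = a * dev2 Y p - c * (\<Sum>e\<in>Y. deg X e)
      + (a' * (6 * h\<^sup>2 + 36 * \<eta> * h / p ^ 3) + h * \<mu> / (3 * p ^ 3)) * card X"
  \<comment> \<open>Derandomization: if every move, the idle one \<open>{}\<close> included, ended
    above \<open>t\<close>, so would the average over all of them. The mass bound gives the idle
    move positive probability.\<close>
  assume "\<not> ?thesis"
  then have nle: "\<not> F S \<le> t" if "S = {} \<or> S \<in> moves Y" for S
    using that unfolding F_def t_def c_def c'_def by blast
  have big: "t < F S" if "S = {} \<or> S \<in> moves Y" for S
    using nle[OF that] by simp
  have FS: "F S = F {} + (a' * (dev2 (Y - S) p' - dev2 Y p') + (c' * (\<Sum>f\<in>S. deg X f) - of_bool (S \<in> H)))"
    if "S \<in> moves Y" for S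
  proof -
    have "S \<subseteq> Y" using that by (auto simp: moves_def alive_def)
    then show ?thesis using fY neH unfolding F_def
      by (simp add: sum_diff algebra_simps)
  qed
  have "avg Y p h (\<lambda>_. (t - F {}) * 1)
     \<le> avg Y p h (\<lambda>S. a' * (dev2 (Y - S) p' - dev2 Y p') + (c' * (\<Sum>f\<in>S. deg X f) - of_bool (S \<in> H)))"
    by (rule avg_mono[OF YX p0(1) p(5)]) (use big FS in fastforce)
  also have "\<dots> = a' * avg Y p h (\<lambda>S. dev2 (Y - S) p' - dev2 Y p')
      + avg Y p h (\<lambda>S. c' * (\<Sum>f\<in>S. deg X f) - of_bool (S \<in> H))"
    by (simp only: avg_add avg_cmult)
  finally have 1: "(t - F {}) * avg Y p h (\<lambda>_. 1) \<le> a' * avg Y p h (\<lambda>S. dev2 (Y - S) p' - dev2 Y p')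
      + avg Y p h (\<lambda>S. c' * (\<Sum>f\<in>S. deg X f) - of_bool (S \<in> H))"
    by (simp only: avg_cmult)
  have "avg Y p h (\<lambda>_. 1) < 1" using avg_one_le[OF YX p0(1) p(4,5)] mass by simp
  then have 2: "(F {} - t) * avg Y p h (\<lambda>_. 1) < (F {} - t) * 1"
    using big[of "{}"] by (intro mult_strict_left_mono) auto
  have 3: "t < F {} + a' * avg Y p h (\<lambda>S. dev2 (Y - S) p' - dev2 Y p')
      + avg Y p h (\<lambda>S. c' * (\<Sum>f\<in>S. deg X f) - of_bool (S \<in> H))"
    using 1 2 by (simp add: algebra_simps)
  have quad: "a' * (avg Y p h (\<lambda>S. dev2 (Y - S) p' - dev2 Y p') + dev2 Y p')
      \<le> a' * (dev2 Y p * (1 + 4 * h / p ^ 3) + 6 * h\<^sup>2 * card X + 36 * \<eta> * h * card X / p ^ 3)"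
    by (intro mult_left_mono quadratic_drift[OF YX p0(2) p(3-5)] a')
  have lin: "avg Y p h (\<lambda>S. c' * (\<Sum>f\<in>S. deg X f) - of_bool (S \<in> H)) + (c - c') * (\<Sum>f\<in>Y. deg X f)
      \<le> h / (3 * p ^ 3) * (\<Sum>e\<in>Y. \<bar>dev Y p e\<bar>)"
    unfolding c_def c'_def by (rule linear_drift[OF YX p(1,2,3,5)])
  \<comment> \<open>The linear error is made quadratic with a free parameter \<open>\<mu>\<close>:
    the part \<open>\<mu>\<close> per point is an additive error, and the square is charged to the
    difference between \<open>a\<close> and \<open>a'\<close>.\<close>
  have "(\<Sum>e\<in>Y. \<bar>dev Y p e\<bar>) \<le> (\<Sum>e\<in>Y. \<mu> + (dev Y p e)\<^sup>2 / (4 * \<mu>))"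
  proof (rule sum_mono)
    fix e
    have "0 \<le> (\<bar>dev Y p e\<bar> - 2 * \<mu>)\<^sup>2" by simp
    then have "4 * \<mu> * \<bar>dev Y p e\<bar> \<le> 4 * \<mu> * \<mu> + (dev Y p e)\<^sup>2"
      by (simp add: power2_diff algebra_simps power2_eq_square)
    then show "\<bar>dev Y p e\<bar> \<le> \<mu> + (dev Y p e)\<^sup>2 / (4 * \<mu>)"
      using \<mu> by (simp add: field_simps)
  qed
  also have "\<dots> = card Y * \<mu> + dev2 Y p / (4 * \<mu>)"
    unfolding dev2_def by (simp add: sum.distrib sum_divide_distrib)
  also have "\<dots> \<le> card X * \<mu> + dev2 Y p / (4 * \<mu>)" using fY \<mu> by simp
  finally have "h / (3 * p ^ 3) * (\<Sum>e\<in>Y. \<bar>dev Y p e\<bar>) \<le> h / (3 * p ^ 3) * (card X * \<mu> + dev2 Y p / (4 * \<mu>))"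
    using p p0 by (intro mult_left_mono) auto
  moreover have "dev2 Y p \<ge> 0" unfolding dev2_def by (intro sum_nonneg) auto
  then have "(a' * (1 + 4 * h / p ^ 3) + h / (12 * \<mu> * p ^ 3)) * dev2 Y p \<le> a * dev2 Y p"
    using a by (intro mult_right_mono)
  ultimately have "F {} + a' * avg Y p h (\<lambda>S. dev2 (Y - S) p' - dev2 Y p')
      + avg Y p h (\<lambda>S. c' * (\<Sum>f\<in>S. deg X f) - of_bool (S \<in> H)) \<le> t"
    using quad lin neH unfolding F_def t_def by (simp add: algebra_simps)
  then show False using 3 by simp
qed

text \<open>Iterates the step while the survival probability falls from 1 to \<open>p0\<close>. The
  coefficient of \<open>dev2\<close> shrinks by the factor \<open>exp (8 / p0 ^ 3 * h)\<close> per
  step: half of that rate absorbs the growth factor \<open>4 * h / p ^ 3\<close>, and the other half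
  pays the charge \<open>h / (12 * \<mu> * p ^ 3)\<close>, because the coefficient never falls below
  \<open>1 / (48 * \<mu>)\<close>.\<close>

lemma nibble_process:
  fixes p0 \<mu> h A err :: real and n :: nat
  assumes p0: "0 < p0" "p0 < 1" and \<mu>: "0 < \<mu>" and n: "0 < n"
    and h: "h = (1 - p0) / n"
    and mass: "2 * h * card X / p0 ^ 3 < 1"
    and A: "A = exp (8 / p0 ^ 3) / (48 * \<mu>)"
    and err: "err = (A * (6 * h\<^sup>2 + 36 * \<eta> * h / p0 ^ 3) + h * \<mu> / (3 * p0 ^ 3)) * card X"
  shows "i \<le> n \<Longrightarrow> \<exists>Y M. Y \<subseteq> X \<and> M \<subseteq> H \<and> pairwise disjnt M \<and> (\<forall>T\<in>M. T \<inter> Y = {}) \<and>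
     exp (8 / p0 ^ 3 * (1 - i * h)) / (48 * \<mu>) * dev2 Y (1 - i * h) - card M
       - (1 - p0 / (1 - i * h)) / 3 * (\<Sum>e\<in>Y. deg X e)
     \<le> i * err - (1 - p0) * (\<Sum>T\<in>H. w T)"
proof (induction i)
  case 0
  \<comment> \<open>At \<open>p = 1\<close> there is no deviation, and the potential is
    \<open>- (1 - p0)\<close> times the total weight.\<close>
  have "dev2 X 1 = 0" by (simp add: dev2_def dev_def)
  moreover have "(\<Sum>e\<in>X. deg X e) = 3 * (\<Sum>T\<in>H. w T)"
    using sum_deg[of X] by (simp add: alive_X)
  ultimately show ?case
    by (intro exI[of _ X] exI[of _ "{}"]) simp
next
  case (Suc i)
  define p where "p = 1 - i * h"
  define p' where "p' = 1 - Suc i * h"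
  define L where "L = 8 / p0 ^ 3"
  define a where "a = exp (L * p) / (48 * \<mu>)"
  define a' where "a' = exp (L * p') / (48 * \<mu>)"
  have h0: "0 < h" unfolding h using p0 n by simp
  have "Suc i * h \<le> n * h" using Suc.prems h0 by (intro mult_right_mono) auto
  also have "\<dots> = 1 - p0" unfolding h using n by simp
  finally have p: "p0 \<le> p'" "p' = p - h" "p \<le> 1" "p0 \<le> p"
    unfolding p_def p'_def using h0 by (auto simp: algebra_simps)
  have ppos: "0 < p" "0 < p ^ 3" using p p0 by auto
  have pp: "p0 ^ 3 \<le> p ^ 3" using p p0 by (intro power_mono) auto
  from Suc.IH Suc.prems obtain Y M where YM: "Y \<subseteq> X" "M \<subseteq> H" "pairwise disjnt M" "\<forall>T\<in>M. T \<inter> Y = {}"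
    and bound: "a * dev2 Y p - card M - (1 - p0 / p) / 3 * (\<Sum>e\<in>Y. deg X e)
      \<le> i * err - (1 - p0) * (\<Sum>T\<in>H. w T)"
    unfolding a_def L_def p_def by auto
  have mass': "2 * h * card X / p ^ 3 < 1"
  proof -
    have "2 * h * card X / p ^ 3 \<le> 2 * h * card X / p0 ^ 3"
      using pp p0 h0 ppos by (intro divide_left_mono) auto
    then show ?thesis using mass by simp
  qed
  have L0: "0 < L" unfolding L_def using p0 by simp
  have a'0: "1 / (48 * \<mu>) \<le> a'" "0 \<le> a'"
    unfolding a'_def using \<mu> L0 p p0 by (auto intro!: divide_right_mono)
  have a'A: "a' \<le> A"
  proof -
    have "L * p' \<le> L * 1" using L0 p h0 by (intro mult_left_mono) auto
    then show ?thesis unfolding a'_def A L_def using \<mu> by (intro divide_right_mono) auto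
  qed
  have "a' * (1 + 4 * h / p ^ 3) + h / (12 * \<mu> * p ^ 3) \<le> a' * (1 + L * h)"
  proof -
    have "h / p ^ 3 \<le> h / p0 ^ 3" using pp h0 p0 ppos by (intro divide_left_mono) auto
    then have q: "4 * h / p ^ 3 \<le> L / 2 * h" unfolding L_def by simp
    have "h / (12 * \<mu> * p ^ 3) = 1 / (48 * \<mu>) * (4 * h / p ^ 3)"
      by simp
    also have "\<dots> \<le> a' * (L / 2 * h)"
      using a'0 q h0 ppos \<mu> by (intro mult_mono) auto
    finally have "h / (12 * \<mu> * p ^ 3) \<le> a' * (L / 2 * h)" .
    moreover have "a' * (4 * h / p ^ 3) \<le> a' * (L / 2 * h)" using a'0 q by (intro mult_left_mono) auto
    ultimately show ?thesis by (simp add: algebra_simps)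
  qed
  also have "\<dots> \<le> a' * exp (L * h)"
    using a'0 exp_ge_add_one_self by (intro mult_left_mono) auto
  also have "\<dots> = a" unfolding a_def a'_def p(2) by (simp add: mult_exp_exp algebra_simps)
  finally have aa: "a' * (1 + 4 * h / p ^ 3) + h / (12 * \<mu> * p ^ 3) \<le> a" .
  obtain S where S: "S = {} \<or> S \<in> moves Y" and
    step: "a' * dev2 (Y - S) p' - of_bool (S \<in> H) - (1 - p0 / p') / 3 * (\<Sum>e\<in>Y - S. deg X e)
    \<le> a * dev2 Y p - (1 - p0 / p) / 3 * (\<Sum>e\<in>Y. deg X e)
      + (a' * (6 * h\<^sup>2 + 36 * \<eta> * h / p ^ 3) + h * \<mu> / (3 * p ^ 3)) * card X"
    using nibble_step[OF YM(1) p0(1) p(1-3) _ mass' a'0(2) \<mu> aa] h0 by auto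
  have "(a' * (6 * h\<^sup>2 + 36 * \<eta> * h / p ^ 3) + h * \<mu> / (3 * p ^ 3)) * card X \<le> err"
    unfolding err
  proof (intro mult_right_mono add_mono mult_mono)
    show "36 * \<eta> * h / p ^ 3 \<le> 36 * \<eta> * h / p0 ^ 3"
      using pp p0 ppos h0 eta_nonneg by (intro divide_left_mono) auto
    show "h * \<mu> / (3 * p ^ 3) \<le> h * \<mu> / (3 * p0 ^ 3)"
      using pp p0 ppos h0 \<mu> by (intro divide_left_mono) auto
    show "0 \<le> 6 * h\<^sup>2 + 36 * \<eta> * h / p ^ 3" using h0 eta_nonneg ppos by simp
    show "0 \<le> A" unfolding A using \<mu> by simp
  qed (use a'A in auto)
  with step bound have new: "a' * dev2 (Y - S) p' - of_bool (S \<in> H) - card M - (1 - p0 / p') / 3 * (\<Sum>e\<in>Y - S. deg X e)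
     \<le> Suc i * err - (1 - p0) * (\<Sum>T\<in>H. w T)"
    by (simp add: algebra_simps)
  define M' where "M' = (if S \<in> H then insert S M else M)"
  have finM: "finite M" using YM finite_H finite_subset by blast
  have SY: "S \<subseteq> Y" using S by (auto simp: moves_def alive_def)
  have SM: "S \<notin> M" if "S \<in> H"
  proof
    assume "S \<in> M"
    then have "S = {}" using YM(4) SY by (metis inf.absorb1)
    then show False using that H_card[of S] by simp
  qed
  have "disjnt T S \<and> disjnt S T" if "T \<in> M" for T
    using YM(4) SY that unfolding disjnt_def by blast
  then have "pairwise disjnt M'"
    unfolding M'_def using YM(3) by (simp add: pairwise_insert)
  moreover have "real (card M') = card M + of_bool (S \<in> H)"
    unfolding M'_def using SM finM by simp
  moreover have "\<forall>T\<in>M'. T \<inter> (Y - S) = {}" "M' \<subseteq> H"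
    unfolding M'_def using YM by auto
  ultimately show ?case
    using new YM(1) unfolding a'_def p'_def L_def
    by (intro exI[of _ "Y - S"] exI[of _ M']) auto
qed

end

text \<open>The order of choice matters: \<open>p0\<close>, \<open>\<mu>\<close>, \<open>A\<close>
  and \<open>\<eta>\<close> depend on \<open>\<epsilon>\<close> alone, while the step length may
  depend on \<open>X\<close>. Stopping at survival probability \<open>p0\<close> forfeits at most
  \<open>\<epsilon> / 6\<close> per point, and the three accumulated errors are at most
  \<open>\<epsilon> / 6\<close>, \<open>\<epsilon> / 6\<close> and \<open>\<epsilon> / 3\<close> per
  point.\<close>

lemma nibble:
  fixes \<epsilon> :: real
  assumes \<epsilon>: "\<epsilon> > 0"
  shows "\<exists>\<eta>>0. \<forall>(X :: 'b set) H w. weighted_triples X H w \<eta> \<longrightarrow>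
    (\<exists>M\<subseteq>H. pairwise disjnt M \<and> real (card M) \<ge> (\<Sum>T\<in>H. w T) - \<epsilon> * card X)"
proof -
  define p0 where "p0 = min \<epsilon> 1 / 2"
  define \<mu> where "\<mu> = \<epsilon> * p0 ^ 3"
  define A where "A = exp (8 / p0 ^ 3) / (48 * \<mu>)"
  define \<eta> where "\<eta> = \<epsilon> * p0 ^ 3 / (216 * A)"
  have p0: "0 < p0" "p0 < 1" "p0 \<le> \<epsilon> / 2" unfolding p0_def using \<epsilon> by auto
  have \<mu>: "0 < \<mu>" unfolding \<mu>_def using \<epsilon> p0 by simp
  have A0: "0 < A" unfolding A_def using \<mu> by simp
  have \<eta>: "0 < \<eta>" unfolding \<eta>_def using A0 \<epsilon> p0 by simp
  show ?thesis
  proof (intro exI[of _ \<eta>] conjI \<eta> allI impI)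
    fix X :: "'b set" and H w
    assume W: "weighted_triples X H w \<eta>"
    interpret weighted_triples X H w \<eta> by (rule W)
    \<comment> \<open>The first bound makes the accumulated second-order error small; the second
      keeps the probability of a move below 1.\<close>
    define b where "b = min (\<epsilon> / (36 * A)) (p0 ^ 3 / (2 * card X + 1))"
    have b: "0 < b" unfolding b_def using A0 \<epsilon> p0 by simp
    obtain n :: nat where n: "(1 - p0) / b < n" using reals_Archimedean2 by blast
    have "0 < (1 - p0) / b" using b p0 by simp
    then have n0: "0 < n" using n by linarith
    define h where "h = (1 - p0) / n"
    have hb: "h < b" unfolding h_def using n b n0 by (simp add: field_simps)
    have h0: "0 < h" unfolding h_def using p0 n0 by simp
    have nh: "n * h = 1 - p0" unfolding h_def using n0 by simp
    have mass: "2 * h * card X / p0 ^ 3 < 1"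
    proof -
      have "h < p0 ^ 3 / (2 * card X + 1)" using hb b_def by simp
      then have "h * (2 * card X + 1) < p0 ^ 3" by (simp add: field_simps)
      then have "2 * h * card X < p0 ^ 3" using h0 by (simp add: algebra_simps)
      then show ?thesis using p0 by simp
    qed
    define err where "err = (A * (6 * h\<^sup>2 + 36 * \<eta> * h / p0 ^ 3) + h * \<mu> / (3 * p0 ^ 3)) * card X"
    obtain Y M where YM: "Y \<subseteq> X" "M \<subseteq> H" "pairwise disjnt M"
      and bound: "exp (8 / p0 ^ 3 * (1 - n * h)) / (48 * \<mu>) * dev2 Y (1 - n * h) - card M
       - (1 - p0 / (1 - n * h)) / 3 * (\<Sum>e\<in>Y. deg X e) \<le> n * err - (1 - p0) * (\<Sum>T\<in>H. w T)"
      using nibble_process[OF p0(1,2) \<mu> n0 h_def mass A_def err_def order_refl] by blast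
    have "0 \<le> exp (8 / p0 ^ 3 * (1 - n * h)) / (48 * \<mu>) * dev2 Y (1 - n * h)"
      using \<mu> by (simp add: dev2_def sum_nonneg)
    then have M: "(1 - p0) * (\<Sum>T\<in>H. w T) - n * err \<le> card M"
      using bound p0 unfolding nh by simp
    have "3 * (\<Sum>T\<in>H. w T) = (\<Sum>e\<in>X. deg X e)" using sum_deg[of X] by (simp add: alive_X)
    also have "\<dots> \<le> (\<Sum>e\<in>X. 1)" by (intro sum_mono deg_X_le_1)
    finally have w: "(\<Sum>T\<in>H. w T) \<le> card X / 3" by simp
    have "p0 * (\<Sum>T\<in>H. w T) \<le> \<epsilon> / 2 * (card X / 3)"
      using p0 \<epsilon> w by (intro mult_mono) (auto intro!: sum_nonneg w_nonneg)
    moreover have "n * err \<le> 2 / 3 * \<epsilon> * card X"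
    proof -
      have "n * err = (n * h) * ((A * (6 * h + 36 * \<eta> / p0 ^ 3) + \<mu> / (3 * p0 ^ 3)) * card X)"
        unfolding err_def by (simp add: power2_eq_square algebra_simps)
      also have "\<dots> \<le> 1 * ((\<epsilon> / 6 + \<epsilon> / 6 + \<epsilon> / 3) * card X)"
      proof (intro mult_mono)
        have "A * (6 * h) \<le> \<epsilon> / 6"
        proof -
          have "h \<le> \<epsilon> / (36 * A)" using hb b_def by simp
          then show ?thesis using A0 by (simp add: field_simps)
        qed
        moreover have "A * (36 * \<eta> / p0 ^ 3) = \<epsilon> / 6" unfolding \<eta>_def using A0 p0 by simp
        moreover have "\<mu> / (3 * p0 ^ 3) = \<epsilon> / 3" unfolding \<mu>_def using p0 by simp
        ultimately show "A * (6 * h + 36 * \<eta> / p0 ^ 3) + \<mu> / (3 * p0 ^ 3) \<le> \<epsilon> / 6 + \<epsilon> / 6 + \<epsilon> / 3"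
          by (simp add: distrib_left)
        show "0 \<le> (A * (6 * h + 36 * \<eta> / p0 ^ 3) + \<mu> / (3 * p0 ^ 3)) * real (card X)"
          using A0 h0 \<eta> p0 \<mu> by simp
      qed (use nh p0 in auto)
      finally show ?thesis by simp
    qed
    moreover have "(1 - p0) * (\<Sum>T\<in>H. w T) = (\<Sum>T\<in>H. w T) - p0 * (\<Sum>T\<in>H. w T)"
      by (simp add: left_diff_distrib)
    moreover have "0 \<le> \<epsilon> * card X" using \<epsilon> by simp
    ultimately have "(\<Sum>T\<in>H. w T) - \<epsilon> * card X \<le> card M"
      using M by linarith
    then show "\<exists>M\<subseteq>H. pairwise disjnt M \<and> (\<Sum>T\<in>H. w T) - \<epsilon> * card X \<le> real (card M)"
      using YM by blast
  qed
qed

subsection \<open>Capped fractional packings and almost covers\<close>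

definition load :: "'b set set \<Rightarrow> ('b set \<Rightarrow> real) \<Rightarrow> 'b \<Rightarrow> real" where
  "load H w e = (\<Sum>T\<in>H. w T * of_bool (e \<in> T))"

definition excess :: "'b set set \<Rightarrow> ('b set \<Rightarrow> real) \<Rightarrow> 'b \<Rightarrow> real" where
  "excess H w e = max 0 (load H w e - 1)"

text \<open>A quadratic penalty in place of the constraints \<open>load H w e \<le> 1\<close>. The
  derivative \<open>l * excess H w e\<close> of the penalty at \<open>e\<close> plays the part of
  the dual variable.\<close>

definition penalized :: "'b set \<Rightarrow> 'b set set \<Rightarrow> real \<Rightarrow> ('b set \<Rightarrow> real) \<Rightarrow> real" where
  "penalized X H l w = (\<Sum>T\<in>H. w T) - l / 2 * (\<Sum>e\<in>X. (excess H w e)\<^sup>2)"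

lemma sum_load:
  assumes "finite X" "\<And>T. T \<in> H \<Longrightarrow> T \<subseteq> X"
  shows "(\<Sum>e\<in>X. c e * load H w e) = (\<Sum>T\<in>H. w T * (\<Sum>e\<in>T. c e))"
proof -
  have "(\<Sum>e\<in>X. c e * load H w e) = (\<Sum>e\<in>X. \<Sum>T\<in>H. w T * (c e * of_bool (e \<in> T)))"
    unfolding load_def by (simp add: sum_distrib_left mult_ac)
  also have "\<dots> = (\<Sum>T\<in>H. \<Sum>e\<in>X. w T * (c e * of_bool (e \<in> T)))"
    by (rule sum.swap)
  also have "\<dots> = (\<Sum>T\<in>H. w T * (\<Sum>e\<in>T. c e))"
  proof (rule sum.cong[OF refl])
    fix T assume "T \<in> H"
    then have "(\<Sum>e\<in>X. c e * of_bool (e \<in> T)) = (\<Sum>e\<in>T. c e)"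
      using assms by (intro sum.mono_neutral_cong_right) auto
    then show "(\<Sum>e\<in>X. w T * (c e * of_bool (e \<in> T))) = w T * (\<Sum>e\<in>T. c e)"
      by (simp flip: sum_distrib_left)
  qed
  finally show ?thesis .
qed

lemma load_upd:
  assumes "finite H" "T \<in> H"
  shows "load H (w(T := w T + t)) e = load H w e + t * of_bool (e \<in> T)"
proof -
  have "load H (w(T := w T + t)) e = (\<Sum>S\<in>H. w S * of_bool (e \<in> S) + (if S = T then t * of_bool (e \<in> T) else 0))"
    unfolding load_def by (intro sum.cong) (auto simp: algebra_simps)
  also have "\<dots> = load H w e + t * of_bool (e \<in> T)"
    using assms by (simp add: sum.distrib load_def)
  finally show ?thesis .
qed

lemma penalized_upd:
  assumes "finite X" "finite H" "T \<in> H" "T \<subseteq> X"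
  shows "penalized X H l (w(T := w T + t)) = penalized X H l w + t
    - l / 2 * (\<Sum>e\<in>T. (max 0 (load H w e + t - 1))\<^sup>2 - (excess H w e)\<^sup>2)"
proof -
  have "(\<Sum>S\<in>H. (w(T := w T + t)) S) = (\<Sum>S\<in>H. w S + (if S = T then t else 0))"
    by (intro sum.cong) auto
  also have "\<dots> = (\<Sum>S\<in>H. w S) + t" using assms by (simp add: sum.distrib)
  finally have 1: "(\<Sum>S\<in>H. (w(T := w T + t)) S) = (\<Sum>S\<in>H. w S) + t" .
  have "(\<Sum>e\<in>X. (excess H (w(T := w T + t)) e)\<^sup>2) - (\<Sum>e\<in>X. (excess H w e)\<^sup>2)
      = (\<Sum>e\<in>X. (excess H (w(T := w T + t)) e)\<^sup>2 - (excess H w e)\<^sup>2)"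
    by (simp add: sum_subtractf)
  also have "\<dots> = (\<Sum>e\<in>T. (max 0 (load H w e + t - 1))\<^sup>2 - (excess H w e)\<^sup>2)"
    using assms by (intro sum.mono_neutral_cong_right) (auto simp: excess_def load_upd)
  finally have 2: "(\<Sum>e\<in>X. (excess H (w(T := w T + t)) e)\<^sup>2) = (\<Sum>e\<in>X. (excess H w e)\<^sup>2)
      + (\<Sum>e\<in>T. (max 0 (load H w e + t - 1))\<^sup>2 - (excess H w e)\<^sup>2)"
    by simp
  show ?thesis unfolding penalized_def 1 2 by (simp add: algebra_simps)
qed

text \<open>A maximizer \<open>w\<close> of the penalized weight over a finite grid below the cap \<open>\<kappa>\<close> satisfies
  first-order conditions, which say that the scaled excesses \<open>f\<close> form a fractional cover of
  all uncapped triples and that \<open>w\<close> and \<open>f\<close> are complementary. This replaces LP duality.\<close>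

lemma soft_duality:
  fixes X :: "'b set" and \<kappa> \<gamma> :: real
  assumes finX: "finite X" and H: "\<And>T. T \<in> H \<Longrightarrow> T \<subseteq> X \<and> card T = 3"
    and \<kappa>: "0 < \<kappa>" and \<gamma>: "0 < \<gamma>" "\<gamma> \<le> 1"
  shows "\<exists>w f. (\<forall>T\<in>H. 0 \<le> w T \<and> w T \<le> \<kappa>) \<and> (\<forall>e\<in>X. load H w e \<le> 1 + 2 * \<gamma>) \<and>
     (\<forall>e\<in>X. 0 \<le> f e) \<and> (\<Sum>e\<in>X. f e) \<le> (1 + \<gamma>) * (\<Sum>T\<in>H. w T) + \<gamma> * card X \<and>
     (\<forall>T\<in>H. w T = \<kappa> \<or> 1 \<le> (\<Sum>e\<in>T. f e))"
proof -
  have finH: "finite H" by (rule finite_subset[of _ "Pow X"]) (use H finX in auto)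
  define l where "l = 1 / \<gamma>"
  have l: "0 < l" unfolding l_def using \<gamma> by simp
  \<comment> \<open>The grid must be so fine that the second-order error
    \<open>3 * l * \<theta> / 2\<close> of one grid step in a triple is at most
    \<open>\<gamma>\<close>.\<close>
  obtain Q :: nat where Q: "3 * l * \<kappa> / (2 * \<gamma>) < Q" using reals_Archimedean2 by blast
  moreover have "0 < 3 * l * \<kappa> / (2 * \<gamma>)" using l \<kappa> \<gamma> by simp
  ultimately have Q0: "0 < Q" by linarith
  define \<theta> where "\<theta> = \<kappa> / Q"
  have \<theta>: "0 < \<theta>" "3 * l * \<theta> / 2 \<le> \<gamma>"
    unfolding \<theta>_def using \<kappa> Q Q0 \<gamma> by (auto simp: field_simps)
  define K where "K = (H \<rightarrow>\<^sub>E {..Q})"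
  define wt where "wt = (\<lambda>k :: 'b set \<Rightarrow> nat. \<lambda>T. \<theta> * real (k T))"
  have finK: "finite K" unfolding K_def using finH by (intro finite_PiE) auto
  have "restrict (\<lambda>_. 0) H \<in> K" unfolding K_def by auto
  then have "K \<noteq> {}" by auto
  then have "Max ((\<lambda>k. penalized X H l (wt k)) ` K) \<in> (\<lambda>k. penalized X H l (wt k)) ` K"
    using finK by (intro Max_in) auto
  then obtain k where k: "k \<in> K" and kM: "penalized X H l (wt k) = Max ((\<lambda>k. penalized X H l (wt k)) ` K)"
    by auto
  have max: "penalized X H l (wt k') \<le> penalized X H l (wt k)" if "k' \<in> K" for k'
    unfolding kM using finK that by (intro Max_ge) auto
  define w where "w = wt k"
  have w0: "0 \<le> w T" for T unfolding w_def wt_def using \<theta> by simp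
  have kT: "k T \<le> Q" if "T \<in> H" for T using k that unfolding K_def by auto
  have upd: "penalized X H l (w(T := w T + t)) \<le> penalized X H l w"
    if T: "T \<in> H" and j: "j \<le> Q" "w T + t = \<theta> * j" for T t j
  proof -
    have "k(T := j) \<in> K" using k T j unfolding K_def by (auto simp: PiE_def extensional_def)
    moreover have "wt (k(T := j)) = w(T := w T + t)" unfolding w_def wt_def using j
      by (auto simp: w_def wt_def)
    ultimately show ?thesis using max unfolding w_def by metis
  qed
  define \<phi> where "\<phi> = excess H w"
  have \<phi>0: "0 \<le> \<phi> e" for e unfolding \<phi>_def excess_def by simp
  \<comment> \<open>The shift \<open>l * \<theta> / 2\<close> per point equals the quadratic error
    of a step upwards, so that \<open>f\<close> covers uncapped triples with no loss.\<close>
  define f where "f = (\<lambda>e. l * \<phi> e + l * \<theta> / 2)"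
  have up: "1 \<le> (\<Sum>e\<in>T. f e)" if T: "T \<in> H" "w T \<noteq> \<kappa>" for T
  proof -
    have "k T \<noteq> Q" using T Q0 unfolding w_def wt_def \<theta>_def by auto
    then have "Suc (k T) \<le> Q" using kT[OF T(1)] by simp
    then have "penalized X H l (w(T := w T + \<theta>)) \<le> penalized X H l w"
      by (rule upd[OF T(1)]) (simp add: w_def wt_def algebra_simps)
    then have "\<theta> \<le> l / 2 * (\<Sum>e\<in>T. (max 0 (load H w e + \<theta> - 1))\<^sup>2 - (\<phi> e)\<^sup>2)"
      using H[OF T(1)] unfolding \<phi>_def by (simp add: penalized_upd[OF finX finH T(1)])
    also have "\<dots> \<le> l / 2 * (\<Sum>e\<in>T. 2 * \<theta> * \<phi> e + \<theta>\<^sup>2)"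
    proof (intro mult_left_mono sum_mono)
      fix e
      have "max 0 (load H w e + \<theta> - 1) \<le> \<phi> e + \<theta>" unfolding \<phi>_def excess_def using \<theta> by auto
      then have "(max 0 (load H w e + \<theta> - 1))\<^sup>2 \<le> (\<phi> e + \<theta>)\<^sup>2" by (intro power_mono) auto
      then show "(max 0 (load H w e + \<theta> - 1))\<^sup>2 - (\<phi> e)\<^sup>2 \<le> 2 * \<theta> * \<phi> e + \<theta>\<^sup>2"
        by (simp add: power2_sum algebra_simps)
    qed (use l in simp)
    also have "\<dots> = (\<Sum>e\<in>T. \<theta> * f e)"
      unfolding f_def sum_distrib_left by (intro sum.cong) (auto simp: algebra_simps power2_eq_square)
    also have "\<dots> = \<theta> * (\<Sum>e\<in>T. f e)" by (simp add: sum_distrib_left)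
    finally show ?thesis using \<theta> by simp
  qed
  have down: "(\<Sum>e\<in>T. l * \<phi> e) \<le> 1 + \<gamma>" if T: "T \<in> H" "w T \<noteq> 0" for T
  proof -
    have "k T \<noteq> 0" using T unfolding w_def wt_def by auto
    then have "w T + (- \<theta>) = \<theta> * real (k T - 1)" unfolding w_def wt_def
      by (simp add: algebra_simps of_nat_diff)
    moreover have "k T - 1 \<le> Q" using kT[OF T(1)] by simp
    ultimately have "penalized X H l (w(T := w T + (- \<theta>))) \<le> penalized X H l w"
      using upd[OF T(1)] by blast
    then have "l / 2 * (\<Sum>e\<in>T. (\<phi> e)\<^sup>2 - (max 0 (load H w e + (- \<theta>) - 1))\<^sup>2) \<le> \<theta>"
      unfolding penalized_upd[OF finX finH T(1) conjunct1[OF H[OF T(1)]]]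
      by (simp add: sum_subtractf \<phi>_def algebra_simps)
    moreover have "l / 2 * (\<Sum>e\<in>T. 2 * \<theta> * \<phi> e - \<theta>\<^sup>2)
        \<le> l / 2 * (\<Sum>e\<in>T. (\<phi> e)\<^sup>2 - (max 0 (load H w e + (- \<theta>) - 1))\<^sup>2)"
    proof (intro mult_left_mono sum_mono)
      fix e
      show "2 * \<theta> * \<phi> e - \<theta>\<^sup>2 \<le> (\<phi> e)\<^sup>2 - (max 0 (load H w e + (- \<theta>) - 1))\<^sup>2"
      proof (cases "load H w e + (- \<theta>) - 1 \<le> 0")
        case True
        have "0 \<le> (\<phi> e - \<theta>)\<^sup>2" by simp
        then show ?thesis using True by (simp add: power2_diff algebra_simps)
      next
        case False
        then have "\<phi> e = load H w e - 1" unfolding \<phi>_def excess_def using \<theta> by auto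
        then have m: "max 0 (load H w e + (- \<theta>) - 1) = \<phi> e - \<theta>" using False by auto
        show ?thesis unfolding m by (simp add: power2_diff algebra_simps)
      qed
    qed (use l in simp)
    moreover have "l / 2 * (\<Sum>e\<in>T. 2 * \<theta> * \<phi> e - \<theta>\<^sup>2) = \<theta> * ((\<Sum>e\<in>T. l * \<phi> e) - 3 * l * \<theta> / 2)"
      using H[OF T(1)] by (simp add: sum_subtractf sum_distrib_left[symmetric] sum_distrib_right[symmetric] algebra_simps power2_eq_square)
    ultimately have "\<theta> * ((\<Sum>e\<in>T. l * \<phi> e) - 3 * l * \<theta> / 2) \<le> \<theta> * 1" by linarith
    then have "(\<Sum>e\<in>T. l * \<phi> e) - 3 * l * \<theta> / 2 \<le> 1" using \<theta>(1) by (simp only: mult_le_cancel_left_pos)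
    then show ?thesis using \<theta>(2) by linarith
  qed
  have load: "load H w e \<le> 1 + 2 * \<gamma>" if "e \<in> X" for e
  proof (cases "\<phi> e = 0")
    case True
    then have "load H w e \<le> 1" unfolding \<phi>_def excess_def by auto
    then show ?thesis using \<gamma> by simp
  next
    case False
    then have e: "load H w e = 1 + \<phi> e" unfolding \<phi>_def excess_def by auto
    then have "load H w e \<noteq> 0" using \<phi>0[of e] by simp
    then obtain T where T: "T \<in> H" "w T * of_bool (e \<in> T) \<noteq> 0"
      unfolding load_def by (meson sum.not_neutral_contains_not_neutral)
    then have eT: "e \<in> T" "w T \<noteq> 0" by (cases "e \<in> T", auto)+
    have "finite T" using H[OF T(1)] finX finite_subset by blast
    then have "l * \<phi> e \<le> (\<Sum>e\<in>T. l * \<phi> e)" using eT \<phi>0 l by (intro member_le_sum) auto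
    then have "l * \<phi> e \<le> 1 + \<gamma>" using down[OF T(1) eT(2)] by simp
    then have "\<phi> e \<le> (1 + \<gamma>) * \<gamma>" unfolding l_def using \<gamma> by (simp add: field_simps)
    also have "\<dots> \<le> 2 * \<gamma>" using \<gamma> by (intro mult_right_mono) auto
    finally show ?thesis using e by simp
  qed
  \<comment> \<open>Complementary slackness in one direction: a positive excess occurs only where
    the load is at least 1. The other direction is \<open>down\<close>, for triples of positive
    weight.\<close>
  have "(\<Sum>e\<in>X. l * \<phi> e) \<le> (\<Sum>e\<in>X. l * \<phi> e * load H w e)"
  proof (rule sum_mono)
    fix e
    show "l * \<phi> e \<le> l * \<phi> e * load H w e"
    proof (cases "\<phi> e = 0")
      case False
      then have "1 \<le> load H w e" unfolding \<phi>_def excess_def by (auto simp: max_def split: if_splits)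
      then have "l * \<phi> e * 1 \<le> l * \<phi> e * load H w e" using l \<phi>0 by (intro mult_left_mono) auto
      then show ?thesis by simp
    qed simp
  qed
  also have "\<dots> = (\<Sum>T\<in>H. w T * (\<Sum>e\<in>T. l * \<phi> e))" by (rule sum_load) (use finX H in auto)
  also have "\<dots> \<le> (\<Sum>T\<in>H. w T * (1 + \<gamma>))"
  proof (rule sum_mono)
    fix T assume "T \<in> H"
    then show "w T * (\<Sum>e\<in>T. l * \<phi> e) \<le> w T * (1 + \<gamma>)"
      using down[of T] w0[of T] by (cases "w T = 0") (auto intro!: mult_left_mono)
  qed
  finally have "(\<Sum>e\<in>X. l * \<phi> e) \<le> (1 + \<gamma>) * (\<Sum>T\<in>H. w T)" by (simp add: sum_distrib_left mult.commute)
  moreover have "l * \<theta> / 2 \<le> \<gamma>" using \<theta>(2) mult_pos_pos[OF l \<theta>(1)] by linarith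
  then have "card X * (l * \<theta> / 2) \<le> card X * \<gamma>" by (intro mult_left_mono) auto
  ultimately have sumf: "(\<Sum>e\<in>X. f e) \<le> (1 + \<gamma>) * (\<Sum>T\<in>H. w T) + \<gamma> * card X"
    unfolding f_def by (simp add: sum.distrib mult.commute)
  have "w T \<le> \<kappa>" if "T \<in> H" for T
  proof -
    have "w T \<le> \<theta> * Q" unfolding w_def wt_def using kT[OF that] \<theta> by (intro mult_left_mono) auto
    then show ?thesis unfolding \<theta>_def using Q0 by simp
  qed
  moreover have "0 \<le> f e" for e unfolding f_def using l \<theta> \<phi>0 by simp
  ultimately show ?thesis using w0 load sumf up by (intro exI[of _ w] exI[of _ f]) blast
qed

subsection \<open>Regular partitions and coloured triangle removal\<close>

text \<open>A partition of \<open>V\<close> is given by a family \<open>\<S>\<close> of sets, its parts being the atoms of \<open>\<S>\<close>;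
  refining means adding sets. Sums over pairs of parts are written as sums over pairs of
  vertices, which weights the parts by their sizes, so no equipartition is needed.\<close>

definition cell :: "'a set \<Rightarrow> 'a set set \<Rightarrow> 'a \<Rightarrow> 'a set" where
  "cell V \<S> x = {y \<in> V. \<forall>S\<in>\<S>. x \<in> S \<longleftrightarrow> y \<in> S}"

definition dens :: "('a \<Rightarrow> 'a \<Rightarrow> real) \<Rightarrow> 'a set \<Rightarrow> 'a set \<Rightarrow> real" where
  "dens g C D = (\<Sum>a\<in>C. \<Sum>b\<in>D. g a b) / (real (card C) * real (card D))"

text \<open>Cut-norm form of regularity: the error is measured against the whole pair, so subsets
  need no minimal size and small ones satisfy the bound for trivial reasons when \<open>g\<close>
  takes values in \<open>[0, 1]\<close>.\<close>

definition regular_pair :: "('a \<Rightarrow> 'a \<Rightarrow> real) \<Rightarrow> real \<Rightarrow> 'a set \<Rightarrow> 'a set \<Rightarrow> bool" where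
  "regular_pair g \<epsilon> C D \<longleftrightarrow> (\<forall>A\<subseteq>C. \<forall>B\<subseteq>D.
     \<bar>\<Sum>a\<in>A. \<Sum>b\<in>B. g a b - dens g C D\<bar> \<le> \<epsilon> * (real (card C) * real (card D)))"

definition energy :: "'a set \<Rightarrow> 'a set set \<Rightarrow> ('a \<Rightarrow> 'a \<Rightarrow> real) \<Rightarrow> real" where
  "energy V \<S> g = (\<Sum>x\<in>V. \<Sum>y\<in>V. (dens g (cell V \<S> x) (cell V \<S> y))\<^sup>2)"

section \<open>Cells and averaging over them\<close>

lemma cell_subset: "cell V \<S> x \<subseteq> V"
  by (auto simp: cell_def)

lemma self_in_cell: "x \<in> V \<Longrightarrow> x \<in> cell V \<S> x"
  by (auto simp: cell_def)

lemma cell_eq: "y \<in> cell V \<S> x \<Longrightarrow> cell V \<S> y = cell V \<S> x"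
  by (auto simp: cell_def)

lemma in_cell_sym: "x \<in> V \<Longrightarrow> y \<in> V \<Longrightarrow> y \<in> cell V \<S> x \<longleftrightarrow> x \<in> cell V \<S> y"
  by (auto simp: cell_def)

lemma cell_antimono: "\<S> \<subseteq> \<S>' \<Longrightarrow> cell V \<S>' x \<subseteq> cell V \<S> x"
  by (auto simp: cell_def)

lemma card_cell_pos: "finite V \<Longrightarrow> x \<in> V \<Longrightarrow> 0 < card (cell V \<S> x)"
  using self_in_cell[of x V \<S>] cell_subset[of V \<S> x] by (metis card_gt_0_iff empty_iff finite_subset)

lemma card_cells_le:
  assumes "finite \<S>"
  shows "card (cell V \<S> ` V) \<le> 2 ^ card \<S>" "finite (cell V \<S> ` V)"
proof -
  have "cell V \<S> x = (\<lambda>P. {y \<in> V. {S \<in> \<S>. y \<in> S} = P}) {S \<in> \<S>. x \<in> S}" for x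
    by (auto simp: cell_def)
  then have sub: "cell V \<S> ` V \<subseteq> (\<lambda>P. {y \<in> V. {S \<in> \<S>. y \<in> S} = P}) ` Pow \<S>"
    by auto
  have fin: "finite ((\<lambda>P. {y \<in> V. {S \<in> \<S>. y \<in> S} = P}) ` Pow \<S>)" using assms by simp
  show "finite (cell V \<S> ` V)" using sub fin by (rule finite_subset)
  have "card (cell V \<S> ` V) \<le> card ((\<lambda>P. {y \<in> V. {S \<in> \<S>. y \<in> S} = P}) ` Pow \<S>)"
    using sub fin by (rule card_mono[rotated])
  also have "\<dots> \<le> card (Pow \<S>)" using assms by (intro card_image_le) simp
  finally show "card (cell V \<S> ` V) \<le> 2 ^ card \<S>" using assms by (simp add: card_Pow)
qed

text \<open>Averaging over cells is a conditional expectation: each \<open>h a\<close> is counted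
  once for every \<open>x\<close> in the cell of \<open>a\<close>, which cancels the division by the
  size of that cell.\<close>

lemma sum_cell_average:
  assumes fin: "finite V" and F: "\<And>x y. x \<in> V \<Longrightarrow> y \<in> cell V \<S> x \<Longrightarrow> F y = F x"
  shows "(\<Sum>x\<in>V. (\<Sum>a\<in>cell V \<S> x. h a) / real (card (cell V \<S> x)) * F x) = (\<Sum>a\<in>V. h a * F a)"
proof -
  let ?c = "cell V \<S>"
  have "(\<Sum>x\<in>V. (\<Sum>a\<in>?c x. h a) / real (card (?c x)) * F x)
      = (\<Sum>x\<in>V. \<Sum>a\<in>V. if a \<in> ?c x then h a / real (card (?c x)) * F x else 0)"
  proof (rule sum.cong[OF refl])
    fix x
    have "(\<Sum>a\<in>V. if a \<in> ?c x then h a / real (card (?c x)) * F x else 0)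
        = (\<Sum>a\<in>V \<inter> ?c x. h a / real (card (?c x)) * F x)"
      by (simp only: sum.inter_restrict[OF fin])
    also have "V \<inter> ?c x = ?c x" by (rule Int_absorb1[OF cell_subset])
    finally show "(\<Sum>a\<in>?c x. h a) / real (card (?c x)) * F x
        = (\<Sum>a\<in>V. if a \<in> ?c x then h a / real (card (?c x)) * F x else 0)"
      by (simp add: sum_divide_distrib sum_distrib_right)
  qed
  also have "\<dots> = (\<Sum>a\<in>V. \<Sum>x\<in>V. if a \<in> ?c x then h a / real (card (?c x)) * F x else 0)"
    by (rule sum.swap)
  also have "\<dots> = (\<Sum>a\<in>V. h a * F a)"
  proof (rule sum.cong[OF refl])
    fix a assume a: "a \<in> V"
    have "(\<Sum>x\<in>V. if a \<in> ?c x then h a / real (card (?c x)) * F x else 0)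
        = (\<Sum>x\<in>V. if x \<in> ?c a then h a / real (card (?c a)) * F a else 0)"
    proof (intro sum.cong refl)
      fix x assume x: "x \<in> V"
      show "(if a \<in> ?c x then h a / real (card (?c x)) * F x else 0)
          = (if x \<in> ?c a then h a / real (card (?c a)) * F a else 0)"
        using in_cell_sym[OF x a, of \<S>] cell_eq[of x V \<S> a] F[OF a, of x] by auto
    qed
    also have "\<dots> = (\<Sum>x\<in>V \<inter> ?c a. h a / real (card (?c a)) * F a)"
      by (simp only: sum.inter_restrict[OF fin])
    also have "V \<inter> ?c a = ?c a" by (rule Int_absorb1[OF cell_subset])
    finally show "(\<Sum>x\<in>V. if a \<in> ?c x then h a / real (card (?c x)) * F x else 0) = h a * F a"
      using card_cell_pos[OF fin a, of \<S>] by simp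
  qed
  finally show ?thesis .
qed

text \<open>The cell average applied in each coordinate: replacing \<open>g\<close> by its densities
  does not change its inner product with a function constant on pairs of cells.\<close>

lemma sum_dens_mult:
  assumes fin: "finite V"
    and F: "\<And>x y x' y'. x \<in> V \<Longrightarrow> y \<in> V \<Longrightarrow> x' \<in> cell V \<S> x \<Longrightarrow> y' \<in> cell V \<S> y \<Longrightarrow> F x' y' = F x y"
  shows "(\<Sum>x\<in>V. \<Sum>y\<in>V. dens g (cell V \<S> x) (cell V \<S> y) * F x y) = (\<Sum>x\<in>V. \<Sum>y\<in>V. g x y * F x y)"
proof -
  let ?c = "cell V \<S>"
  have "(\<Sum>x\<in>V. \<Sum>y\<in>V. dens g (?c x) (?c y) * F x y)
      = (\<Sum>y\<in>V. \<Sum>x\<in>V. (\<Sum>a\<in>?c x. (\<Sum>b\<in>?c y. g a b) / real (card (?c y))) / real (card (?c x)) * F x y)"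
    by (subst sum.swap) (simp add: dens_def sum_divide_distrib mult.commute)
  also have "\<dots> = (\<Sum>y\<in>V. \<Sum>a\<in>V. (\<Sum>b\<in>?c y. g a b) / real (card (?c y)) * F a y)"
    by (rule sum.cong[OF refl], rule sum_cell_average[OF fin], rule F) (auto intro: self_in_cell)
  also have "\<dots> = (\<Sum>a\<in>V. \<Sum>y\<in>V. (\<Sum>b\<in>?c y. g a b) / real (card (?c y)) * F a y)"
    by (rule sum.swap)
  also have "\<dots> = (\<Sum>a\<in>V. \<Sum>b\<in>V. g a b * F a b)"
    by (rule sum.cong[OF refl], rule sum_cell_average[OF fin], rule F) (auto intro: self_in_cell)
  finally show ?thesis .
qed

lemma dens_bounds:
  assumes "\<And>x y. 0 \<le> g x y" "\<And>x y. g x y \<le> 1"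
  shows "0 \<le> dens g C D" "dens g C D \<le> 1"
proof -
  show "0 \<le> dens g C D" unfolding dens_def using assms by (intro divide_nonneg_nonneg sum_nonneg) auto
  have "(\<Sum>a\<in>C. \<Sum>b\<in>D. g a b) \<le> (\<Sum>a\<in>C. \<Sum>b\<in>D. 1)" using assms by (intro sum_mono) auto
  also have "\<dots> = real (card C) * real (card D)" by simp
  finally have "dens g C D \<le> (real (card C) * real (card D)) / (real (card C) * real (card D))"
    unfolding dens_def by (intro divide_right_mono) auto
  also have "\<dots> \<le> 1" by simp
  finally show "dens g C D \<le> 1" .
qed

section \<open>Energy increments and the regularity lemma\<close>

lemma energy_le:
  assumes "finite V" "\<And>x y. 0 \<le> g x y" "\<And>x y. g x y \<le> 1"
  shows "energy V \<S> g \<le> (real (card V))\<^sup>2"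
proof -
  have "energy V \<S> g \<le> (\<Sum>x\<in>V. \<Sum>y\<in>V. 1)"
    unfolding energy_def using dens_bounds[of g] assms by (intro sum_mono power_le_one) auto
  then show ?thesis by (simp add: power2_eq_square)
qed

text \<open>The coarse density is the orthogonal projection of the fine one, as both have the same
  inner product with the coarse density, namely that of \<open>g\<close>.\<close>

lemma energy_pythagoras:
  assumes fin: "finite V" and sub: "\<S> \<subseteq> \<S>'"
  shows "energy V \<S>' g = energy V \<S> g + (\<Sum>x\<in>V. \<Sum>y\<in>V.
    (dens g (cell V \<S>' x) (cell V \<S>' y) - dens g (cell V \<S> x) (cell V \<S> y))\<^sup>2)"
proof -
  let ?d = "\<lambda>x y. dens g (cell V \<S> x) (cell V \<S> y)"
  let ?d' = "\<lambda>x y. dens g (cell V \<S>' x) (cell V \<S>' y)"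
  have inv: "?d x' y' = ?d x y" if "x' \<in> cell V \<S> x" "y' \<in> cell V \<S> y" for x x' y y'
    using cell_eq[OF that(1)] cell_eq[OF that(2)] by simp
  have inv': "?d x' y' = ?d x y" if "x' \<in> cell V \<S>' x" "y' \<in> cell V \<S>' y" for x x' y y'
    using that cell_antimono[OF sub] by (intro inv) blast+
  have 1: "(\<Sum>x\<in>V. \<Sum>y\<in>V. ?d' x y * ?d x y) = (\<Sum>x\<in>V. \<Sum>y\<in>V. g x y * ?d x y)"
    by (rule sum_dens_mult[OF fin]) (use inv' in blast)
  have 2: "(\<Sum>x\<in>V. \<Sum>y\<in>V. ?d x y * ?d x y) = (\<Sum>x\<in>V. \<Sum>y\<in>V. g x y * ?d x y)"
    by (rule sum_dens_mult[OF fin]) (use inv in blast)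
  have "(\<Sum>x\<in>V. \<Sum>y\<in>V. (?d' x y - ?d x y)\<^sup>2)
      = (\<Sum>x\<in>V. \<Sum>y\<in>V. (?d' x y)\<^sup>2) + (\<Sum>x\<in>V. \<Sum>y\<in>V. ?d x y * ?d x y) - 2 * (\<Sum>x\<in>V. \<Sum>y\<in>V. ?d' x y * ?d x y)"
    by (simp add: power2_diff sum.distrib sum_subtractf sum_distrib_left power2_eq_square algebra_simps)
  then show ?thesis unfolding energy_def using 1 2 by (simp add: power2_eq_square)
qed

text \<open>Once \<open>A\<close> and \<open>B\<close> belong to the family, their indicators are
  constant on the new cells. The fine densities then reproduce the discrepancy of \<open>g\<close>
  on \<open>A \<times> B\<close>, and Cauchy-Schwarz bounds their mean square change on the pair
  from below.\<close>

lemma refinement_gain: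
  assumes fin: "finite V" and xy: "x \<in> V" "y \<in> V" and \<epsilon>: "0 \<le> \<epsilon>"
    and sub: "\<S> \<subseteq> \<S>'" and AB: "A \<in> \<S>'" "B \<in> \<S>'" "A \<subseteq> cell V \<S> x" "B \<subseteq> cell V \<S> y"
    and irr: "\<epsilon> * (real (card (cell V \<S> x)) * real (card (cell V \<S> y)))
      < \<bar>\<Sum>a\<in>A. \<Sum>b\<in>B. g a b - dens g (cell V \<S> x) (cell V \<S> y)\<bar>"
  shows "\<epsilon>\<^sup>2 \<le> dens (\<lambda>a b. (dens g (cell V \<S>' a) (cell V \<S>' b) - dens g (cell V \<S> a) (cell V \<S> b))\<^sup>2)
     (cell V \<S> x) (cell V \<S> y)"
proof -
  let ?C = "cell V \<S> x" and ?D = "cell V \<S> y"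
  let ?d = "\<lambda>x y. dens g (cell V \<S> x) (cell V \<S> y)"
  let ?d' = "\<lambda>x y. dens g (cell V \<S>' x) (cell V \<S>' y)"
  let ?N = "real (card ?C) * real (card ?D)"
  have N: "0 < ?N" using card_cell_pos[OF fin] xy by simp
  have finCD: "finite ?C" "finite ?D" using fin cell_subset finite_subset by metis+
  have ABV: "A \<subseteq> V" "B \<subseteq> V"
    using order_trans[OF AB(3) cell_subset] order_trans[OF AB(4) cell_subset] by auto
  have restr: "(\<Sum>a\<in>V. \<Sum>b\<in>V. k a b * of_bool (a \<in> A \<and> b \<in> B)) = (\<Sum>a\<in>A. \<Sum>b\<in>B. k a b)" for k :: "'a \<Rightarrow> 'a \<Rightarrow> real"
  proof -
    have "(\<Sum>a\<in>V. \<Sum>b\<in>V. k a b * of_bool (a \<in> A \<and> b \<in> B)) = (\<Sum>a\<in>A. \<Sum>b\<in>V. k a b * of_bool (a \<in> A \<and> b \<in> B))"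
      using fin ABV by (intro sum.mono_neutral_right) auto
    also have "\<dots> = (\<Sum>a\<in>A. \<Sum>b\<in>B. k a b)"
      using fin ABV by (intro sum.cong refl sum.mono_neutral_cong_right) auto
    finally show ?thesis .
  qed
  have "(\<Sum>a\<in>V. \<Sum>b\<in>V. ?d' a b * of_bool (a \<in> A \<and> b \<in> B)) = (\<Sum>a\<in>V. \<Sum>b\<in>V. g a b * of_bool (a \<in> A \<and> b \<in> B))"
    by (rule sum_dens_mult[OF fin]) (use AB in \<open>auto simp: cell_def\<close>)
  then have eq: "(\<Sum>a\<in>A. \<Sum>b\<in>B. ?d' a b) = (\<Sum>a\<in>A. \<Sum>b\<in>B. g a b)" unfolding restr .
  have const: "?d a b = ?d x y" if "a \<in> A" "b \<in> B" for a b
    using cell_eq[OF subsetD[OF AB(3) that(1)]] cell_eq[OF subsetD[OF AB(4) that(2)]] by simp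
  have "(\<Sum>a\<in>A. \<Sum>b\<in>B. g a b - ?d x y) = (\<Sum>a\<in>A. \<Sum>b\<in>B. ?d' a b) - (\<Sum>a\<in>A. \<Sum>b\<in>B. ?d x y)"
    unfolding eq by (simp only: sum_subtractf)
  also have "(\<Sum>a\<in>A. \<Sum>b\<in>B. ?d x y) = (\<Sum>a\<in>A. \<Sum>b\<in>B. ?d a b)"
    by (intro sum.cong refl) (use const in auto)
  finally have e2: "(\<Sum>a\<in>A. \<Sum>b\<in>B. g a b - ?d x y) = (\<Sum>(a, b)\<in>A \<times> B. ?d' a b - ?d a b)"
    by (simp only: sum_subtractf sum.cartesian_product[symmetric])
  have "(\<epsilon> * ?N)\<^sup>2 \<le> \<bar>\<Sum>a\<in>A. \<Sum>b\<in>B. g a b - ?d x y\<bar>\<^sup>2"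
    using irr \<epsilon> by (intro power_mono) auto
  also have "\<dots> = (\<Sum>z\<in>A \<times> B. ?d' (fst z) (snd z) - ?d (fst z) (snd z))\<^sup>2"
    unfolding e2 by (simp add: case_prod_beta)
  also have "\<dots> \<le> (\<Sum>z\<in>A \<times> B. (?d' (fst z) (snd z) - ?d (fst z) (snd z))\<^sup>2) * (\<Sum>z\<in>A \<times> B. 1\<^sup>2)"
    using Cauchy_Schwarz_ineq_sum[of "\<lambda>z. ?d' (fst z) (snd z) - ?d (fst z) (snd z)" "\<lambda>_. 1" "A \<times> B"] by simp
  also have "\<dots> \<le> (\<Sum>z\<in>?C \<times> ?D. (?d' (fst z) (snd z) - ?d (fst z) (snd z))\<^sup>2) * ?N"
  proof (intro mult_mono sum_mono2)
    have "card (A \<times> B) \<le> card (?C \<times> ?D)" using AB finCD by (intro card_mono) auto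
    then show "(\<Sum>z\<in>A \<times> B. 1\<^sup>2) \<le> ?N"
      by (simp add: card_cartesian_product) (metis of_nat_mult of_nat_le_iff)
  qed (use finCD AB in \<open>auto intro: sum_nonneg\<close>)
  finally have "(\<epsilon> * ?N)\<^sup>2 \<le> (\<Sum>a\<in>?C. \<Sum>b\<in>?D. (?d' a b - ?d a b)\<^sup>2) * ?N"
    by (simp add: sum.cartesian_product case_prod_beta)
  then have "\<epsilon>\<^sup>2 * ?N * ?N \<le> (\<Sum>a\<in>?C. \<Sum>b\<in>?D. (?d' a b - ?d a b)\<^sup>2) * ?N"
    by (simp add: power2_eq_square mult_ac)
  then have "\<epsilon>\<^sup>2 * ?N \<le> (\<Sum>a\<in>?C. \<Sum>b\<in>?D. (?d' a b - ?d a b)\<^sup>2)"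
    using N by (rule mult_right_le_imp_le)
  then show ?thesis unfolding dens_def[of _ ?C ?D] using N by (simp add: pos_le_divide_eq)
qed

definition irregular_pairs :: "'a set \<Rightarrow> 'a set set \<Rightarrow> real \<Rightarrow> ('a \<Rightarrow> 'a \<Rightarrow> real) \<Rightarrow> ('a \<times> 'a) set" where
  "irregular_pairs V \<S> \<epsilon> g = {(x, y) \<in> V \<times> V. \<not> regular_pair g \<epsilon> (cell V \<S> x) (cell V \<S> y)}"

text \<open>One pair of witnesses is added for each kernel and each ordered pair of cells. Choosing
  witnesses by cells instead of by vertices keeps the number of new sets independent of
  \<open>V\<close>, while all kernels gain in the same refinement.\<close>

lemma energy_increment:
  assumes fin: "finite V" "finite \<S>" and \<epsilon>: "0 \<le> \<epsilon>"
  shows "\<exists>\<S>'. \<S> \<subseteq> \<S>' \<and> finite \<S>' \<and> card \<S>' \<le> card \<S> + 2 * q * (2 ^ card \<S>)\<^sup>2 \<and>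
    (\<forall>i<q. energy V \<S>' (g i) \<ge> energy V \<S> (g i) + \<epsilon>\<^sup>2 * card (irregular_pairs V \<S> \<epsilon> (g i)))"
proof -
  define bad where "bad = (\<lambda>i C D A B. A \<subseteq> C \<and> B \<subseteq> D \<and>
     \<epsilon> * (real (card C) * real (card D)) < \<bar>\<Sum>a\<in>A. \<Sum>b\<in>B. g i a b - dens (g i) C D\<bar>)"
  define wA where "wA = (\<lambda>(i, C, D). SOME A. \<exists>B. bad i C D A B)"
  define wB where "wB = (\<lambda>(i, C, D). SOME B. bad i C D (wA (i, C, D)) B)"
  have wit: "bad i C D (wA (i, C, D)) (wB (i, C, D))" if irr: "\<not> regular_pair (g i) \<epsilon> C D" for i C D
  proof -
    have "\<exists>A B. bad i C D A B" using irr unfolding regular_pair_def bad_def by (meson not_le)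
    then have "\<exists>B. bad i C D (wA (i, C, D)) B" unfolding wA_def prod.case by (rule someI_ex)
    then show ?thesis unfolding wB_def prod.case by (rule someI_ex)
  qed
  define I where "I = {..<q} \<times> (cell V \<S> ` V) \<times> (cell V \<S> ` V)"
  define \<S>' where "\<S>' = \<S> \<union> (wA ` I \<union> wB ` I)"
  have finI: "finite I" unfolding I_def using card_cells_le(2)[OF fin(2)] by auto
  have cardI: "card I \<le> q * (2 ^ card \<S>)\<^sup>2"
    unfolding I_def card_cartesian_product power2_eq_square
    using card_cells_le(1)[OF fin(2), of V] by (simp add: mult_le_mono)
  have "card \<S>' \<le> card \<S> + (card (wA ` I) + card (wB ` I))"
    unfolding \<S>'_def by (intro order_trans[OF card_Un_le] add_left_mono card_Un_le)
  also have "\<dots> \<le> card \<S> + (card I + card I)"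
    using finI by (intro add_left_mono add_mono card_image_le)
  also have "\<dots> \<le> card \<S> + 2 * q * (2 ^ card \<S>)\<^sup>2" using cardI by simp
  finally have card': "card \<S>' \<le> card \<S> + 2 * q * (2 ^ card \<S>)\<^sup>2" .
  have "energy V \<S>' (g i) \<ge> energy V \<S> (g i) + \<epsilon>\<^sup>2 * card (irregular_pairs V \<S> \<epsilon> (g i))" if i: "i < q" for i
  proof -
    let ?\<Delta> = "\<lambda>a b. (dens (g i) (cell V \<S>' a) (cell V \<S>' b) - dens (g i) (cell V \<S> a) (cell V \<S> b))\<^sup>2"
    have sub: "\<S> \<subseteq> \<S>'" unfolding \<S>'_def by auto
    have "\<epsilon>\<^sup>2 * card (irregular_pairs V \<S> \<epsilon> (g i)) = (\<Sum>z\<in>irregular_pairs V \<S> \<epsilon> (g i). \<epsilon>\<^sup>2)" by simp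
    also have "\<dots> \<le> (\<Sum>z\<in>irregular_pairs V \<S> \<epsilon> (g i). dens ?\<Delta> (cell V \<S> (fst z)) (cell V \<S> (snd z)))"
    proof (rule sum_mono)
      fix z assume "z \<in> irregular_pairs V \<S> \<epsilon> (g i)"
      then obtain x y where z: "z = (x, y)" and xy: "x \<in> V" "y \<in> V"
        and irr: "\<not> regular_pair (g i) \<epsilon> (cell V \<S> x) (cell V \<S> y)"
        unfolding irregular_pairs_def by auto
      let ?t = "(i, cell V \<S> x, cell V \<S> y)"
      have "?t \<in> I" unfolding I_def using i xy by auto
      then have "wA ?t \<in> \<S>'" "wB ?t \<in> \<S>'" unfolding \<S>'_def by auto
      then show "\<epsilon>\<^sup>2 \<le> dens ?\<Delta> (cell V \<S> (fst z)) (cell V \<S> (snd z))"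
        unfolding z fst_conv snd_conv using wit[OF irr] unfolding bad_def
        by (intro refinement_gain[OF fin(1) xy \<epsilon> sub, of "wA ?t" "wB ?t"]) auto
    qed
    also have "\<dots> \<le> (\<Sum>z\<in>V \<times> V. dens ?\<Delta> (cell V \<S> (fst z)) (cell V \<S> (snd z)))"
      using fin by (intro sum_mono2)
        (auto simp: irregular_pairs_def dens_def intro!: divide_nonneg_nonneg sum_nonneg)
    also have "\<dots> = (\<Sum>x\<in>V. \<Sum>y\<in>V. dens ?\<Delta> (cell V \<S> x) (cell V \<S> y) * 1)"
      by (simp add: sum.cartesian_product case_prod_beta)
    also have "\<dots> = (\<Sum>x\<in>V. \<Sum>y\<in>V. ?\<Delta> x y * 1)" by (rule sum_dens_mult[OF fin(1)]) simp
    finally show ?thesis unfolding energy_pythagoras[OF fin(1) sub] by simp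
  qed
  moreover have "finite \<S>'" unfolding \<S>'_def using fin finI by simp
  ultimately show ?thesis using card' by (intro exI[of _ \<S>']) (auto simp: \<S>'_def)
qed

text \<open>Each failed round raises the total energy of the \<open>q\<close> kernels by at least
  \<open>\<epsilon> ^ 3 * n\<^sup>2\<close>, and this total never exceeds
  \<open>q * n\<^sup>2\<close>. The number of rounds, and with it \<open>M\<close>, is therefore
  fixed by \<open>\<epsilon>\<close> and \<open>q\<close> before \<open>V\<close> is given.\<close>

lemma regularity:
  fixes \<epsilon> :: real and q :: nat
  assumes \<epsilon>: "0 < \<epsilon>"
  shows "\<exists>M. \<forall>(V :: 'a set) (g :: nat \<Rightarrow> 'a \<Rightarrow> 'a \<Rightarrow> real).
    finite V \<longrightarrow> (\<forall>i x y. 0 \<le> g i x y \<and> g i x y \<le> 1) \<longrightarrow>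
    (\<exists>\<S>. finite \<S> \<and> card \<S> \<le> M \<and>
      (\<Sum>i<q. real (card (irregular_pairs V \<S> \<epsilon> (g i)))) \<le> \<epsilon> * (real (card V))\<^sup>2)"
proof -
  have step: "\<exists>M. \<forall>(V :: 'a set) (g :: nat \<Rightarrow> 'a \<Rightarrow> 'a \<Rightarrow> real). finite V \<longrightarrow>
      (\<exists>\<S>. finite \<S> \<and> card \<S> \<le> M \<and>
        ((\<Sum>i<q. real (card (irregular_pairs V \<S> \<epsilon> (g i)))) \<le> \<epsilon> * (real (card V))\<^sup>2 \<or>
         (\<Sum>i<q. energy V \<S> (g i)) \<ge> real s * \<epsilon> ^ 3 * (real (card V))\<^sup>2))" for s
  proof (induction s)
    case 0
    show ?case
      by (intro exI[of _ 0] allI impI exI[of _ "{}"])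
        (auto simp: energy_def intro!: sum_nonneg)
  next
    case (Suc s)
    then obtain M where M: "\<And>(V :: 'a set) (g :: nat \<Rightarrow> 'a \<Rightarrow> 'a \<Rightarrow> real). finite V \<Longrightarrow>
      (\<exists>\<S>. finite \<S> \<and> card \<S> \<le> M \<and>
        ((\<Sum>i<q. real (card (irregular_pairs V \<S> \<epsilon> (g i)))) \<le> \<epsilon> * (real (card V))\<^sup>2 \<or>
         (\<Sum>i<q. energy V \<S> (g i)) \<ge> real s * \<epsilon> ^ 3 * (real (card V))\<^sup>2))"
      by blast
    show ?case
    proof (intro exI[of _ "M + 2 * q * (2 ^ M)\<^sup>2"] allI impI)
      fix V :: "'a set" and g :: "nat \<Rightarrow> 'a \<Rightarrow> 'a \<Rightarrow> real"
      assume fin: "finite V"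
      then obtain \<S> where S: "finite \<S>" "card \<S> \<le> M"
        and dich: "(\<Sum>i<q. real (card (irregular_pairs V \<S> \<epsilon> (g i)))) \<le> \<epsilon> * (real (card V))\<^sup>2 \<or>
         (\<Sum>i<q. energy V \<S> (g i)) \<ge> real s * \<epsilon> ^ 3 * (real (card V))\<^sup>2"
        using M by blast
      show "\<exists>\<S>. finite \<S> \<and> card \<S> \<le> M + 2 * q * (2 ^ M)\<^sup>2 \<and>
        ((\<Sum>i<q. real (card (irregular_pairs V \<S> \<epsilon> (g i)))) \<le> \<epsilon> * (real (card V))\<^sup>2 \<or>
         (\<Sum>i<q. energy V \<S> (g i)) \<ge> real (Suc s) * \<epsilon> ^ 3 * (real (card V))\<^sup>2)"
      proof (cases "(\<Sum>i<q. real (card (irregular_pairs V \<S> \<epsilon> (g i)))) \<le> \<epsilon> * (real (card V))\<^sup>2")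
        case True
        then show ?thesis using S by (intro exI[of _ \<S>]) auto
      next
        case False
        obtain \<S>' where S': "finite \<S>'" "card \<S>' \<le> card \<S> + 2 * q * (2 ^ card \<S>)\<^sup>2"
          and inc: "\<And>i. i < q \<Longrightarrow> energy V \<S>' (g i) \<ge> energy V \<S> (g i) + \<epsilon>\<^sup>2 * card (irregular_pairs V \<S> \<epsilon> (g i))"
          using energy_increment[OF fin S(1), of \<epsilon> q g] \<epsilon> by auto
        have "card \<S>' \<le> M + 2 * q * (2 ^ M)\<^sup>2"
          using S S' by (meson add_mono le_trans mult_le_mono2 one_le_numeral power_increasing power_mono zero_le)
        moreover have "real (Suc s) * \<epsilon> ^ 3 * (real (card V))\<^sup>2 \<le> (\<Sum>i<q. energy V \<S>' (g i))"
        proof -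
          have "\<epsilon>\<^sup>2 * (\<epsilon> * (real (card V))\<^sup>2) \<le> \<epsilon>\<^sup>2 * (\<Sum>i<q. real (card (irregular_pairs V \<S> \<epsilon> (g i))))"
            using False by (intro mult_left_mono) auto
          moreover have "(\<Sum>i<q. energy V \<S> (g i) + \<epsilon>\<^sup>2 * card (irregular_pairs V \<S> \<epsilon> (g i))) \<le> (\<Sum>i<q. energy V \<S>' (g i))"
            using inc by (intro sum_mono) auto
          ultimately show ?thesis using dich False
            by (simp add: sum.distrib sum_distrib_left algebra_simps power2_eq_square power3_eq_cube)
        qed
        ultimately show ?thesis using S' by blast
      qed
    qed
  qed
  obtain s :: nat where s: "real q / \<epsilon> ^ 3 < s" using reals_Archimedean2 by blast
  obtain M where M: "\<And>(V :: 'a set) (g :: nat \<Rightarrow> 'a \<Rightarrow> 'a \<Rightarrow> real). finite V \<Longrightarrow>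
      (\<exists>\<S>. finite \<S> \<and> card \<S> \<le> M \<and>
        ((\<Sum>i<q. real (card (irregular_pairs V \<S> \<epsilon> (g i)))) \<le> \<epsilon> * (real (card V))\<^sup>2 \<or>
         (\<Sum>i<q. energy V \<S> (g i)) \<ge> real s * \<epsilon> ^ 3 * (real (card V))\<^sup>2))"
    using step[of s] by blast
  show ?thesis
  proof (intro exI[of _ M] allI impI)
    fix V :: "'a set" and g :: "nat \<Rightarrow> 'a \<Rightarrow> 'a \<Rightarrow> real"
    assume fin: "finite V" and g: "\<forall>i x y. 0 \<le> g i x y \<and> g i x y \<le> 1"
    obtain \<S> where S: "finite \<S>" "card \<S> \<le> M"
      and dich: "(\<Sum>i<q. real (card (irregular_pairs V \<S> \<epsilon> (g i)))) \<le> \<epsilon> * (real (card V))\<^sup>2 \<or>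
         (\<Sum>i<q. energy V \<S> (g i)) \<ge> real s * \<epsilon> ^ 3 * (real (card V))\<^sup>2"
      using M[OF fin] by blast
    have "(\<Sum>i<q. real (card (irregular_pairs V \<S> \<epsilon> (g i)))) \<le> \<epsilon> * (real (card V))\<^sup>2"
    proof (cases "V = {}")
      case True
      then show ?thesis by (simp add: irregular_pairs_def)
    next
      case False
      have "(\<Sum>i<q. energy V \<S> (g i)) \<le> (\<Sum>i<q. (real (card V))\<^sup>2)"
        using g by (intro sum_mono energy_le[OF fin]) auto
      also have "\<dots> = q * (real (card V))\<^sup>2" by simp
      also have "\<dots> < real s * \<epsilon> ^ 3 * (real (card V))\<^sup>2"
        using s \<epsilon> False fin by (intro mult_strict_right_mono) (auto simp: field_simps card_gt_0_iff)
      finally show ?thesis using dich by simp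
    qed
    then show "\<exists>\<S>. finite \<S> \<and> card \<S> \<le> M \<and>
      (\<Sum>i<q. real (card (irregular_pairs V \<S> \<epsilon> (g i)))) \<le> \<epsilon> * (real (card V))\<^sup>2"
      using S by blast
  qed
qed

section \<open>Counting lemma and removal for several relations at once\<close>

abbreviation rel_kernel :: "('a \<Rightarrow> 'a \<Rightarrow> bool) \<Rightarrow> 'a \<Rightarrow> 'a \<Rightarrow> real" where
  "rel_kernel R \<equiv> (\<lambda>x y. of_bool (R x y))"

text \<open>The form needed for counting triangles: with the third vertex fixed, \<open>P\<close>
  and \<open>Q\<close> select its neighbourhoods in the two parts.\<close>

lemma regular_pair_restrict:
  assumes "regular_pair g \<epsilon> A B" "finite A" "finite B"
  shows "- (\<epsilon> * (real (card A) * real (card B)))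
    \<le> (\<Sum>a\<in>A. \<Sum>b\<in>B. (g a b - dens g A B) * of_bool (P a) * of_bool (Q b))"
proof -
  have "(\<Sum>a\<in>A. \<Sum>b\<in>B. (g a b - dens g A B) * of_bool (P a) * of_bool (Q b))
      = (\<Sum>a\<in>{a \<in> A. P a}. \<Sum>b\<in>B. (g a b - dens g A B) * of_bool (P a) * of_bool (Q b))"
    using assms by (intro sum.mono_neutral_right) auto
  also have "\<dots> = (\<Sum>a\<in>{a \<in> A. P a}. \<Sum>b\<in>{b \<in> B. Q b}. g a b - dens g A B)"
    using assms by (intro sum.cong refl sum.mono_neutral_cong_right) auto
  finally have eq: "(\<Sum>a\<in>A. \<Sum>b\<in>B. (g a b - dens g A B) * of_bool (P a) * of_bool (Q b))
     = (\<Sum>a\<in>{a \<in> A. P a}. \<Sum>b\<in>{b \<in> B. Q b}. g a b - dens g A B)" .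
  have "{a \<in> A. P a} \<subseteq> A" "{b \<in> B. Q b} \<subseteq> B" by auto
  then have "\<bar>\<Sum>a\<in>{a \<in> A. P a}. \<Sum>b\<in>{b \<in> B. Q b}. g a b - dens g A B\<bar> \<le> \<epsilon> * (real (card A) * real (card B))"
    using assms(1) unfolding regular_pair_def by blast
  then show ?thesis unfolding eq by linarith
qed

text \<open>Telescoping: the three relations are replaced by their densities one at a time. In each
  difference one vertex is fixed and regularity of the other two parts bounds the error, so each
  replacement costs at most \<open>\<epsilon>\<close> times the number of triples.\<close>

lemma triangle_counting:
  assumes fin: "finite A" "finite B" "finite C" and \<epsilon>: "0 \<le> \<epsilon>"
    and reg: "regular_pair (rel_kernel R1) \<epsilon> A B" "regular_pair (rel_kernel R2) \<epsilon> B C" "regular_pair (rel_kernel R3) \<epsilon> A C"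
  shows "(dens (rel_kernel R1) A B * dens (rel_kernel R2) B C * dens (rel_kernel R3) A C - 3 * \<epsilon>)
      * (real (card A) * real (card B) * real (card C))
    \<le> (\<Sum>a\<in>A. \<Sum>b\<in>B. \<Sum>c\<in>C. of_bool (R1 a b \<and> R2 b c \<and> R3 a c))"
proof -
  define d1 where "d1 = dens (rel_kernel R1) A B"
  define d2 where "d2 = dens (rel_kernel R2) B C"
  define d3 where "d3 = dens (rel_kernel R3) A C"
  have d: "0 \<le> d1" "d1 \<le> 1" "0 \<le> d2" "d2 \<le> 1"
    unfolding d1_def d2_def by (intro dens_bounds; simp)+
  let ?N = "real (card A) * real (card B) * real (card C)"
  let ?r1 = "\<lambda>a b. rel_kernel R1 a b - d1"
  let ?r2 = "\<lambda>b c. rel_kernel R2 b c - d2"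
  let ?r3 = "\<lambda>a c. rel_kernel R3 a c - d3"
  have t1: "- (\<epsilon> * ?N) \<le> (\<Sum>a\<in>A. \<Sum>b\<in>B. \<Sum>c\<in>C. ?r1 a b * of_bool (R3 a c) * of_bool (R2 b c))"
  proof -
    have "- (\<epsilon> * ?N) = (\<Sum>c\<in>C. - (\<epsilon> * (real (card A) * real (card B))))" by simp
    also have "\<dots> \<le> (\<Sum>c\<in>C. \<Sum>a\<in>A. \<Sum>b\<in>B. ?r1 a b * of_bool (R3 a c) * of_bool (R2 b c))"
      unfolding d1_def by (intro sum_mono regular_pair_restrict[OF reg(1) fin(1,2)])
    also have "\<dots> = (\<Sum>a\<in>A. \<Sum>c\<in>C. \<Sum>b\<in>B. ?r1 a b * of_bool (R3 a c) * of_bool (R2 b c))"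
      by (rule sum.swap)
    also have "\<dots> = (\<Sum>a\<in>A. \<Sum>b\<in>B. \<Sum>c\<in>C. ?r1 a b * of_bool (R3 a c) * of_bool (R2 b c))"
      by (intro sum.cong refl sum.swap)
    finally show ?thesis .
  qed
  have t2: "- (\<epsilon> * ?N) \<le> (\<Sum>a\<in>A. \<Sum>b\<in>B. \<Sum>c\<in>C. ?r2 b c * of_bool True * of_bool (R3 a c))"
  proof -
    have "- (\<epsilon> * ?N) = (\<Sum>a\<in>A. - (\<epsilon> * (real (card B) * real (card C))))" by simp
    also have "\<dots> \<le> (\<Sum>a\<in>A. \<Sum>b\<in>B. \<Sum>c\<in>C. ?r2 b c * of_bool True * of_bool (R3 a c))"
      unfolding d2_def by (intro sum_mono regular_pair_restrict[OF reg(2) fin(2,3)])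
    finally show ?thesis .
  qed
  have t3: "- (\<epsilon> * ?N) \<le> (\<Sum>a\<in>A. \<Sum>b\<in>B. \<Sum>c\<in>C. ?r3 a c * of_bool True * of_bool True)"
  proof -
    have "- (\<epsilon> * ?N) = (\<Sum>b\<in>B. - (\<epsilon> * (real (card A) * real (card C))))" by simp
    also have "\<dots> \<le> (\<Sum>b\<in>B. \<Sum>a\<in>A. \<Sum>c\<in>C. ?r3 a c * of_bool True * of_bool True)"
      unfolding d3_def by (intro sum_mono regular_pair_restrict[OF reg(3) fin(1,3)])
    also have "\<dots> = (\<Sum>a\<in>A. \<Sum>b\<in>B. \<Sum>c\<in>C. ?r3 a c * of_bool True * of_bool True)"
      by (rule sum.swap)
    finally show ?thesis .
  qed
  have N0: "0 \<le> \<epsilon> * ?N" using \<epsilon> by simp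
  have pos: "- (\<epsilon> * ?N) \<le> k * s" if "0 \<le> k" "k \<le> 1" "- (\<epsilon> * ?N) \<le> s" for k s :: real
  proof -
    have "k * - (\<epsilon> * ?N) \<le> k * s" using that by (intro mult_left_mono)
    moreover have "k * (\<epsilon> * ?N) \<le> 1 * (\<epsilon> * ?N)" using that N0 by (intro mult_right_mono)
    ultimately show ?thesis by linarith
  qed
  have d12: "0 \<le> d1 * d2" "d1 * d2 \<le> 1" using d by (auto intro: mult_le_one)
  have "(\<Sum>a\<in>A. \<Sum>b\<in>B. \<Sum>c\<in>C. of_bool (R1 a b \<and> R2 b c \<and> R3 a c))
    = (\<Sum>a\<in>A. \<Sum>b\<in>B. \<Sum>c\<in>C. ?r1 a b * of_bool (R3 a c) * of_bool (R2 b c)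
        + d1 * (?r2 b c * of_bool True * of_bool (R3 a c))
        + (d1 * d2) * (?r3 a c * of_bool True * of_bool True) + d1 * d2 * d3)"
    by (intro sum.cong refl) (simp add: of_bool_conj algebra_simps)
  also have "\<dots> = (\<Sum>a\<in>A. \<Sum>b\<in>B. \<Sum>c\<in>C. ?r1 a b * of_bool (R3 a c) * of_bool (R2 b c))
     + d1 * (\<Sum>a\<in>A. \<Sum>b\<in>B. \<Sum>c\<in>C. ?r2 b c * of_bool True * of_bool (R3 a c))
     + (d1 * d2) * (\<Sum>a\<in>A. \<Sum>b\<in>B. \<Sum>c\<in>C. ?r3 a c * of_bool True * of_bool True)
     + d1 * d2 * d3 * ?N"
    by (simp only: sum.distrib sum_distrib_left[symmetric]) simp
  finally show ?thesis
    using t1 pos[OF d(1,2) t2] pos[OF d12 t3]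
    unfolding d1_def[symmetric] d2_def[symmetric] d3_def[symmetric]
    by (simp only: left_diff_distrib)
qed

text \<open>The condition on the density is constant on pairs of cells, so the number of these pairs
  is a sum of densities, each below \<open>d\<close>.\<close>

lemma card_low_density_le:
  assumes fin: "finite V" and d: "0 \<le> d"
  shows "real (card {(x, y) \<in> V \<times> V. R x y \<and> dens (rel_kernel R) (cell V \<S> x) (cell V \<S> y) < d})
    \<le> d * (real (card V))\<^sup>2"
proof -
  let ?d = "\<lambda>x y. dens (rel_kernel R) (cell V \<S> x) (cell V \<S> y)"
  have "real (card {(x, y) \<in> V \<times> V. R x y \<and> ?d x y < d}) = (\<Sum>z\<in>V \<times> V. of_bool (R (fst z) (snd z) \<and> ?d (fst z) (snd z) < d))"
  proof -
    have "{(x, y) \<in> V \<times> V. R x y \<and> ?d x y < d} = V \<times> V \<inter> {z. R (fst z) (snd z) \<and> ?d (fst z) (snd z) < d}"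
      by auto
    then show ?thesis using fin by (simp only: sum_of_bool_eq finite_cartesian_product)
  qed
  also have "\<dots> = (\<Sum>x\<in>V. \<Sum>y\<in>V. rel_kernel R x y * of_bool (?d x y < d))"
    by (simp add: sum.cartesian_product case_prod_beta of_bool_conj)
  also have "\<dots> = (\<Sum>x\<in>V. \<Sum>y\<in>V. ?d x y * of_bool (?d x y < d))"
    by (rule sum_dens_mult[OF fin, symmetric]) (simp add: cell_eq)
  also have "\<dots> \<le> (\<Sum>x\<in>V. \<Sum>y\<in>V. d)"
    using d by (intro sum_mono) (auto simp: of_bool_def)
  finally show ?thesis by (simp add: power2_eq_square mult_ac)
qed

lemma card_small_cells_le:
  assumes fin: "finite V" "finite \<S>" and s: "0 \<le> s"
  shows "real (card {x \<in> V. real (card (cell V \<S> x)) < s}) \<le> 2 ^ card \<S> * s"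
proof -
  let ?K = "{C \<in> cell V \<S> ` V. real (card C) < s}"
  have "\<Union>?K \<subseteq> V" using cell_subset[of V \<S>] by blast
  then have "finite (\<Union>?K)" using fin(1) by (rule finite_subset)
  moreover have "{x \<in> V. real (card (cell V \<S> x)) < s} \<subseteq> \<Union>?K" using self_in_cell by fastforce
  ultimately have "card {x \<in> V. real (card (cell V \<S> x)) < s} \<le> card (\<Union>?K)"
    by (rule card_mono)
  also have "\<dots> \<le> (\<Sum>C\<in>?K. card C)" by (rule card_Union_le_sum_card_weak) (auto intro: finite_subset[OF cell_subset fin(1)])
  finally have "real (card {x \<in> V. real (card (cell V \<S> x)) < s}) \<le> (\<Sum>C\<in>?K. real (card C))"
    by (metis (no_types, lifting) of_nat_le_iff of_nat_sum sum.cong)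
  also have "\<dots> \<le> (\<Sum>C\<in>?K. s)" by (intro sum_mono) auto
  also have "\<dots> = card ?K * s" by simp
  also have "\<dots> \<le> 2 ^ card \<S> * s"
  proof (intro mult_right_mono s)
    have "card ?K \<le> card (cell V \<S> ` V)" using card_cells_le(2)[OF fin(2)] by (intro card_mono) auto
    also have "\<dots> \<le> 2 ^ card \<S>" by (rule card_cells_le(1)[OF fin(2)])
    finally show "real (card ?K) \<le> 2 ^ card \<S>" by (metis of_nat_le_iff of_nat_numeral of_nat_power)
  qed
  finally show ?thesis .
qed

text \<open>Colours carry edge weights through the removal: a single \<open>D\<close> serves all
  triples of colours, and a triangle that avoids \<open>D\<close> forces cubically many triangles of
  the same colour pattern. The relations act on ordered pairs, and the three cells in the counting
  may coincide.\<close>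

lemma coloured_removal:
  fixes \<epsilon> :: real and q :: nat
  assumes \<epsilon>: "0 < \<epsilon>"
  shows "\<exists>\<delta>>0. \<forall>(V :: 'a set) (R :: nat \<Rightarrow> 'a \<Rightarrow> 'a \<Rightarrow> bool). finite V \<longrightarrow>
    (\<exists>D\<subseteq>V \<times> V. real (card D) \<le> \<epsilon> * (real (card V))\<^sup>2 \<and>
      (\<forall>i<q. \<forall>j<q. \<forall>k<q. \<forall>x\<in>V. \<forall>y\<in>V. \<forall>z\<in>V.
        R i x y \<longrightarrow> R j y z \<longrightarrow> R k x z \<longrightarrow> (x, y) \<notin> D \<longrightarrow> (y, z) \<notin> D \<longrightarrow> (x, z) \<notin> D \<longrightarrow>
        \<delta> * real (card V) ^ 3 \<le> real (card {(a, b, c) \<in> V \<times> V \<times> V. R i a b \<and> R j b c \<and> R k a c})))"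
proof -
  \<comment> \<open>Small cells, irregular pairs and pairs of low density each cost at most
    \<open>\<epsilon> / 4 * n\<^sup>2\<close> deletions; the low densities of all \<open>q\<close>
    colours share one such budget. With \<open>3 * \<epsilon>' \<le> d ^ 3 / 2\<close>, at least
    half of the predicted \<open>d ^ 3\<close> survives the counting error.\<close>
  define d where "d = \<epsilon> / (4 * (real q + 1))"
  define \<epsilon>' where "\<epsilon>' = min (\<epsilon> / 4) (d ^ 3 / 6)"
  have d: "0 < d" "real q * d \<le> \<epsilon> / 4" unfolding d_def using \<epsilon> by (auto simp: field_simps)
  have \<epsilon>': "0 < \<epsilon>'" "\<epsilon>' \<le> \<epsilon> / 4" "3 * \<epsilon>' \<le> d ^ 3 / 2" unfolding \<epsilon>'_def using \<epsilon> d by auto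
  obtain M where M: "\<And>(V :: 'a set) (g :: nat \<Rightarrow> 'a \<Rightarrow> 'a \<Rightarrow> real).
    finite V \<Longrightarrow> (\<forall>i x y. 0 \<le> g i x y \<and> g i x y \<le> 1) \<Longrightarrow>
    (\<exists>\<S>. finite \<S> \<and> card \<S> \<le> M \<and>
      (\<Sum>i<q. real (card (irregular_pairs V \<S> \<epsilon>' (g i)))) \<le> \<epsilon>' * (real (card V))\<^sup>2)"
    using regularity[OF \<epsilon>'(1), of q] by blast
  define \<gamma> where "\<gamma> = \<epsilon> / (8 * 2 ^ M)"
  have \<gamma>: "0 < \<gamma>" unfolding \<gamma>_def using \<epsilon> by simp
  define \<delta> where "\<delta> = d ^ 3 / 2 * \<gamma> ^ 3"
  have \<delta>: "0 < \<delta>" unfolding \<delta>_def using d \<gamma> by simp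
  show ?thesis
  proof (intro exI[of _ \<delta>] conjI \<delta> allI impI)
    fix V :: "'a set" and R :: "nat \<Rightarrow> 'a \<Rightarrow> 'a \<Rightarrow> bool"
    assume fin: "finite V"
    let ?n = "real (card V)"
    obtain \<S> where S: "finite \<S>" "card \<S> \<le> M"
      and irr: "(\<Sum>i<q. real (card (irregular_pairs V \<S> \<epsilon>' (rel_kernel (R i))))) \<le> \<epsilon>' * ?n\<^sup>2"
      using M[OF fin, of "\<lambda>i. rel_kernel (R i)"] by auto
    let ?c = "cell V \<S>"
    define W where "W = {x \<in> V. real (card (?c x)) < \<gamma> * ?n}"
    define D1 where "D1 = W \<times> V \<union> V \<times> W"
    define D2 where "D2 = (\<Union>i<q. irregular_pairs V \<S> \<epsilon>' (rel_kernel (R i)))"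
    define low where "low = (\<lambda>i. {(x, y) \<in> V \<times> V. R i x y \<and> dens (rel_kernel (R i)) (?c x) (?c y) < d})"
    define D3 where "D3 = (\<Union>i<q. low i)"
    define D where "D = D1 \<union> D2 \<union> D3"
    have DV: "D \<subseteq> V \<times> V" unfolding D_def D1_def D2_def D3_def W_def irregular_pairs_def low_def by auto
    have "real (card W) \<le> 2 ^ card \<S> * (\<gamma> * ?n)"
      unfolding W_def using \<gamma> by (intro card_small_cells_le fin S) auto
    also have "\<dots> \<le> 2 ^ M * (\<gamma> * ?n)" using S \<gamma> by (intro mult_right_mono power_increasing) auto
    also have "\<dots> = \<epsilon> / 8 * ?n" unfolding \<gamma>_def by simp
    finally have W: "real (card W) \<le> \<epsilon> / 8 * ?n" .
    have "real (card D1) \<le> real (card (W \<times> V)) + real (card (V \<times> W))"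
      unfolding D1_def using card_Un_le[of "W \<times> V" "V \<times> W"] by linarith
    also have "\<dots> = 2 * real (card W) * ?n" by (simp add: card_cartesian_product)
    also have "\<dots> \<le> 2 * (\<epsilon> / 8 * ?n) * ?n" using W by (intro mult_right_mono mult_left_mono) auto
    finally have D1: "real (card D1) \<le> \<epsilon> / 4 * ?n\<^sup>2" by (simp add: power2_eq_square)
    have "card D2 \<le> (\<Sum>i<q. card (irregular_pairs V \<S> \<epsilon>' (rel_kernel (R i))))"
      unfolding D2_def by (rule card_UN_le) simp
    then have "real (card D2) \<le> (\<Sum>i<q. real (card (irregular_pairs V \<S> \<epsilon>' (rel_kernel (R i)))))"
      by (metis of_nat_le_iff of_nat_sum)
    then have "real (card D2) \<le> \<epsilon>' * ?n\<^sup>2" using irr by linarith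
    also have "\<dots> \<le> \<epsilon> / 4 * ?n\<^sup>2" using \<epsilon>' by (intro mult_right_mono) auto
    finally have D2: "real (card D2) \<le> \<epsilon> / 4 * ?n\<^sup>2" .
    have "card D3 \<le> (\<Sum>i<q. card (low i))" unfolding D3_def by (rule card_UN_le) simp
    then have "real (card D3) \<le> (\<Sum>i<q. real (card (low i)))" by (metis of_nat_le_iff of_nat_sum)
    also have "\<dots> \<le> (\<Sum>i<q. d * ?n\<^sup>2)"
      unfolding low_def using d by (intro sum_mono card_low_density_le fin) auto
    also have "\<dots> = real q * d * ?n\<^sup>2" by simp
    also have "\<dots> \<le> \<epsilon> / 4 * ?n\<^sup>2" using d by (intro mult_right_mono) auto
    finally have D3: "real (card D3) \<le> \<epsilon> / 4 * ?n\<^sup>2" .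
    have "card D \<le> card D1 + card D2 + card D3"
      unfolding D_def by (meson add_le_mono card_Un_le le_refl le_trans)
    then have "real (card D) \<le> 3 * (\<epsilon> / 4 * ?n\<^sup>2)" using D1 D2 D3 by linarith
    also have "\<dots> \<le> \<epsilon> * ?n\<^sup>2" using \<epsilon> by simp
    finally have cardD: "real (card D) \<le> \<epsilon> * ?n\<^sup>2" .
    have good: "\<gamma> * ?n \<le> real (card (?c x)) \<and> \<gamma> * ?n \<le> real (card (?c y)) \<and>
        regular_pair (rel_kernel (R i)) \<epsilon>' (?c x) (?c y) \<and> d \<le> dens (rel_kernel (R i)) (?c x) (?c y)"
      if "i < q" "x \<in> V" "y \<in> V" "R i x y" "(x, y) \<notin> D" for i x y
      using that unfolding D_def D1_def D2_def D3_def W_def irregular_pairs_def low_def by auto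
    have finc: "finite (?c x)" for x using fin cell_subset finite_subset by metis
    show "\<exists>D\<subseteq>V \<times> V. real (card D) \<le> \<epsilon> * (real (card V))\<^sup>2 \<and>
      (\<forall>i<q. \<forall>j<q. \<forall>k<q. \<forall>x\<in>V. \<forall>y\<in>V. \<forall>z\<in>V.
        R i x y \<longrightarrow> R j y z \<longrightarrow> R k x z \<longrightarrow> (x, y) \<notin> D \<longrightarrow> (y, z) \<notin> D \<longrightarrow> (x, z) \<notin> D \<longrightarrow>
        \<delta> * real (card V) ^ 3 \<le> real (card {(a, b, c) \<in> V \<times> V \<times> V. R i a b \<and> R j b c \<and> R k a c}))"
    proof (intro exI[of _ D] conjI DV cardD allI ballI impI)
      fix i j k x y z
      assume ijk: "i < q" "j < q" "k < q" and V: "x \<in> V" "y \<in> V" "z \<in> V"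
        and RR: "R i x y" "R j y z" "R k x z" and nD: "(x, y) \<notin> D" "(y, z) \<notin> D" "(x, z) \<notin> D"
      note g1 = good[OF ijk(1) V(1,2) RR(1) nD(1)]
      note g2 = good[OF ijk(2) V(2,3) RR(2) nD(2)]
      note g3 = good[OF ijk(3) V(1,3) RR(3) nD(3)]
      let ?d1 = "dens (rel_kernel (R i)) (?c x) (?c y)"
      let ?d2 = "dens (rel_kernel (R j)) (?c y) (?c z)"
      let ?d3 = "dens (rel_kernel (R k)) (?c x) (?c z)"
      let ?T = "{(a, b, c) \<in> V \<times> V \<times> V. R i a b \<and> R j b c \<and> R k a c}"
      have "d * d * d \<le> ?d1 * ?d2 * ?d3" using g1 g2 g3 d by (intro mult_mono) auto
      then have ddd: "d ^ 3 / 2 \<le> ?d1 * ?d2 * ?d3 - 3 * \<epsilon>'" using \<epsilon>' by (simp add: power3_eq_cube)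
      moreover have "\<gamma> * ?n * (\<gamma> * ?n) * (\<gamma> * ?n) \<le> real (card (?c x)) * real (card (?c y)) * real (card (?c z))"
        using g1 g2 \<gamma> by (intro mult_mono) auto
      ultimately have "d ^ 3 / 2 * (\<gamma> * ?n * (\<gamma> * ?n) * (\<gamma> * ?n))
        \<le> (?d1 * ?d2 * ?d3 - 3 * \<epsilon>') * (real (card (?c x)) * real (card (?c y)) * real (card (?c z)))"
        using d \<gamma> by (intro mult_mono[OF ddd]) (auto intro!: order_trans[OF _ ddd] simp del: diff_ge_0_iff_ge)
      also have "\<dots> \<le> (\<Sum>a\<in>?c x. \<Sum>b\<in>?c y. \<Sum>c\<in>?c z. of_bool (R i a b \<and> R j b c \<and> R k a c))"
        using g1 g2 g3 \<epsilon>' by (intro triangle_counting finc) auto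
      also have "\<dots> = (\<Sum>t\<in>?c x \<times> ?c y \<times> ?c z. of_bool (t \<in> {(a, b, c). R i a b \<and> R j b c \<and> R k a c}))"
        by (simp add: sum.cartesian_product case_prod_beta)
      also have "\<dots> = real (card (?c x \<times> ?c y \<times> ?c z \<inter> {(a, b, c). R i a b \<and> R j b c \<and> R k a c}))"
        using finc by (subst sum_of_bool_eq) auto
      also have "\<dots> \<le> real (card ?T)"
      proof -
        have "?T \<subseteq> V \<times> V \<times> V" by auto
        then have "finite ?T" using fin by (meson finite_SigmaI finite_subset)
        moreover have "?c x \<times> ?c y \<times> ?c z \<inter> {(a, b, c). R i a b \<and> R j b c \<and> R k a c} \<subseteq> ?T"
          using cell_subset[of V \<S>] by blast
        ultimately show ?thesis by (simp add: card_mono)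
      qed
      finally show "\<delta> * ?n ^ 3 \<le> real (card ?T)"
        unfolding \<delta>_def by (simp add: power3_eq_cube mult_ac)
    qed
  qed
qed

subsection \<open>Cuts and rounding of fractional covers\<close>

text \<open>Conditional expectations: an edge contains a vertex at most once, so the sum is affine
  in each coordinate and does not increase when that coordinate moves to a suitable end of
  \<open>[-1, 1]\<close>.\<close>

lemma sign_rounding:
  fixes x :: "'a \<Rightarrow> real"
  assumes "finite U" "finite E" "\<And>e. e \<in> E \<Longrightarrow> finite e" "\<And>v. v \<in> U \<Longrightarrow> \<bar>x v\<bar> \<le> 1"
  shows "\<exists>\<sigma>. (\<forall>v\<in>U. \<sigma> v = 1 \<or> \<sigma> v = -1) \<and> (\<forall>v. v \<notin> U \<longrightarrow> \<sigma> v = x v) \<and>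
    (\<Sum>e\<in>E. \<Prod>v\<in>e. \<sigma> v) \<le> (\<Sum>e\<in>E. \<Prod>v\<in>e. x v)"
  using assms(1,4)
proof (induction U rule: finite_induct)
  case empty
  then show ?case by (intro exI[of _ x]) auto
next
  case (insert u U)
  then obtain \<sigma> where \<sigma>: "\<forall>v\<in>U. \<sigma> v = 1 \<or> \<sigma> v = -1" "\<forall>v. v \<notin> U \<longrightarrow> \<sigma> v = x v"
    "(\<Sum>e\<in>E. \<Prod>v\<in>e. \<sigma> v) \<le> (\<Sum>e\<in>E. \<Prod>v\<in>e. x v)" by auto
  define A where "A = (\<Sum>e\<in>E. if u \<in> e then 0 else \<Prod>v\<in>e. \<sigma> v)"
  define B where "B = (\<Sum>e\<in>E. if u \<in> e then \<Prod>v\<in>e - {u}. \<sigma> v else 0)"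
  have aff: "(\<Sum>e\<in>E. \<Prod>v\<in>e. (\<sigma>(u := t)) v) = A + t * B" for t
  proof -
    have "(\<Prod>v\<in>e. (\<sigma>(u := t)) v)
        = (if u \<in> e then 0 else \<Prod>v\<in>e. \<sigma> v) + t * (if u \<in> e then \<Prod>v\<in>e - {u}. \<sigma> v else 0)"
      if "e \<in> E" for e
    proof (cases "u \<in> e")
      case True
      have "(\<Prod>v\<in>e. (\<sigma>(u := t)) v) = t * (\<Prod>v\<in>e - {u}. (\<sigma>(u := t)) v)"
        using prod.remove[OF assms(3)[OF that] True, of "\<sigma>(u := t)"] by simp
      also have "(\<Prod>v\<in>e - {u}. (\<sigma>(u := t)) v) = (\<Prod>v\<in>e - {u}. \<sigma> v)"
        by (intro prod.cong) auto
      finally show ?thesis using True by simp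
    next
      case False
      then have "(\<Prod>v\<in>e. (\<sigma>(u := t)) v) = (\<Prod>v\<in>e. \<sigma> v)" by (intro prod.cong) auto
      then show ?thesis using False by simp
    qed
    then show ?thesis unfolding A_def B_def by (simp add: sum.distrib sum_distrib_left)
  qed
  define t :: real where "t = (if B \<ge> 0 then -1 else 1)"
  have "t * B \<le> x u * B"
  proof (cases "B \<ge> 0")
    case True
    then show ?thesis unfolding t_def using insert.prems[of u] mult_right_mono[of "-1" "x u" B] by auto
  next
    case False
    then show ?thesis unfolding t_def using insert.prems[of u] mult_right_mono_neg[of "x u" 1 B] by auto
  qed
  moreover have "\<sigma>(u := x u) = \<sigma>" using \<sigma>(2) insert.hyps by auto
  ultimately have "(\<Sum>e\<in>E. \<Prod>v\<in>e. (\<sigma>(u := t)) v) \<le> (\<Sum>e\<in>E. \<Prod>v\<in>e. \<sigma> v)"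
    using aff[of t] aff[of "x u"] by simp
  then have "(\<Sum>e\<in>E. \<Prod>v\<in>e. (\<sigma>(u := t)) v) \<le> (\<Sum>e\<in>E. \<Prod>v\<in>e. x v)" using \<sigma>(3) by linarith
  then show ?case
    using \<sigma>(1,2) by (intro exI[of _ "\<sigma>(u := t)"]) (auto simp: t_def)
qed

lemma nsets_triple:
  assumes "x \<noteq> y" "y \<noteq> z" "x \<noteq> z"
  shows "nsets {x, y, z} 2 = {{x, y}, {y, z}, {x, z}}"
proof
  show "{{x, y}, {y, z}, {x, z}} \<subseteq> nsets {x, y, z} 2" using assms by (auto simp: nsets_def)
  show "nsets {x, y, z} 2 \<subseteq> {{x, y}, {y, z}, {x, z}}" unfolding nsets_2_eq by auto
qed

lemma nsets_3_cases:
  assumes "T \<in> nsets V 3"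
  obtains x y z where "x \<in> V" "y \<in> V" "z \<in> V" "x \<noteq> y" "y \<noteq> z" "x \<noteq> z" "T = {x, y, z}"
    "nsets T 2 = {{x, y}, {y, z}, {x, z}}"
proof -
  obtain x y z where T: "T = {x, y, z}" "x \<noteq> y" "x \<noteq> z" "y \<noteq> z"
    using assms unfolding nsets_def card_3_iff by auto
  moreover have "nsets T 2 = {{x, y}, {y, z}, {x, z}}"
    unfolding T(1) by (rule nsets_triple[OF T(2,4,3)])
  ultimately show thesis using assms that unfolding nsets_def by auto
qed

lemma triangle_monochromatic_edge:
  fixes \<sigma> :: "'a \<Rightarrow> real"
  assumes "T \<in> nsets V 3" "\<forall>v\<in>V. \<sigma> v = 1 \<or> \<sigma> v = -1"
  shows "\<exists>e\<in>nsets T 2. (\<Prod>v\<in>e. \<sigma> v) = 1"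
proof -
  obtain x y z where T: "x \<in> V" "y \<in> V" "z \<in> V" "x \<noteq> y" "y \<noteq> z" "x \<noteq> z"
    "nsets T 2 = {{x, y}, {y, z}, {x, z}}"
    by (rule nsets_3_cases[OF assms(1)])
  have mono: "(\<Prod>v\<in>{a, b}. \<sigma> v) = 1" if "a \<noteq> b" "b \<in> V" "\<sigma> a = \<sigma> b" for a b
  proof -
    have "\<sigma> b = 1 \<or> \<sigma> b = -1" using assms(2) that(2) by blast
    then show ?thesis using that(1,3) by auto
  qed
  consider "\<sigma> x = \<sigma> y" | "\<sigma> y = \<sigma> z" | "\<sigma> x = \<sigma> z" using assms(2) T by metis
  then show ?thesis
    unfolding T(7) using mono T(1-6) by cases blast+
qed

lemma sign_sum_eq:
  fixes \<sigma> :: "'a \<Rightarrow> real"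
  assumes "finite P" "P \<subseteq> nsets V 2" "\<forall>v\<in>V. \<sigma> v = 1 \<or> \<sigma> v = -1"
  shows "(\<Sum>e\<in>P. \<Prod>v\<in>e. \<sigma> v) = 2 * real (card {e \<in> P. (\<Prod>v\<in>e. \<sigma> v) = 1}) - real (card P)"
proof -
  have "(\<Prod>v\<in>e. \<sigma> v) = 2 * of_bool ((\<Prod>v\<in>e. \<sigma> v) = 1) - 1" if "e \<in> P" for e
  proof -
    have "e \<in> nsets V 2" using that assms(2) by auto
    then obtain x y where "e = {x, y}" "x \<noteq> y" "x \<in> V" "y \<in> V"
      unfolding nsets_2_eq by auto
    moreover from this have "\<sigma> x = 1 \<or> \<sigma> x = -1" "\<sigma> y = 1 \<or> \<sigma> y = -1" using assms(3) by blast+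
    ultimately show ?thesis by auto
  qed
  then have "(\<Sum>e\<in>P. \<Prod>v\<in>e. \<sigma> v) = (\<Sum>e\<in>P. 2 * of_bool ((\<Prod>v\<in>e. \<sigma> v) = 1) - 1)"
    by (intro sum.cong) auto
  also have "\<dots> = 2 * real (card (P \<inter> {e. (\<Prod>v\<in>e. \<sigma> v) = 1})) - real (card P)"
    using assms(1) by (simp add: sum_subtractf sum_distrib_left[symmetric])
  also have "P \<inter> {e. (\<Prod>v\<in>e. \<sigma> v) = 1} = {e \<in> P. (\<Prod>v\<in>e. \<sigma> v) = 1}" by auto
  finally show ?thesis .
qed

section \<open>Triangle covers from sign vectors and thresholds\<close>

context simple_graph
begin

lemma finite_edge: "e \<in> E \<Longrightarrow> finite e"
  using edges by (auto simp: nsets_def)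

text \<open>Read \<open>x v\<close> as the mean of a random sign. For actual signs, the edges with
  equal signs at both ends cover every triangle, and the sum is twice their number minus
  \<open>card E\<close>; rounding to signs can only lower the sum.\<close>

lemma sum_prod_ge_tau:
  fixes x :: "'a \<Rightarrow> real"
  assumes "\<And>v. v \<in> V \<Longrightarrow> \<bar>x v\<bar> \<le> 1"
  shows "2 * real (tau_t V E) - real (card E) \<le> (\<Sum>e\<in>E. \<Prod>v\<in>e. x v)"
proof -
  have "\<exists>\<sigma>. (\<forall>v\<in>V. \<sigma> v = 1 \<or> \<sigma> v = -1) \<and> (\<forall>v. v \<notin> V \<longrightarrow> \<sigma> v = x v) \<and>
    (\<Sum>e\<in>E. \<Prod>v\<in>e. \<sigma> v) \<le> (\<Sum>e\<in>E. \<Prod>v\<in>e. x v)"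
    by (rule sign_rounding[OF finite_V finite_E]) (use finite_edge assms in auto)
  then obtain \<sigma> where \<sigma>: "\<forall>v\<in>V. \<sigma> v = 1 \<or> \<sigma> v = -1"
    "(\<Sum>e\<in>E. \<Prod>v\<in>e. \<sigma> v) \<le> (\<Sum>e\<in>E. \<Prod>v\<in>e. x v)"
    by auto
  let ?C = "{e \<in> E. (\<Prod>v\<in>e. \<sigma> v) = 1}"
  have "triangle_cover V E ?C"
    unfolding triangle_cover_def
  proof (intro conjI ballI)
    fix T assume "T \<in> triangles V E"
    then have T: "T \<in> nsets V 3" "nsets T 2 \<subseteq> E" by (auto simp: triangles_def)
    show "?C \<inter> nsets T 2 \<noteq> {}" using triangle_monochromatic_edge[OF T(1) \<sigma>(1)] T(2) by blast
  qed auto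
  then have "tau_t V E \<le> card ?C" by (rule tau_t_le)
  then show ?thesis using sign_sum_eq[OF finite_E edges \<sigma>(1)] \<sigma>(2) by linarith
qed

text \<open>Rounding the zero vector gives a bipartition with at least half of \<open>P\<close>
  across; the edges within its classes serve as \<open>Q\<close>.\<close>

lemma half_cover:
  assumes "P \<subseteq> E"
  shows "\<exists>Q\<subseteq>P. 2 * card Q \<le> card P \<and> (\<forall>T\<in>nsets V 3. nsets T 2 \<subseteq> P \<longrightarrow> Q \<inter> nsets T 2 \<noteq> {})"
proof -
  have P: "finite P" "P \<subseteq> nsets V 2" using assms finite_E edges finite_subset by blast+
  obtain \<sigma> :: "'a \<Rightarrow> real" where \<sigma>: "\<forall>v\<in>V. \<sigma> v = 1 \<or> \<sigma> v = -1"
    "(\<Sum>e\<in>P. \<Prod>v\<in>e. \<sigma> v) \<le> (\<Sum>e\<in>P. \<Prod>v\<in>e. 0)"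
    using sign_rounding[OF finite_V P(1), of "\<lambda>_. 0"] finite_edge assms by auto
  have "(\<Sum>e\<in>P. \<Prod>v\<in>e. 0 :: real) = 0"
    using P(2) by (intro sum.neutral) (auto simp: nsets_def)
  then have "real (2 * card {e \<in> P. (\<Prod>v\<in>e. \<sigma> v) = 1}) \<le> real (card P)"
    using sign_sum_eq[OF P \<sigma>(1)] \<sigma>(2) by simp
  then have "2 * card {e \<in> P. (\<Prod>v\<in>e. \<sigma> v) = 1} \<le> card P" by (simp only: of_nat_le_iff)
  then show ?thesis
    using triangle_monochromatic_edge[OF _ \<sigma>(1)]
    by (intro exI[of _ "{e \<in> P. (\<Prod>v\<in>e. \<sigma> v) = 1}"]) blast
qed

text \<open>A triangle avoiding the full edges \<open>3 * J - j \<le> 2 * g e\<close> has all three values above \<open>j\<close>,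
  so it suffices to take, in addition, the edges inside the two classes of a good bipartition.
  Averaging over \<open>j\<close> costs at most \<open>2 * g e / (3 * J)\<close> per edge, with a definite saving
  unless \<open>g e / (3 * J)\<close> is near \<open>0\<close> or \<open>1 / 2\<close>.\<close>

lemma threshold_cover:
  fixes g :: "'a set \<Rightarrow> nat"
  assumes D: "D \<subseteq> E" and j: "j < J"
    and g: "\<And>T. T \<in> triangles V E \<Longrightarrow> D \<inter> nsets T 2 = {} \<Longrightarrow> 3 * J \<le> (\<Sum>e\<in>nsets T 2. g e)"
  shows "2 * tau_t V E \<le> 2 * card D + 2 * card {e \<in> E. 3 * J - j \<le> 2 * g e}
    + card {e \<in> E. j < g e \<and> 2 * g e < 3 * J - j}"
proof -
  let ?F = "{e \<in> E. 3 * J - j \<le> 2 * g e}"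
  let ?P = "{e \<in> E. j < g e \<and> 2 * g e < 3 * J - j}"
  obtain Q where Q: "Q \<subseteq> ?P" "2 * card Q \<le> card ?P"
    "\<And>T. T \<in> nsets V 3 \<Longrightarrow> nsets T 2 \<subseteq> ?P \<Longrightarrow> Q \<inter> nsets T 2 \<noteq> {}"
    using half_cover[of ?P] by auto
  have "triangle_cover V E (D \<union> ?F \<union> Q)"
    unfolding triangle_cover_def
  proof (intro conjI ballI)
    show "D \<union> ?F \<union> Q \<subseteq> E" using D Q(1) by auto
    fix T assume T: "T \<in> triangles V E"
    then have T3: "T \<in> nsets V 3" "nsets T 2 \<subseteq> E" by (auto simp: triangles_def)
    show "(D \<union> ?F \<union> Q) \<inter> nsets T 2 \<noteq> {}"
    proof
      assume none: "(D \<union> ?F \<union> Q) \<inter> nsets T 2 = {}"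
      then have s: "3 * J \<le> (\<Sum>e\<in>nsets T 2. g e)" using g[OF T] by blast
      have lt: "2 * g e < 3 * J - j" if "e \<in> nsets T 2" for e
        using none that T3(2) by (auto simp: disjoint_iff)
      obtain x y z where xyz: "x \<noteq> y" "y \<noteq> z" "x \<noteq> z" "nsets T 2 = {{x, y}, {y, z}, {x, z}}"
        by (rule nsets_3_cases[OF T3(1)])
      have d: "{x, y} \<noteq> {y, z}" "{x, y} \<noteq> {x, z}" "{y, z} \<noteq> {x, z}" using xyz by (auto simp: doubleton_eq_iff)
      have s': "3 * J \<le> g {x, y} + g {y, z} + g {x, z}" using s d unfolding xyz(4) by simp
      have "2 * g {x, y} < 3 * J - j" "2 * g {y, z} < 3 * J - j" "2 * g {x, z} < 3 * J - j"
        using lt unfolding xyz(4) by auto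
      then have "j < g {x, y}" "j < g {y, z}" "j < g {x, z}" using s' by linarith+
      then have "nsets T 2 \<subseteq> ?P" using T3(2) lt unfolding xyz(4) by auto
      then show False using Q(3)[OF T3(1)] none by blast
    qed
  qed
  then have "tau_t V E \<le> card (D \<union> ?F \<union> Q)" by (rule tau_t_le)
  also have "\<dots> \<le> card D + card ?F + card Q"
    by (meson add_le_mono card_Un_le le_refl le_trans)
  finally show ?thesis using Q(2) by linarith
qed

lemma rounding_deficit:
  fixes g :: "'a set \<Rightarrow> nat"
  assumes D: "D \<subseteq> E"
    and g: "\<And>T. T \<in> triangles V E \<Longrightarrow> D \<inter> nsets T 2 = {} \<Longrightarrow> 3 * J \<le> (\<Sum>e\<in>nsets T 2. g e)"
  shows "12 * J * tau_t V E + 4 * J * card {e \<in> E. 2 * J \<le> g e} + J * card {e \<in> E. J \<le> 2 * g e \<and> 5 * g e < 6 * J}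
    \<le> 12 * J * card D + 8 * (\<Sum>e\<in>E. g e)"
proof -
  have card_edges: "card {e \<in> E. Q e} = (\<Sum>e\<in>E. of_bool (Q e))" for Q
    using finite_E by (simp add: Int_def)
  \<comment> \<open>This is the contribution of an edge of value \<open>k\<close> to the bounds on
    \<open>2 * tau_t V E\<close>, summed over all thresholds: 2 when it is taken outright, 1 when it
    goes to the bipartition.\<close>
  define cst where "cst = (\<lambda>k. \<Sum>j<J. 2 * of_bool (3 * J - j \<le> 2 * k) + of_bool (j < k \<and> 2 * k < 3 * J - j) :: nat)"
  have cst_le: "cst k \<le> min k J + (J - (3 * J - 2 * k))" for k
  proof -
    have "cst k \<le> (\<Sum>j<J. of_bool (j < k) + of_bool (3 * J - 2 * k \<le> j))"
      unfolding cst_def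
    proof (rule sum_mono)
      fix j assume "j \<in> {..<J}"
      then show "2 * of_bool (3 * J - j \<le> 2 * k) + of_bool (j < k \<and> 2 * k < 3 * J - j)
        \<le> (of_bool (j < k) + of_bool (3 * J - 2 * k \<le> j) :: nat)"
        by (cases "3 * J - j \<le> 2 * k"; cases "j < k") auto
    qed
    also have "\<dots> = card ({..<J} \<inter> {j. j < k}) + card ({..<J} \<inter> {j. 3 * J - 2 * k \<le> j})"
      by (simp add: sum.distrib)
    also have "{..<J} \<inter> {j. j < k} = {..<min k J}" by auto
    also have "{..<J} \<inter> {j. 3 * J - 2 * k \<le> j} = {3 * J - 2 * k..<J}" by auto
    finally show ?thesis by simp
  qed
  \<comment> \<open>The bound on \<open>cst k\<close> is \<open>k\<close> up to \<open>J\<close>,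
    then \<open>2 * k - J\<close> up to \<open>3 * J / 2\<close>, then \<open>2 * J\<close>. It
    touches \<open>4 * k / 3\<close> only at 0 and \<open>3 * J / 2\<close>; the two extra terms fit
    into the slack between \<open>J / 2\<close> and \<open>6 * J / 5\<close> and from
    \<open>2 * J\<close> on.\<close>
  have gain: "6 * cst k + 4 * J * of_bool (2 * J \<le> k) + J * of_bool (J \<le> 2 * k \<and> 5 * k < 6 * J) \<le> 8 * k" for k
    using cst_le[of k] by (auto simp: min_def split: if_splits)
  have "J * (2 * tau_t V E) = (\<Sum>j<J. 2 * tau_t V E)" by simp
  also have "\<dots> \<le> (\<Sum>j<J. 2 * card D + 2 * card {e \<in> E. 3 * J - j \<le> 2 * g e}
    + card {e \<in> E. j < g e \<and> 2 * g e < 3 * J - j})"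
    by (intro sum_mono threshold_cover[OF D _ g]) auto
  also have "\<dots> = 2 * J * card D + (\<Sum>j<J. \<Sum>e\<in>E. 2 * of_bool (3 * J - j \<le> 2 * g e) + of_bool (j < g e \<and> 2 * g e < 3 * J - j))"
    unfolding card_edges[of "\<lambda>e. 3 * J - _ \<le> 2 * g e"] card_edges[of "\<lambda>e. _ < g e \<and> 2 * g e < 3 * J - _"]
    by (simp only: sum.distrib sum_distrib_left[symmetric]) simp
  also have "(\<Sum>j<J. \<Sum>e\<in>E. 2 * of_bool (3 * J - j \<le> 2 * g e) + of_bool (j < g e \<and> 2 * g e < 3 * J - j))
      = (\<Sum>e\<in>E. cst (g e))"
    unfolding cst_def by (rule sum.swap)
  finally have 1: "2 * J * tau_t V E \<le> 2 * J * card D + (\<Sum>e\<in>E. cst (g e))" by (simp add: mult_ac)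
  have "(\<Sum>e\<in>E. 6 * cst (g e) + 4 * J * of_bool (2 * J \<le> g e) + J * of_bool (J \<le> 2 * g e \<and> 5 * g e < 6 * J))
      \<le> (\<Sum>e\<in>E. 8 * g e)"
    by (intro sum_mono gain)
  moreover have "(\<Sum>e\<in>E. 6 * cst (g e) + 4 * J * of_bool (2 * J \<le> g e) + J * of_bool (J \<le> 2 * g e \<and> 5 * g e < 6 * J))
     = 6 * (\<Sum>e\<in>E. cst (g e)) + 4 * J * card {e \<in> E. 2 * J \<le> g e} + J * card {e \<in> E. J \<le> 2 * g e \<and> 5 * g e < 6 * J}"
    unfolding card_edges[of "\<lambda>e. 2 * J \<le> g e"] card_edges[of "\<lambda>e. J \<le> 2 * g e \<and> 5 * g e < 6 * J"]
    by (simp only: sum.distrib sum_distrib_left[symmetric])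
  moreover have "(\<Sum>e\<in>E. 8 * g e) = 8 * (\<Sum>e\<in>E. g e)" by (simp add: sum_distrib_left)
  ultimately show ?thesis using 1 by (simp add: algebra_simps)
qed

end

section \<open>Neighbourhoods of large degree sum and the cuts they produce\<close>

definition nbrs :: "'a set \<Rightarrow> 'a set set \<Rightarrow> 'a \<Rightarrow> 'a set" where
  "nbrs V B v = {u \<in> V. {u, v} \<in> B}"

lemma card_incident:
  assumes "B \<subseteq> nsets V 2"
  shows "card {e \<in> B. u \<in> e} = card (nbrs V B u)"
proof (rule bij_betw_same_card[symmetric], rule bij_betwI')
  fix x y assume "x \<in> nbrs V B u" "y \<in> nbrs V B u"
  then show "({x, u} = {y, u}) = (x = y)" by (auto simp: doubleton_eq_iff)
next
  fix x assume "x \<in> nbrs V B u"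
  then show "{x, u} \<in> {e \<in> B. u \<in> e}" by (auto simp: nbrs_def)
next
  fix e assume e: "e \<in> {e \<in> B. u \<in> e}"
  then have "e \<in> nsets V 2" using assms by auto
  then obtain x y where "e = {x, y}" "x \<in> V" "y \<in> V" unfolding nsets_2_eq by auto
  then show "\<exists>x\<in>nbrs V B u. e = {x, u}" using e unfolding nbrs_def by (auto simp: insert_commute)
qed

lemma sum_card_inter:
  assumes "finite B" "finite I"
  shows "(\<Sum>e\<in>B. card (e \<inter> I)) = (\<Sum>u\<in>I. card {e \<in> B. u \<in> e})"
proof -
  have "(\<Sum>e\<in>B. card (e \<inter> I)) = (\<Sum>e\<in>B. \<Sum>u\<in>I. of_bool (u \<in> e))"
    using assms by (simp add: Int_commute)
  also have "\<dots> = (\<Sum>u\<in>I. \<Sum>e\<in>B. of_bool (u \<in> e))" by (rule sum.swap)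
  also have "\<dots> = (\<Sum>u\<in>I. card {e \<in> B. u \<in> e})" using assms by (simp add: Int_def)
  finally show ?thesis .
qed

text \<open>Summed over \<open>v\<close>, the degree sums of the neighbourhoods give the sum of
  squared degrees, at least \<open>4 * (card B)\<^sup>2 / card V\<close> by Cauchy-Schwarz. A
  maximal \<open>v\<close> reaches the average.\<close>

lemma ex_neighbourhood_large_degree_sum:
  assumes fin: "finite V" "V \<noteq> {}" and B: "B \<subseteq> nsets V 2"
  shows "\<exists>v\<in>V. 4 * (real (card B))\<^sup>2 \<le> (real (card V))\<^sup>2 * real (\<Sum>e\<in>B. card (e \<inter> nbrs V B v))"
proof -
  have finB: "finite B" using B fin finite_subset finite_imp_finite_nsets by blast
  let ?N = "nbrs V B"
  let ?S = "\<lambda>v. real (\<Sum>e\<in>B. card (e \<inter> ?N v))"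
  have finN: "finite (?N v)" for v using fin by (simp add: nbrs_def)
  have sym: "u \<in> ?N v \<longleftrightarrow> v \<in> ?N u" if "u \<in> V" "v \<in> V" for u v
    using that by (simp add: nbrs_def insert_commute)
  have "(\<Sum>u\<in>V. card (?N u)) = (\<Sum>u\<in>V. card {e \<in> B. u \<in> e})" by (simp add: card_incident[OF B])
  also have "\<dots> = (\<Sum>e\<in>B. card (e \<inter> V))" by (rule sum_card_inter[OF finB fin(1), symmetric])
  also have "\<dots> = (\<Sum>e\<in>B. 2)" using B by (intro sum.cong refl) (auto simp: nsets_def Int_absorb2)
  finally have hand: "(\<Sum>u\<in>V. card (?N u)) = 2 * card B" by simp
  have "4 * (real (card B))\<^sup>2 = (\<Sum>u\<in>V. real (card (?N u)))\<^sup>2"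
    using arg_cong[OF hand, of real] by (simp add: power_mult_distrib)
  also have "\<dots> \<le> (\<Sum>u\<in>V. (real (card (?N u)))\<^sup>2) * card V"
    by (rule sum_squared_le_sum_of_squares)
  also have "(\<Sum>u\<in>V. (real (card (?N u)))\<^sup>2) = (\<Sum>v\<in>V. ?S v)"
  proof -
    have "(\<Sum>v\<in>V. ?S v) = (\<Sum>v\<in>V. \<Sum>u\<in>?N v. real (card (?N u)))"
      by (simp add: sum_card_inter[OF finB finN] card_incident[OF B])
    also have "\<dots> = (\<Sum>v\<in>V. \<Sum>u\<in>V. if u \<in> ?N v then real (card (?N u)) else 0)"
      using fin by (intro sum.cong refl sum.mono_neutral_cong_left) (auto simp: nbrs_def)
    also have "\<dots> = (\<Sum>u\<in>V. \<Sum>v\<in>V. if v \<in> ?N u then real (card (?N u)) else 0)"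
      by (subst sum.swap) (use sym in \<open>auto intro!: sum.cong\<close>)
    also have "\<dots> = (\<Sum>u\<in>V. \<Sum>v\<in>?N u. real (card (?N u)))"
      using fin by (intro sum.cong refl sum.mono_neutral_cong_right) (auto simp: nbrs_def)
    finally show ?thesis by (simp add: power2_eq_square)
  qed
  finally have main: "4 * (real (card B))\<^sup>2 \<le> (\<Sum>v\<in>V. ?S v) * card V" .
  have "Max (?S ` V) \<in> ?S ` V" using fin by (intro Max_in) auto
  then obtain v where v: "v \<in> V" "?S v = Max (?S ` V)" by (metis (no_types, lifting) imageE)
  have "(\<Sum>u\<in>V. ?S u) \<le> (\<Sum>u\<in>V. ?S v)"
    unfolding v(2) using fin by (intro sum_mono Max_ge) auto
  also have "\<dots> = card V * ?S v" by simp
  finally have "(\<Sum>u\<in>V. ?S u) * card V \<le> card V * ?S v * card V" by (intro mult_right_mono) auto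
  then show ?thesis using main v(1) by (intro bexI[of _ v]) (auto simp: power2_eq_square mult_ac)
qed

context simple_graph
begin

lemma card_E_le: "real (card E) \<le> (real (card V))\<^sup>2 / 2"
proof -
  have "card E \<le> card V choose 2"
    using card_mono[OF _ edges] finite_V by (simp add: finite_imp_finite_nsets card_nsets)
  then have "2 * card E \<le> card V * (card V - 1)" by (simp add: choose_two)
  also have "\<dots> \<le> card V * card V" by simp
  finally have "real (2 * card E) \<le> real (card V * card V)" by (simp only: of_nat_le_iff)
  then show ?thesis by (simp add: power2_eq_square)
qed

text \<open>Apply \<open>sum_prod_ge_tau\<close> with value 1 on \<open>I\<close> and
  \<open>- p\<close> elsewhere. An edge contributes 1 inside \<open>I\<close>, \<open>- p\<close>
  across and \<open>p\<^sup>2\<close> outside, which is at most the expression summed; a nearly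
  independent \<open>I\<close> of large degree sum would make the total too small.\<close>

lemma degree_sum_le:
  fixes p :: real
  assumes I: "I \<subseteq> V" and p: "0 \<le> p" "p \<le> 1"
  shows "p * real (\<Sum>e\<in>E. card (e \<inter> I)) + (2 * real (tau_t V E) - real (card E))
    \<le> (1 + 2 * p) * real (card {e \<in> E. e \<subseteq> I}) + p\<^sup>2 * card E"
proof -
  define x :: "'a \<Rightarrow> real" where "x = (\<lambda>v. if v \<in> I then 1 else - p)"
  have "2 * real (tau_t V E) - real (card E) \<le> (\<Sum>e\<in>E. \<Prod>v\<in>e. x v)"
    by (rule sum_prod_ge_tau) (use p in \<open>auto simp: x_def\<close>)
  also have "\<dots> \<le> (\<Sum>e\<in>E. (1 + 2 * p) * of_bool (e \<subseteq> I) - p * real (card (e \<inter> I)) + p\<^sup>2)"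
  proof (rule sum_mono)
    fix e assume "e \<in> E"
    then have "e \<in> nsets V 2" using edges by auto
    then obtain a b where e: "e = {a, b}" "a \<noteq> b" unfolding nsets_2_eq by auto
    show "(\<Prod>v\<in>e. x v) \<le> (1 + 2 * p) * of_bool (e \<subseteq> I) - p * real (card (e \<inter> I)) + p\<^sup>2"
      using e p by (cases "a \<in> I"; cases "b \<in> I") (auto simp: x_def Int_insert_left power2_eq_square)
  qed
  also have "\<dots> = (1 + 2 * p) * real (card {e \<in> E. e \<subseteq> I}) - p * real (\<Sum>e\<in>E. card (e \<inter> I)) + p\<^sup>2 * card E"
    using finite_E by (simp add: sum.distrib sum_subtractf sum_distrib_left[symmetric] Int_def mult.commute)
  finally show ?thesis by linarith
qed

text \<open>By the deficit in the rounding, almost all edges have \<open>g e / (3 * J)\<close> near \<open>0\<close> or \<open>1 / 2\<close>, so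
  many edges are cheap. Two cheap edges in a triangle force the third to be one of
  the few with \<open>2 * J \<le> g e\<close>; hence the neighbourhood of a vertex through cheap edges is almost
  independent although many edges leave it, which yields a bipartition with too many edges across.\<close>

lemma no_cheap_almost_cover:
  fixes \<beta> \<delta> :: real and g :: "'a set \<Rightarrow> nat" and J :: nat
  assumes V: "V \<noteq> {}" and \<beta>: "0 < \<beta>" and m: "\<beta> * (real (card V))\<^sup>2 \<le> card E"
    and \<tau>: "(1 - \<delta>) * (real (card E) / 2) \<le> tau_t V E" and \<delta>: "\<delta> \<le> \<beta>\<^sup>2 / 10000"
    and D: "D \<subseteq> E" "real (card D) \<le> \<beta>\<^sup>2 / 20000 * card E"
    and J: "14000 / \<beta>\<^sup>2 \<le> J"
    and cover: "\<And>T. T \<in> triangles V E \<Longrightarrow> D \<inter> nsets T 2 = {} \<Longrightarrow> 3 * J \<le> (\<Sum>e\<in>nsets T 2. g e)"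
    and cost: "real (\<Sum>e\<in>E. g e) \<le> 3 * J * ((1 + \<beta>\<^sup>2 / 400) * card E / 4) + card E"
  shows False
proof -
  let ?m = "real (card E)" and ?n = "real (card V)"
  have n: "0 < ?n" using V finite_V by (simp add: card_gt_0_iff)
  have m0: "0 < ?m" using m \<beta> n by (smt (verit) mult_pos_pos zero_less_power)
  have \<beta>2: "\<beta> \<le> 1 / 2"
  proof -
    have "\<beta> * ?n\<^sup>2 \<le> 1 / 2 * ?n\<^sup>2" using m card_E_le by simp
    then show ?thesis using n by (simp add: mult_le_cancel_right)
  qed
  have b2: "0 < \<beta>\<^sup>2" "\<beta>\<^sup>2 \<le> 1 / 4"
    using \<beta> \<beta>2 power_mono[of \<beta> "1/2" 2] by (auto simp: power2_eq_square)
  define bm where "bm = \<beta>\<^sup>2 * ?m"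
  have bm: "0 < bm" "bm \<le> ?m / 4" unfolding bm_def using b2 m0 mult_right_mono[of "\<beta>\<^sup>2" "1/4" ?m] by auto
  have J0: "0 < real J" using J b2 by (smt (verit) divide_pos_pos)
  have mJ: "14000 * ?m \<le> J * bm"
  proof -
    have "14000 \<le> J * \<beta>\<^sup>2" using J b2 by (simp add: field_simps)
    then have "14000 * ?m \<le> J * \<beta>\<^sup>2 * ?m" using m0 by (intro mult_right_mono) auto
    then show ?thesis unfolding bm_def by (simp add: mult_ac)
  qed
  have "(1 + \<beta>\<^sup>2 / 400) * ?m = ?m + bm / 400" unfolding bm_def by (simp add: algebra_simps)
  then have cost': "real (\<Sum>e\<in>E. g e) \<le> 3 * J * ((?m + bm / 400) / 4) + ?m" using cost by simp
  \<comment> \<open>In units of \<open>3 * J\<close> the cuts are at \<open>1 / 6\<close>,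
    \<open>2 / 5\<close> and \<open>2 / 3\<close>. The sets \<open>lo\<close>, \<open>mid\<close>
    and \<open>hi\<close> exhaust \<open>E\<close>; \<open>mid\<close> and \<open>big\<close> are
    the two sets penalized by \<open>rounding_deficit\<close>.\<close>
  define big where "big = {e \<in> E. 2 * J \<le> g e}"
  define mid where "mid = {e \<in> E. J \<le> 2 * g e \<and> 5 * g e < 6 * J}"
  define hi where "hi = {e \<in> E. 6 * J \<le> 5 * g e}"
  define lo where "lo = {e \<in> E. 2 * g e < J}"
  have \<tau>': "?m - \<beta>\<^sup>2 / 10000 * ?m \<le> 2 * real (tau_t V E)"
  proof -
    have "\<delta> * ?m \<le> \<beta>\<^sup>2 / 10000 * ?m" using \<delta> m0 by (intro mult_right_mono) auto
    then show ?thesis using \<tau> by (simp add: algebra_simps)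
  qed
  have "real (12 * J * tau_t V E + 4 * J * card big + J * card mid) \<le> real (12 * J * card D + 8 * (\<Sum>e\<in>E. g e))"
    using rounding_deficit[OF D(1) cover] unfolding big_def mid_def by (simp only: of_nat_le_iff)
  then have "12 * J * real (tau_t V E) + 4 * J * real (card big) + J * real (card mid)
     \<le> 12 * J * real (card D) + 8 * real (\<Sum>e\<in>E. g e)" by simp
  also have "\<dots> \<le> 12 * J * (bm / 20000) + 8 * (3 * J * ((?m + bm / 400) / 4) + ?m)"
    using D(2) cost' J0 unfolding bm_def by (intro add_mono mult_left_mono) auto
  finally have "12 * J * real (tau_t V E) + 4 * J * real (card big) + J * real (card mid)
     \<le> 12 * J * (bm / 20000) + 8 * (3 * J * ((?m + bm / 400) / 4) + ?m)" .
  moreover have "6 * J * (?m - bm / 10000) \<le> 6 * J * (2 * real (tau_t V E))"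
    using \<tau>' J0 unfolding bm_def by (intro mult_left_mono) auto
  \<comment> \<open>The products are named so that the remaining inequality is linear. Its
    right-hand side collects the excess cost (150), \<open>D\<close> (6), the deficit in
    \<open>\<tau>\<close> (6) and the rounding error (below 6), in units of
    \<open>bm / 10000\<close>; hence 168.\<close>
  moreover define t1 t2 t3 where "t1 = J * ?m" and "t2 = J * bm" and "t3 = J * real (tau_t V E)"
  moreover define t4 t5 t6 where "t4 = J * real (card big)" and "t5 = J * real (card mid)" and "t6 = ?m"
  ultimately have "12 * t3 + 4 * t4 + t5 \<le> 12 * (t2 / 20000) + (6 * (t1 + t2 / 400) + 8 * t6)"
      "6 * (t1 - t2 / 10000) \<le> 12 * t3" "14000 * t6 \<le> t2"
    using mJ by (simp_all add: algebra_simps add_divide_distrib)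
  moreover have "0 < t2" unfolding t2_def using J0 bm by simp
  ultimately have "4 * t4 + t5 \<le> t2 * (168 / 10000)" by argo
  then have "J * (4 * real (card big) + real (card mid)) \<le> J * (bm * (168 / 10000))"
    unfolding t4_def t5_def t2_def by (simp add: algebra_simps)
  then have deficit: "4 * real (card big) + real (card mid) \<le> bm * (168 / 10000)"
    using J0 by (simp only: mult_le_cancel_left_pos)
  have fins: "finite big" "finite mid" "finite hi" "finite lo" "finite D"
    unfolding big_def mid_def hi_def lo_def using finite_E D finite_subset by auto
  \<comment> \<open>Markov: the total value is about \<open>3 * J * ?m / 4\<close> and each edge of
    \<open>hi\<close> takes at least \<open>6 * J / 5\<close>, so \<open>hi\<close> has at most
    about \<open>5 / 8\<close> of the edges. This leaves more than a quarter for \<open>lo\<close>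
    after the small losses.\<close>
  have "J * (6 * real (card hi)) = (\<Sum>e\<in>hi. real (6 * J))" by simp
  also have "\<dots> \<le> (\<Sum>e\<in>hi. real (5 * g e))"
    unfolding hi_def by (intro sum_mono) (simp only: mem_Collect_eq of_nat_le_iff)
  also have "\<dots> \<le> (\<Sum>e\<in>E. real (5 * g e))"
    using finite_E unfolding hi_def by (intro sum_mono2) auto
  also have "\<dots> = 5 * real (\<Sum>e\<in>E. g e)" by (simp add: sum_distrib_left)
  also have "\<dots> \<le> 5 * (3 * J * ((?m + bm / 400) / 4) + ?m)"
    using cost' by (intro mult_left_mono) auto
  also have "\<dots> = J * (15 / 4 * (?m + bm / 400)) + 5 * ?m" by (simp add: field_simps)
  also have "\<dots> \<le> J * (15 / 4 * (?m + bm / 400)) + J * (bm / 2800)" using mJ by simp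
  also have "\<dots> = J * (15 / 4 * (?m + bm / 400) + bm / 2800)" by (simp only: distrib_left)
  finally have hi: "6 * real (card hi) \<le> 15 / 4 * (?m + bm / 400) + bm / 2800"
    using J0 by (simp only: mult_le_cancel_left_pos)
  have "E \<subseteq> lo \<union> mid \<union> hi" unfolding lo_def mid_def hi_def by auto
  then have "card E \<le> card (lo \<union> mid \<union> hi)" using fins by (intro card_mono) auto
  also have "\<dots> \<le> card lo + card mid + card hi" by (meson add_le_mono card_Un_le le_refl le_trans)
  finally have lo: "?m \<le> real (card lo) + real (card mid) + real (card hi)" by linarith
  define B where "B = lo - D"
  have BE: "B \<subseteq> E" unfolding B_def lo_def by auto
  have BV: "B \<subseteq> nsets V 2" using BE edges by auto
  have "card lo \<le> card (B \<union> D)" unfolding B_def using fins by (intro card_mono) auto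
  also have "\<dots> \<le> card B + card D" by (rule card_Un_le)
  finally have "real (card lo) \<le> real (card B) + real (card D)" by linarith
  moreover have Db: "real (card D) \<le> bm / 20000" using D(2) unfolding bm_def by simp
  moreover have "0 \<le> real (card big)" "0 \<le> real (card mid)" by auto
  ultimately have B4: "?m / 4 \<le> real (card B)" using lo hi deficit bm by argo
  obtain v where v: "v \<in> V"
    and vB: "4 * (real (card B))\<^sup>2 \<le> ?n\<^sup>2 * real (\<Sum>e\<in>B. card (e \<inter> nbrs V B v))"
    using ex_neighbourhood_large_degree_sum[OF finite_V V BV] by blast
  define I where "I = nbrs V B v"
  have IV: "I \<subseteq> V" unfolding I_def nbrs_def by auto
  define S where "S = real (\<Sum>e\<in>E. card (e \<inter> I))"
  have S: "\<beta> * ?m / 4 \<le> S"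
  proof -
    have "(\<Sum>e\<in>B. card (e \<inter> I)) \<le> (\<Sum>e\<in>E. card (e \<inter> I))"
      using BE finite_E by (intro sum_mono2) auto
    then have le: "real (\<Sum>e\<in>B. card (e \<inter> I)) \<le> S" unfolding S_def by (simp only: of_nat_le_iff)
    have "?n\<^sup>2 * (\<beta> * ?m / 4) = \<beta> * ?n\<^sup>2 * ?m / 4" by simp
    also have "\<dots> \<le> ?m * ?m / 4" using m m0 by (intro divide_right_mono mult_right_mono) auto
    also have "\<dots> = 4 * (?m / 4)\<^sup>2" by (simp add: power2_eq_square)
    also have "\<dots> \<le> 4 * (real (card B))\<^sup>2" using B4 m0 by (intro mult_left_mono power_mono) auto
    also have "\<dots> \<le> ?n\<^sup>2 * real (\<Sum>e\<in>B. card (e \<inter> I))" using vB unfolding I_def .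
    also have "\<dots> \<le> ?n\<^sup>2 * S" using le by (intro mult_left_mono) auto
    finally show ?thesis using n by (simp only: mult_le_cancel_left_pos zero_less_power)
  qed
  have "{e \<in> E. e \<subseteq> I} \<subseteq> big \<union> D"
  proof
    fix e assume "e \<in> {e \<in> E. e \<subseteq> I}"
    then have e: "e \<in> E" "e \<subseteq> I" by auto
    then have "e \<in> nsets V 2" using edges by auto
    then obtain a b where ab: "e = {a, b}" "a \<noteq> b" "a \<in> V" "b \<in> V" unfolding nsets_2_eq by auto
    have aB: "{a, v} \<in> B" "{b, v} \<in> B" using e ab unfolding I_def nbrs_def by auto
    then have ne: "a \<noteq> v" "b \<noteq> v" using BV by (auto simp: nsets_def)
    have T3: "{a, b, v} \<in> nsets V 3" using ab ne v by (auto simp: nsets_def)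
    have T2: "nsets {a, b, v} 2 = {{a, b}, {b, v}, {a, v}}" by (rule nsets_triple[OF ab(2) ne(2,1)])
    show "e \<in> big \<union> D"
    proof (rule ccontr)
      assume ne': "e \<notin> big \<union> D"
      have "{a, b, v} \<in> triangles V E" unfolding triangles_def using T3 T2 e ab aB BE by auto
      moreover have "D \<inter> nsets {a, b, v} 2 = {}" unfolding T2 using ne' aB ab unfolding B_def by auto
      ultimately have "3 * J \<le> (\<Sum>e\<in>nsets {a, b, v} 2. g e)" by (rule cover)
      also have "\<dots> = g {a, b} + g {b, v} + g {a, v}"
        unfolding T2 using ab ne by (simp add: doubleton_eq_iff)
      finally have "3 * J \<le> g {a, b} + g {b, v} + g {a, v}" .
      moreover have "2 * g {a, v} < J" "2 * g {b, v} < J" using aB unfolding B_def lo_def by auto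
      ultimately have "2 * J \<le> g e" unfolding ab by linarith
      then show False using ne' e unfolding big_def by auto
    qed
  qed
  then have "card {e \<in> E. e \<subseteq> I} \<le> card (big \<union> D)" using fins by (intro card_mono) auto
  also have "\<dots> \<le> card big + card D" by (rule card_Un_le)
  finally have "real (card {e \<in> E. e \<subseteq> I}) \<le> real (card big) + real (card D)" by linarith
  moreover have "0 \<le> real (card mid)" by simp
  ultimately have eI: "real (card {e \<in> E. e \<subseteq> I}) \<le> bm * (43 / 10000)" using deficit Db bm by argo
  \<comment> \<open>The value \<open>\<beta> / 8\<close> maximizes
    \<open>p * \<beta> * ?m / 4 - p\<^sup>2 * ?m\<close>. The maximum \<open>bm / 64\<close> exceeds
    the edges inside \<open>I\<close> and the deficit in \<open>\<tau>\<close> together.\<close>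
  have "\<beta> / 8 * S + (2 * real (tau_t V E) - ?m)
    \<le> (1 + 2 * (\<beta> / 8)) * real (card {e \<in> E. e \<subseteq> I}) + (\<beta> / 8)\<^sup>2 * ?m"
    unfolding S_def by (rule degree_sum_le[OF IV]) (use \<beta> \<beta>2 in auto)
  moreover have "(1 + 2 * (\<beta> / 8)) * real (card {e \<in> E. e \<subseteq> I}) \<le> (9 / 8) * (bm * (43 / 10000))"
    using \<beta> \<beta>2 eI by (intro mult_mono) auto
  moreover have "\<beta> / 8 * (\<beta> * ?m / 4) \<le> \<beta> / 8 * S" using S \<beta> by (intro mult_left_mono) auto
  moreover have "\<beta> / 8 * (\<beta> * ?m / 4) = bm / 32" "(\<beta> / 8)\<^sup>2 * ?m = bm / 64"
    unfolding bm_def by (simp_all add: power2_eq_square)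
  moreover have "?m - bm / 10000 \<le> 2 * real (tau_t V E)" using \<tau>' unfolding bm_def by simp
  ultimately show False using bm(1) by argo
qed

end

text \<open>The colour of an edge is its rounded weight. If a triangle of colour sum below
  \<open>3 * J\<close> survived the deletion, the removal lemma would give cubically many triangles
  with the same colours, all of which \<open>f\<close> leaves uncovered.\<close>

lemma removal_rounding:
  fixes \<epsilon> :: real and J :: nat
  assumes \<epsilon>: "0 < \<epsilon>" and J: "0 < J"
  shows "\<exists>\<delta>>0. \<forall>(V :: 'a set) E (f :: 'a set \<Rightarrow> real). simple_graph V E \<longrightarrow> (\<forall>e\<in>E. 0 \<le> f e) \<longrightarrow>
    real (card {T \<in> triangles V E. (\<Sum>e\<in>nsets T 2. f e) < 1}) < \<delta> * real (card V) ^ 3 \<longrightarrow>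
    (\<exists>D g. D \<subseteq> E \<and> real (card D) \<le> \<epsilon> * (real (card V))\<^sup>2 \<and>
      real (\<Sum>e\<in>E. g e) \<le> 3 * J * (\<Sum>e\<in>E. f e) + card E \<and>
      (\<forall>T\<in>triangles V E. D \<inter> nsets T 2 = {} \<longrightarrow> 3 * J \<le> (\<Sum>e\<in>nsets T 2. g e :: nat)))"
proof -
  obtain \<delta> where \<delta>: "\<delta> > 0" and rem: "\<forall>(V :: 'a set) (R :: nat \<Rightarrow> 'a \<Rightarrow> 'a \<Rightarrow> bool). finite V \<longrightarrow>
    (\<exists>D\<subseteq>V \<times> V. real (card D) \<le> \<epsilon> * (real (card V))\<^sup>2 \<and>
      (\<forall>i<3 * J + 1. \<forall>j<3 * J + 1. \<forall>k<3 * J + 1. \<forall>x\<in>V. \<forall>y\<in>V. \<forall>z\<in>V.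
        R i x y \<longrightarrow> R j y z \<longrightarrow> R k x z \<longrightarrow> (x, y) \<notin> D \<longrightarrow> (y, z) \<notin> D \<longrightarrow> (x, z) \<notin> D \<longrightarrow>
        \<delta> * real (card V) ^ 3 \<le> real (card {(a, b, c) \<in> V \<times> V \<times> V. R i a b \<and> R j b c \<and> R k a c})))"
    using coloured_removal[OF \<epsilon>, where 'a = 'a, of "3 * J + 1"] by (elim exE conjE) (rule that)
  show ?thesis
  proof (intro exI[of _ "\<delta> / 27"] conjI allI impI)
    show "\<delta> / 27 > 0" using \<delta> by simp
    fix V :: "'a set" and E and f :: "'a set \<Rightarrow> real"
    assume G: "simple_graph V E" and f: "\<forall>e\<in>E. 0 \<le> f e"
      and low: "real (card {T \<in> triangles V E. (\<Sum>e\<in>nsets T 2. f e) < 1}) < \<delta> / 27 * real (card V) ^ 3"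
    interpret simple_graph V E by (rule G)
    let ?Low = "{T \<in> triangles V E. (\<Sum>e\<in>nsets T 2. f e) < 1}"
    \<comment> \<open>Rounding up preserves covering at the cost of 1 per edge. The cap bounds the
      number of colours by \<open>3 * J + 1\<close> and is harmless, since an edge of value
      \<open>3 * J\<close> covers its triangles alone.\<close>
    define g where "g = (\<lambda>e. min (3 * J) (nat \<lceil>3 * J * f e\<rceil>))"
    define R where "R = (\<lambda>i x y. {x, y} \<in> E \<and> g {x, y} = i)"
    obtain D where D: "D \<subseteq> V \<times> V" "real (card D) \<le> \<epsilon> * (real (card V))\<^sup>2"
      and many': "\<forall>i<3 * J + 1. \<forall>j<3 * J + 1. \<forall>k<3 * J + 1. \<forall>x\<in>V. \<forall>y\<in>V. \<forall>z\<in>V.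
        R i x y \<longrightarrow> R j y z \<longrightarrow> R k x z \<longrightarrow> (x, y) \<notin> D \<longrightarrow> (y, z) \<notin> D \<longrightarrow> (x, z) \<notin> D \<longrightarrow>
        \<delta> * real (card V) ^ 3 \<le> real (card {(a, b, c) \<in> V \<times> V \<times> V. R i a b \<and> R j b c \<and> R k a c})"
      using mp[OF spec[OF spec[OF rem, of V], of R] finite_V] by (elim exE conjE) (rule that)
    note many = many'[rule_format]
    define DE where "DE = E \<inter> (\<lambda>(x, y). {x, y}) ` D"
    have finD: "finite D" using D finite_V by (meson finite_SigmaI finite_subset)
    have "card DE \<le> card ((\<lambda>(x, y). {x, y}) ` D)" unfolding DE_def using finD by (intro card_mono) auto
    also have "\<dots> \<le> card D" using finD by (rule card_image_le)
    finally have cDE: "real (card DE) \<le> \<epsilon> * (real (card V))\<^sup>2" using D(2) by linarith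
    have cost: "real (\<Sum>e\<in>E. g e) \<le> 3 * J * (\<Sum>e\<in>E. f e) + card E"
    proof -
      have "real (\<Sum>e\<in>E. g e) \<le> (\<Sum>e\<in>E. 3 * J * f e + 1)"
        unfolding of_nat_sum
      proof (rule sum_mono)
        fix e assume "e \<in> E"
        then have "0 \<le> 3 * J * f e" using f by simp
        then have "real (nat \<lceil>3 * J * f e\<rceil>) \<le> 3 * J * f e + 1" by (simp add: of_nat_nat)
        then show "real (g e) \<le> 3 * J * f e + 1" unfolding g_def by linarith
      qed
      then show ?thesis by (simp add: sum.distrib sum_distrib_left)
    qed
    have gf: "T \<in> ?Low" if T: "T \<in> triangles V E" and s: "(\<Sum>e\<in>nsets T 2. g e) < 3 * J" for T
    proof -
      have sub: "nsets T 2 \<subseteq> E" using T by (auto simp: triangles_def)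
      then have fin: "finite (nsets T 2)" using finite_E finite_subset by blast
      have "3 * J * (\<Sum>e\<in>nsets T 2. f e) \<le> (\<Sum>e\<in>nsets T 2. real (g e))"
        unfolding sum_distrib_left
      proof (rule sum_mono)
        fix e assume e: "e \<in> nsets T 2"
        then have "g e \<le> (\<Sum>e\<in>nsets T 2. g e)" using fin by (intro member_le_sum) auto
        then have "g e = nat \<lceil>3 * J * f e\<rceil>" using s unfolding g_def by linarith
        then show "3 * J * f e \<le> real (g e)" using real_nat_ceiling_ge by simp
      qed
      also have "\<dots> < real (3 * J)" using s by (metis of_nat_less_iff of_nat_sum)
      finally have "real (3 * J) * (\<Sum>e\<in>nsets T 2. f e) < real (3 * J) * 1" by simp
      moreover have "0 < real (3 * J)" using J by simp
      ultimately have "(\<Sum>e\<in>nsets T 2. f e) < 1" by (simp only: mult_less_cancel_left_pos)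
      then show ?thesis using T by simp
    qed
    have cover: "3 * J \<le> (\<Sum>e\<in>nsets T 2. g e)" if T: "T \<in> triangles V E" and nD: "DE \<inter> nsets T 2 = {}" for T
    proof (rule ccontr)
      assume s: "\<not> 3 * J \<le> (\<Sum>e\<in>nsets T 2. g e)"
      have T3: "T \<in> nsets V 3" "nsets T 2 \<subseteq> E" using T by (auto simp: triangles_def)
      obtain x y z where xyz: "x \<in> V" "y \<in> V" "z \<in> V" "x \<noteq> y" "y \<noteq> z" "x \<noteq> z"
        and T2: "nsets T 2 = {{x, y}, {y, z}, {x, z}}"
        by (rule nsets_3_cases[OF T3(1)])
      have sum3: "(\<Sum>e\<in>{{x, y}, {y, z}, {x, z}}. h e) = h {x, y} + h {y, z} + h {x, z}"
        if "x \<noteq> y" "y \<noteq> z" "x \<noteq> z" for x y z :: 'a and h :: "'a set \<Rightarrow> nat"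
        using that by (simp add: doubleton_eq_iff)
      have nDD: "(a, b) \<notin> D" if "{a, b} \<in> nsets T 2" for a b
      proof
        assume "(a, b) \<in> D"
        then have "{a, b} \<in> DE" unfolding DE_def using that T3(2) by force
        then show False using nD that by blast
      qed
      define i where "i = g {x, y}"
      define j where "j = g {y, z}"
      define k where "k = g {x, z}"
      have ijk: "i < 3 * J + 1" "j < 3 * J + 1" "k < 3 * J + 1" unfolding i_def j_def k_def g_def by auto
      have sijk: "i + j + k < 3 * J" using s sum3[OF xyz(4-6), of g] unfolding T2 i_def j_def k_def by simp
      let ?Tr = "{(a, b, c) \<in> V \<times> V \<times> V. R i a b \<and> R j b c \<and> R k a c}"
      have "\<delta> * real (card V) ^ 3 \<le> real (card ?Tr)"
      proof (rule many[OF ijk xyz(1-3)])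
        show "R i x y" "R j y z" "R k x z" using T3(2) unfolding R_def i_def j_def k_def T2 by auto
        show "(x, y) \<notin> D" "(y, z) \<notin> D" "(x, z) \<notin> D" using nDD unfolding T2 by auto
      qed
      \<comment> \<open>Each of the ordered triples lies in \<open>T \<times> T \<times> T\<close>
        for an uncovered triangle \<open>T\<close>, which has 27 elements; this is the origin of
        \<open>\<delta> / 27\<close>.\<close>
      also have "card ?Tr \<le> card (\<Union>T\<in>?Low. T \<times> T \<times> T)"
      proof (rule card_mono)
        have finT: "finite T" if "T \<in> ?Low" for T using that by (auto simp: triangles_def nsets_def)
        show "finite (\<Union>T\<in>?Low. T \<times> T \<times> T)" using finite_triangles finT by (intro finite_UN_I) auto
        show "?Tr \<subseteq> (\<Union>T\<in>?Low. T \<times> T \<times> T)"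
        proof
          fix t assume "t \<in> ?Tr"
          then obtain a b c where t: "t = (a, b, c)" "a \<in> V" "b \<in> V" "c \<in> V" and RR: "R i a b" "R j b c" "R k a c"
            by auto
          have E: "{a, b} \<in> E" "{b, c} \<in> E" "{a, c} \<in> E" using RR unfolding R_def by auto
          then have ne: "a \<noteq> b" "b \<noteq> c" "a \<noteq> c" using edges by (auto simp: nsets_def)
          have N2: "nsets {a, b, c} 2 = {{a, b}, {b, c}, {a, c}}" by (rule nsets_triple[OF ne])
          have "{a, b, c} \<in> triangles V E" unfolding triangles_def using t ne E N2 by (auto simp: nsets_def)
          moreover have "(\<Sum>e\<in>nsets {a, b, c} 2. g e) < 3 * J"
            using sum3[OF ne, of g] RR sijk unfolding N2 R_def by simp
          ultimately have "{a, b, c} \<in> ?Low" by (rule gf)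
          then show "t \<in> (\<Union>T\<in>?Low. T \<times> T \<times> T)" unfolding t(1) by (intro UN_I[of "{a, b, c}"]) auto
        qed
      qed
      also have "\<dots> \<le> (\<Sum>T\<in>?Low. card (T \<times> T \<times> T))" using finite_triangles by (intro card_UN_le) simp
      also have "\<dots> = (\<Sum>T\<in>?Low. 27)"
        by (intro sum.cong refl) (auto simp: triangles_def nsets_def card_cartesian_product)
      also have "real \<dots> = 27 * real (card ?Low)" by simp
      finally show False using low by simp
    qed
    show "\<exists>D g. D \<subseteq> E \<and> real (card D) \<le> \<epsilon> * (real (card V))\<^sup>2 \<and>
      real (\<Sum>e\<in>E. g e) \<le> 3 * J * (\<Sum>e\<in>E. f e) + card E \<and>
      (\<forall>T\<in>triangles V E. D \<inter> nsets T 2 = {} \<longrightarrow> 3 * J \<le> (\<Sum>e\<in>nsets T 2. g e :: nat))"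
      using cDE cost cover by (intro exI[of _ DE] exI[of _ g]) (auto simp: DE_def)
  qed
qed

subsection \<open>Triangle packings\<close>

context simple_graph
begin

lemma triangle_edges:
  assumes "T \<in> triangles V E"
  shows "nsets T 2 \<subseteq> E" "card (nsets T 2) = 3" "\<Union> (nsets T 2) = T"
proof -
  have T: "T \<in> nsets V 3" "nsets T 2 \<subseteq> E" using assms by (auto simp: triangles_def)
  then have "finite T" "card T = 3" by (auto simp: nsets_def)
  then show "card (nsets T 2) = 3" by (simp add: card_nsets choose_two)
  show "nsets T 2 \<subseteq> E" by (rule T)
  obtain x y z where "T = {x, y, z}" "nsets T 2 = {{x, y}, {y, z}, {x, z}}"
    by (rule nsets_3_cases[OF T(1)])
  then show "\<Union> (nsets T 2) = T" by auto
qed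

text \<open>Linearity of the triple system: at most two common vertices span at most one common
  pair.\<close>

lemma triangles_share_one_edge:
  assumes "S \<in> triangles V E" "T \<in> triangles V E" "S \<noteq> T"
  shows "card (nsets S 2 \<inter> nsets T 2) \<le> 1"
proof -
  have fin: "finite S" "finite T" "card S = 3" "card T = 3"
    using assms by (auto simp: triangles_def nsets_def)
  have "S \<inter> T \<noteq> S" using assms(3) fin by (metis card_subset_eq inf.cobounded2)
  then have "S \<inter> T \<subset> S" by blast
  then have "card (S \<inter> T) < 3" using psubset_card_mono[OF fin(1)] fin(3) by metis
  then have "card (S \<inter> T) choose 2 \<le> 1" by (auto simp: numeral_3_eq_3 less_Suc_eq choose_two)
  moreover have "nsets S 2 \<inter> nsets T 2 = nsets (S \<inter> T) 2" by (auto simp: nsets_def)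
  ultimately show ?thesis using fin by (simp add: card_nsets)
qed

lemma matching_le_nu_t:
  assumes M: "M \<subseteq> (\<lambda>T. nsets T 2) ` triangles V E" "pairwise disjnt M"
  shows "card M \<le> nu_t V E"
proof -
  define P where "P = {T \<in> triangles V E. nsets T 2 \<in> M}"
  have finP: "finite P" unfolding P_def using finite_triangles by simp
  have "M \<subseteq> (\<lambda>T. nsets T 2) ` P" unfolding P_def using M(1) by blast
  then have "card M \<le> card P"
    using finP by (meson card_image_le card_mono finite_imageI le_trans)
  also have "card P \<le> nu_t V E"
  proof (rule nu_t_ge, unfold triangle_packing_def, intro conjI pairwiseI)
    show "P \<subseteq> triangles V E" unfolding P_def by auto
    fix S T assume ST: "S \<in> P" "T \<in> P" "S \<noteq> T"
    then have "nsets S 2 \<noteq> nsets T 2"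
      using triangle_edges(3) unfolding P_def by (metis (no_types, lifting) mem_Collect_eq)
    then show "disjnt (nsets S 2) (nsets T 2)"
      using ST M(2) unfolding P_def pairwise_def by blast
  qed
  finally show ?thesis .
qed

text \<open>Dividing the weights of \<open>soft_duality\<close> by \<open>1 + 2 * \<gamma>\<close>
  restores the degree bound 1 and puts this factor into the cost of \<open>f\<close>. Before
  scaling, an uncovered triangle has weight exactly \<open>\<kappa>\<close>, and the total weight is
  at most \<open>card E\<close>, being a third of the sum of loads that are at most 3.\<close>

lemma spread_packing_or_cover:
  fixes \<kappa> \<gamma> :: real
  assumes \<kappa>: "0 < \<kappa>" and \<gamma>: "0 < \<gamma>" "\<gamma> \<le> 1"
  obtains w f where
    "weighted_triples E ((\<lambda>T. nsets T 2) ` triangles V E) w \<kappa>"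
    "\<forall>e\<in>E. 0 \<le> f e"
    "(\<Sum>e\<in>E. f e) \<le> (1 + \<gamma>) * (1 + 2 * \<gamma>) * (\<Sum>S\<in>(\<lambda>T. nsets T 2) ` triangles V E. w S) + \<gamma> * card E"
    "\<kappa> * card {T \<in> triangles V E. (\<Sum>e\<in>nsets T 2. f e) < 1} \<le> card E"
proof -
  let ?H = "(\<lambda>T. nsets T 2) ` triangles V E"
  have H: "S \<subseteq> E \<and> card S = 3" if "S \<in> ?H" for S using that triangle_edges by auto
  have "\<exists>w f. (\<forall>S\<in>?H. 0 \<le> w S \<and> w S \<le> \<kappa>) \<and> (\<forall>e\<in>E. load ?H w e \<le> 1 + 2 * \<gamma>) \<and>
     (\<forall>e\<in>E. 0 \<le> f e) \<and> (\<Sum>e\<in>E. f e) \<le> (1 + \<gamma>) * (\<Sum>S\<in>?H. w S) + \<gamma> * card E \<and>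
     (\<forall>S\<in>?H. w S = \<kappa> \<or> 1 \<le> (\<Sum>e\<in>S. f e))"
    by (rule soft_duality[OF finite_E _ \<kappa> \<gamma>]) (rule H)
  then obtain w f where w: "\<forall>S\<in>?H. 0 \<le> w S \<and> w S \<le> \<kappa>" and load: "\<forall>e\<in>E. load ?H w e \<le> 1 + 2 * \<gamma>"
    and f: "\<forall>e\<in>E. 0 \<le> f e" and sumf: "(\<Sum>e\<in>E. f e) \<le> (1 + \<gamma>) * (\<Sum>S\<in>?H. w S) + \<gamma> * card E"
    and cap: "\<forall>S\<in>?H. w S = \<kappa> \<or> 1 \<le> (\<Sum>e\<in>S. f e)"
    by (elim exE conjE) (rule that)
  define s where "s = 1 + 2 * \<gamma>"
  have s: "1 \<le> s" "0 < s" "s \<le> 3" unfolding s_def using \<gamma> by auto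
  define w' where "w' = (\<lambda>S. w S / s)"
  have finH: "finite ?H" using finite_triangles by simp
  have W: "weighted_triples E ?H w' \<kappa>"
  proof
    show "finite E" by (rule finite_E)
    show "T \<subseteq> E" "card T = 3" if "T \<in> ?H" for T using H[OF that] by auto
    show "card (S \<inter> T) \<le> 1" if "S \<in> ?H" "T \<in> ?H" "S \<noteq> T" for S T
      using that triangles_share_one_edge by blast
    show "0 \<le> w' T" if "T \<in> ?H" for T using w that s unfolding w'_def by auto
    show "w' T \<le> \<kappa>" if "T \<in> ?H" for T
    proof -
      have "w T / s \<le> w T / 1" using w that s by (intro divide_left_mono) auto
      then show ?thesis using w that unfolding w'_def by fastforce
    qed
    show "0 \<le> \<kappa>" using \<kappa> by simp
    fix e assume e: "e \<in> E"
    have "(\<Sum>T\<in>?H. w' T * of_bool (e \<in> T)) = load ?H w e / s"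
      unfolding w'_def load_def by (simp add: sum_divide_distrib)
    also have "\<dots> \<le> 1" using load e s unfolding s_def by simp
    finally show "(\<Sum>T\<in>?H. w' T * of_bool (e \<in> T)) \<le> 1" .
  qed
  have sumw: "(\<Sum>S\<in>?H. w S) = s * (\<Sum>S\<in>?H. w' S)"
    unfolding w'_def using s by (simp add: sum_distrib_left)
  let ?Low = "{T \<in> triangles V E. (\<Sum>e\<in>nsets T 2. f e) < 1}"
  have inj: "inj_on (\<lambda>T. nsets T 2) ?Low"
    using triangle_edges(3) by (intro inj_onI) (metis (no_types, lifting) mem_Collect_eq)
  have "\<kappa> * card ?Low = (\<Sum>S\<in>(\<lambda>T. nsets T 2) ` ?Low. \<kappa>)" by (simp add: card_image[OF inj])
  also have "\<dots> = (\<Sum>S\<in>(\<lambda>T. nsets T 2) ` ?Low. w S)"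
  proof (rule sum.cong[OF refl])
    fix S assume "S \<in> (\<lambda>T. nsets T 2) ` ?Low"
    then show "\<kappa> = w S" using cap by force
  qed
  also have "\<dots> \<le> (\<Sum>S\<in>?H. w S)" using finH w by (intro sum_mono2) auto
  also have "\<dots> \<le> card E"
  proof -
    have "3 * (\<Sum>S\<in>?H. w S) = (\<Sum>S\<in>?H. w S * (\<Sum>e\<in>S. 1))"
      unfolding sum_distrib_left by (intro sum.cong refl) (use H in auto)
    also have "\<dots> = (\<Sum>e\<in>E. 1 * load ?H w e)" by (rule sum_load[symmetric]) (use finite_E H in auto)
    also have "\<dots> \<le> (\<Sum>e\<in>E. 3)" using load s unfolding s_def by (intro sum_mono) fastforce
    finally show ?thesis by simp
  qed
  finally have low: "\<kappa> * card ?Low \<le> card E" .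
  show thesis
    by (rule that[OF W _ _ low]) (use f sumf sumw in \<open>auto simp: s_def\<close>)
qed

end

theorem theorem1p7:
  fixes \<beta> :: real
  assumes "\<beta> > 0"
  shows "\<exists>(N::nat) (\<delta>::real). \<delta> > 0 \<and>
    (\<forall>(V::'a set) (E::'a set set).
       simple_graph V E \<longrightarrow> card V > N \<longrightarrow>
       real (card E) \<ge> \<beta> * real (card V) ^ 2 \<longrightarrow>
       real (tau_t V E) \<ge> (1 - \<delta>) * (real (card E) / 2) \<longrightarrow>
       real (nu_t V E) \<ge> (1 + \<beta>\<^sup>2 / 800) * (real (card E) / 4))"
proof -
  define c where "c = \<beta>\<^sup>2 / 800"
  \<comment> \<open>All losses from duality and the nibble amount to at most
    \<open>20 * \<gamma>\<close> in relative terms, well within the extra \<open>c\<close> by which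
    \<open>\<beta>\<^sup>2 / 400\<close> exceeds \<open>\<beta>\<^sup>2 / 800\<close>.\<close>
  define \<gamma> where "\<gamma> = c / 100"
  have c0: "0 < c" and \<gamma>0: "0 < \<gamma>" unfolding \<gamma>_def c_def using assms by auto
  obtain J :: nat where J: "14000 / \<beta>\<^sup>2 < J" using reals_Archimedean2 by blast
  have J0: "0 < J"
  proof -
    have "0 < 14000 / \<beta>\<^sup>2" using assms by simp
    then have "0 < real J" using J by linarith
    then show ?thesis by simp
  qed
  \<comment> \<open>One factor \<open>\<beta>\<close> converts the removal bound in
    \<open>n\<^sup>2\<close> into a bound in \<open>m\<close>, leaving
    \<open>\<beta>\<^sup>2 / 20000 * m\<close> deleted edges.\<close>
  have \<epsilon>0: "0 < \<beta> ^ 3 / 20000" using assms by simp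
  obtain r where r: "r > 0" and rr: "\<forall>(V :: 'a set) E (f :: 'a set \<Rightarrow> real). simple_graph V E \<longrightarrow> (\<forall>e\<in>E. 0 \<le> f e) \<longrightarrow>
    real (card {T \<in> triangles V E. (\<Sum>e\<in>nsets T 2. f e) < 1}) < r * real (card V) ^ 3 \<longrightarrow>
    (\<exists>D g. D \<subseteq> E \<and> real (card D) \<le> \<beta> ^ 3 / 20000 * (real (card V))\<^sup>2 \<and>
      real (\<Sum>e\<in>E. g e) \<le> 3 * J * (\<Sum>e\<in>E. f e) + card E \<and>
      (\<forall>T\<in>triangles V E. D \<inter> nsets T 2 = {} \<longrightarrow> 3 * J \<le> (\<Sum>e\<in>nsets T 2. g e :: nat)))"
    using removal_rounding[OF \<epsilon>0 J0, where 'a = 'a] by (elim exE conjE) (rule that)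
  obtain \<eta> where \<eta>: "\<eta> > 0" and nib: "\<forall>(X :: 'a set set) H w. weighted_triples X H w \<eta> \<longrightarrow>
    (\<exists>M\<subseteq>H. pairwise disjnt M \<and> real (card M) \<ge> (\<Sum>T\<in>H. w T) - \<gamma> * card X)"
    using nibble[OF \<gamma>0, where 'b = "'a set"] by (elim exE conjE) (rule that)
  \<comment> \<open>Chosen so that \<open>n > N\<close> gives
    \<open>n\<^sup>2 < \<eta> * r * n ^ 3\<close>: the at most \<open>m / \<eta>\<close> uncovered
    triangles are then fewer than the removal lemma tolerates.\<close>
  define N where "N = nat \<lceil>1 / (r * \<eta>)\<rceil>"
  show ?thesis
  proof (intro exI[of _ N] exI[of _ "\<beta>\<^sup>2 / 10000"] conjI allI impI)
    show "0 < \<beta>\<^sup>2 / 10000" using assms by simp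
    fix V :: "'a set" and E
    assume G: "simple_graph V E" and n: "N < card V" and m: "\<beta> * (real (card V))\<^sup>2 \<le> real (card E)"
      and \<tau>: "(1 - \<beta>\<^sup>2 / 10000) * (real (card E) / 2) \<le> real (tau_t V E)"
    interpret simple_graph V E by (rule G)
    let ?m = "real (card E)" and ?n = "real (card V)"
    let ?H = "(\<lambda>T. nsets T 2) ` triangles V E"
    have n0: "0 < ?n" using n by simp
    have V: "V \<noteq> {}" using n by auto
    have m0: "0 < ?m" using m assms n0 by (smt (verit) mult_pos_pos zero_less_power)
    have \<beta>2: "\<beta> \<le> 1 / 2"
    proof -
      have "\<beta> * ?n\<^sup>2 \<le> 1 / 2 * ?n\<^sup>2" using m card_E_le by simp
      then show ?thesis using n0 by (simp add: mult_le_cancel_right)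
    qed
    then have "\<beta>\<^sup>2 \<le> (1 / 2)\<^sup>2" using assms by (intro power_mono) auto
    then have c1: "c \<le> 1" unfolding c_def by (simp add: power2_eq_square)
    have \<gamma>1: "\<gamma> \<le> 1" unfolding \<gamma>_def using c1 by simp
    show "(1 + \<beta>\<^sup>2 / 800) * (?m / 4) \<le> real (nu_t V E)"
    proof (rule ccontr)
      assume "\<not> ?thesis"
      then have \<nu>: "real (nu_t V E) < (1 + c) * (?m / 4)" unfolding c_def by simp
      obtain w f where W: "weighted_triples E ?H w \<eta>" and f: "\<forall>e\<in>E. 0 \<le> f e"
        and sumf: "(\<Sum>e\<in>E. f e) \<le> (1 + \<gamma>) * (1 + 2 * \<gamma>) * (\<Sum>S\<in>?H. w S) + \<gamma> * ?m"
        and low: "\<eta> * card {T \<in> triangles V E. (\<Sum>e\<in>nsets T 2. f e) < 1} \<le> ?m"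
        by (rule spread_packing_or_cover[OF \<eta> \<gamma>0 \<gamma>1]) (rule that)
      obtain M where M: "M \<subseteq> ?H" "pairwise disjnt M" "(\<Sum>S\<in>?H. w S) - \<gamma> * ?m \<le> real (card M)"
        using mp[OF spec[OF spec[OF spec[OF nib, of E], of ?H], of w] W] by (elim exE conjE) (rule that)
      have "real (card M) \<le> real (nu_t V E)" using matching_le_nu_t[OF M(1,2)] by simp
      then have sw: "(\<Sum>S\<in>?H. w S) \<le> (1 + c) * (?m / 4) + \<gamma> * ?m" using \<nu> M(3) by linarith
      have "(\<Sum>e\<in>E. f e) \<le> (1 + 4 * \<gamma>) * ((1 + c) * (?m / 4) + \<gamma> * ?m) + \<gamma> * ?m"
      proof -
        have "\<gamma> * \<gamma> \<le> \<gamma> * 1 / 2" unfolding \<gamma>_def using c0 c1 by (simp add: mult_le_one field_simps)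
        then have "(1 + \<gamma>) * (1 + 2 * \<gamma>) \<le> 1 + 4 * \<gamma>" by (simp add: algebra_simps)
        then have "(1 + \<gamma>) * (1 + 2 * \<gamma>) * (\<Sum>S\<in>?H. w S) \<le> (1 + 4 * \<gamma>) * ((1 + c) * (?m / 4) + \<gamma> * ?m)"
          using sw \<gamma>0 weighted_triples.w_nonneg[OF W] by (intro mult_mono sum_nonneg) auto
        then show ?thesis using sumf by linarith
      qed
      also have "\<dots> \<le> (1 + 2 * c) * ?m / 4"
      proof -
        have "(1 + 4 * \<gamma>) * ((1 + c) * (?m / 4) + \<gamma> * ?m) + \<gamma> * ?m
            = ((1 + 4 * \<gamma>) * (1 + c + 4 * \<gamma>) + 4 * \<gamma>) * (?m / 4)" by (simp add: algebra_simps)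
        also have "\<dots> \<le> (1 + 2 * c) * (?m / 4)"
        proof (intro mult_right_mono)
          have "4 * \<gamma> * (1 + c + 4 * \<gamma>) \<le> 4 * \<gamma> * 3" using c1 \<gamma>0 unfolding \<gamma>_def by (intro mult_left_mono) auto
          moreover have "(1 + 4 * \<gamma>) * (1 + c + 4 * \<gamma>) = 1 + c + 4 * \<gamma> + 4 * \<gamma> * (1 + c + 4 * \<gamma>)"
            by (simp only: distrib_right mult_1_left)
          ultimately show "(1 + 4 * \<gamma>) * (1 + c + 4 * \<gamma>) + 4 * \<gamma> \<le> 1 + 2 * c"
            using c0 \<gamma>_def by linarith
        qed (use m0 in auto)
        finally show ?thesis by simp
      qed
      finally have sf: "(\<Sum>e\<in>E. f e) \<le> (1 + \<beta>\<^sup>2 / 400) * ?m / 4" unfolding c_def by simp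
      have few: "real (card {T \<in> triangles V E. (\<Sum>e\<in>nsets T 2. f e) < 1}) < r * ?n ^ 3"
      proof -
        have "1 / (r * \<eta>) \<le> real N" unfolding N_def by (rule real_nat_ceiling_ge)
        then have "1 / (r * \<eta>) < ?n" using n by linarith
        then have "1 < r * \<eta> * ?n" using r \<eta> by (simp add: field_simps)
        then have "1 * ?n\<^sup>2 < r * \<eta> * ?n * ?n\<^sup>2" using n0 by (intro mult_strict_right_mono) auto
        then have "?n\<^sup>2 < \<eta> * (r * ?n ^ 3)" by (simp add: power2_eq_square power3_eq_cube mult_ac)
        moreover have "?m \<le> ?n\<^sup>2" using card_E_le zero_le_power2[of ?n] by linarith
        ultimately have "\<eta> * card {T \<in> triangles V E. (\<Sum>e\<in>nsets T 2. f e) < 1} < \<eta> * (r * ?n ^ 3)"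
          using low by linarith
        then show ?thesis using \<eta> by (simp only: mult_less_cancel_left_pos)
      qed
      obtain D g where D: "D \<subseteq> E" "real (card D) \<le> \<beta> ^ 3 / 20000 * ?n\<^sup>2"
        and g: "real (\<Sum>e\<in>E. g e) \<le> 3 * J * (\<Sum>e\<in>E. f e) + ?m"
        and cover: "\<forall>T\<in>triangles V E. D \<inter> nsets T 2 = {} \<longrightarrow> 3 * J \<le> (\<Sum>e\<in>nsets T 2. g e :: nat)"
        using mp[OF mp[OF mp[OF spec[OF spec[OF spec[OF rr, of V], of E], of f] G] f] few]
        by (elim exE conjE) (rule that)
      have "real (card D) \<le> \<beta>\<^sup>2 / 20000 * (\<beta> * ?n\<^sup>2)"
        using D(2) by (simp add: power2_eq_square power3_eq_cube mult_ac)
      also have "\<dots> \<le> \<beta>\<^sup>2 / 20000 * ?m" using m by (intro mult_left_mono) auto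
      finally have cD: "real (card D) \<le> \<beta>\<^sup>2 / 20000 * ?m" .
      have "3 * J * (\<Sum>e\<in>E. f e) \<le> 3 * J * ((1 + \<beta>\<^sup>2 / 400) * ?m / 4)"
        using sf by (intro mult_left_mono) auto
      then have cost: "real (\<Sum>e\<in>E. g e) \<le> 3 * J * ((1 + \<beta>\<^sup>2 / 400) * ?m / 4) + ?m" using g by linarith
      show False
        by (rule no_cheap_almost_cover[OF V assms m \<tau> order_refl D(1) cD less_imp_le[OF J] _ cost])
          (use cover in blast)
    qed
  qed
qed

end
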